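(* Let $U\subseteq\mathbf{R}^d$ be open, $u\in\mathcal{D}'(U)$, $\tau>0$, $\sigma>1$, and let $(x_0,\xi_0)\in U\times(\mathbf{R}^d\setminus\{0\})$. Then $(x_0,\xi_0)\notin \mathrm{WF}_{\{\tau,\sigma\}}(u)$ if and only if there exist a conic neighborhood $\Gamma_0$ of $\xi_0$, a compact set $K\subset\subset U$ and $\phi\in\mathcal{D}^K_{\{\tau,\sigma\}}$ such that $\phi=1$ on a neighborhood of $x_0$ and such that $$|\widehat{\phi u}(\xi)|\le A\,\frac{h^{N^\sigma}N^{\tau N^\sigma}}{|\xi|^N},\qquad N\in\mathbf{N},\ \xi\in\Gamma_0,$$ for some constants $A,h>0$.
   Context: $\mathbf{N}$ denotes the nonnegative integers, with the convention $0^{0}=1$ (so $N^{\tau N^\sigma}=1$ for $N=0$). $\mathcal{D}'(U)$ is the space of Schwartz distributions on $U$, and $\mathcal{E}'(U)$ the space of compactly supported distributions. The Fourier transform is $\widehat u(\xi)=\int_{\mathbf{R}^d}u(x)e^{-2\pi i x\xi}\,dx$, extended to $\mathcal{E}'$. Conic neighborhoods are subsets of $\mathbf{R}^d\setminus\{0\}$. Function spaces: put $M_p^{\tau,\sigma}=p^{\tau p^\sigma}$ for $p\ge1$, $M_0^{\tau,\sigma}=1$. For $h>0$ and a regular compact set $K\subset\mathbf{R}^d$, $\mathcal{E}_{\tau,\sigma,h}(K)$ is the space of $\phi\in C^\infty(K)$ with $\sup_{\alpha\in\mathbf{N}^d}\sup_{x\in K}\frac{|\partial^\alpha\phi(x)|}{h^{|\alpha|^\sigma}M_{|\alpha|}^{\tau,\sigma}}<\infty$;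 $\mathcal{D}^K_{\tau,\sigma,h}$ is the set of functions in $\mathcal{E}_{\tau,\sigma,h}(K)$ with support contained in $K$ (regarded as smooth functions on $\mathbf{R}^d$ vanishing outside $K$); and $\mathcal{D}^K_{\{\tau,\sigma\}}=\varinjlim_{h\to\infty}\mathcal{D}^K_{\tau,\sigma,h}$, i.e. the union of these spaces over $h>0$. Wave front set: for $u\in\mathcal{D}'(U)$, $\mathrm{WF}_{\{\tau,\sigma\}}(u)\subseteq U\times(\mathbf{R}^d\setminus\{0\})$ is defined by: $(x_0,\xi_0)\notin\mathrm{WF}_{\{\tau,\sigma\}}(u)$ if there exist an open neighborhood $\Omega$ of $x_0$, a conic neighborhood $\Gamma$ of $\xi_0$ and a bounded sequence $\{u_N\}_{N\in\mathbf{N}}$ in $\mathcal{E}'(U)$ such that $u_N=u$ on $\Omega$ for all $N$ and, for some constants $A,h>0$, $$|\widehat u_N(\xi)|\le A\,\frac{h^N N!^{\tau/\sigma}}{|\xi|^{\lfloor N^{1/\sigma}\rfloor}},\qquad N\in\mathbf{N},\ \xi\in\Gamma.$$ *)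

theory Defs
  imports "HOL-Analysis.Analysis"
begin

section \<open>Smooth functions on \<open>\<real>\<^sup>d\<close>\<close>

definition partial_deriv ::
  "'n::finite \<Rightarrow> (real^'n \<Rightarrow> complex) \<Rightarrow> (real^'n \<Rightarrow> complex)" where
  "partial_deriv i f = (\<lambda>x. frechet_derivative f (at x) (axis i 1))"

definition iter_partial ::
  "'n::finite list \<Rightarrow> (real^'n \<Rightarrow> complex) \<Rightarrow> (real^'n \<Rightarrow> complex)" where
  "iter_partial is f = foldr partial_deriv is f"

text \<open>Requiring all iterated partial derivatives to be (totally) differentiable is the same as
  requiring them all to exist and be continuous. For open \<open>U\<close> the values of \<open>f\<close> outside \<open>U\<close> are
  irrelevant, so this describes \<open>C\<^sup>\<infinity>(U)\<close>.\<close>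

definition smooth_on :: "(real^'n::finite) set \<Rightarrow> (real^'n \<Rightarrow> complex) \<Rightarrow> bool" where
  "smooth_on U f \<longleftrightarrow> (\<forall>is. \<forall>x\<in>U. iter_partial is f differentiable (at x))"

text \<open>Multi-indices are functions \<open>\<alpha> :: 'n \<Rightarrow> nat\<close>. The index type carries no order, so the order in
  which \<open>\<partial>\<^sup>\<alpha>\<close> differentiates is fixed by an arbitrary enumeration of the coordinates; on smooth
  functions it does not matter.\<close>

definition coords :: "'n::finite list" where
  "coords = (SOME is. distinct is \<and> set is = UNIV)"

definition mi_order :: "('n::finite \<Rightarrow> nat) \<Rightarrow> nat" where
  "mi_order \<alpha> = (\<Sum>i\<in>UNIV. \<alpha> i)"

definition mi_deriv ::
  "('n::finite \<Rightarrow> nat) \<Rightarrow> (real^'n \<Rightarrow> complex) \<Rightarrow> (real^'n \<Rightarrow> complex)" where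
  "mi_deriv \<alpha> f = iter_partial (concat (map (\<lambda>i. replicate (\<alpha> i) i) coords)) f"

definition supp :: "(real^'n::finite \<Rightarrow> complex) \<Rightarrow> (real^'n) set" where
  "supp f = closure {x. f x \<noteq> 0}"

definition test_functions :: "(real^'n::finite) set \<Rightarrow> (real^'n \<Rightarrow> complex) set" where
  "test_functions U = {\<phi>. smooth_on UNIV \<phi> \<and> compact (supp \<phi>) \<and> supp \<phi> \<subseteq> U}"


section \<open>Distributions\<close>

type_synonym 'n functional = "(real^'n \<Rightarrow> complex) \<Rightarrow> complex"

text \<open>An element of \<open>\<D>'(U)\<close> is given by a functional on all functions, of which only the values on
  \<open>test_functions U\<close> are meaningful; everything below depends on those values only.\<close>

definition distribution :: "(real^'n::finite) set \<Rightarrow> 'n functional \<Rightarrow> bool" where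
  "distribution U u \<longleftrightarrow>
     (\<forall>\<phi>\<in>test_functions U. \<forall>\<psi>\<in>test_functions U. u (\<lambda>x. \<phi> x + \<psi> x) = u \<phi> + u \<psi>) \<and>
     (\<forall>\<phi>\<in>test_functions U. \<forall>c. u (\<lambda>x. c * \<phi> x) = c * u \<phi>) \<and>
     (\<forall>K. compact K \<and> K \<subseteq> U \<longrightarrow>
        (\<exists>C m. \<forall>\<phi>\<in>test_functions U. supp \<phi> \<subseteq> K \<longrightarrow>
           norm (u \<phi>) \<le> C * (\<Sum>\<alpha> | mi_order \<alpha> \<le> m. (SUP x. norm (mi_deriv \<alpha> \<phi> x)))))"

definition equal_on :: "(real^'n::finite) set \<Rightarrow> 'n functional \<Rightarrow> 'n functional \<Rightarrow> bool" where
  "equal_on V u v \<longleftrightarrow> (\<forall>\<psi>\<in>test_functions V. u \<psi> = v \<psi>)"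

definition mult_dist :: "(real^'n::finite \<Rightarrow> complex) \<Rightarrow> 'n functional \<Rightarrow> 'n functional" where
  "mult_dist \<phi> u = (\<lambda>\<psi>. u (\<lambda>x. \<phi> x * \<psi> x))"

definition supported_in ::
  "(real^'n::finite) set \<Rightarrow> 'n functional \<Rightarrow> (real^'n) set \<Rightarrow> bool" where
  "supported_in U v K \<longleftrightarrow> equal_on (U - K) v (\<lambda>\<psi>. 0)"

definition compact_distribution :: "(real^'n::finite) set \<Rightarrow> 'n functional \<Rightarrow> bool" where
  "compact_distribution U v \<longleftrightarrow>
     distribution U v \<and> (\<exists>K. compact K \<and> K \<subseteq> U \<and> supported_in U v K)"

text \<open>The canonical extension of \<open>v \<in> \<E>'(U)\<close> to \<open>f \<in> C\<^sup>\<infinity>(U)\<close>: the value \<open>v (\<theta> f)\<close>, which is the same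
  for all cutoffs \<open>\<theta>\<close> equal to 1 near a compact set carrying \<open>v\<close>.\<close>

definition pairing ::
  "(real^'n::finite) set \<Rightarrow> 'n functional \<Rightarrow> (real^'n \<Rightarrow> complex) \<Rightarrow> complex" where
  "pairing U v f =
     (THE c. \<exists>K W \<theta>. compact K \<and> K \<subseteq> U \<and> supported_in U v K \<and>
        open W \<and> K \<subseteq> W \<and> \<theta> \<in> test_functions U \<and> (\<forall>x\<in>W. \<theta> x = 1) \<and>
        c = v (\<lambda>x. \<theta> x * f x))"

definition fourier ::
  "(real^'n::finite) set \<Rightarrow> 'n functional \<Rightarrow> real^'n \<Rightarrow> complex" where
  "fourier U v \<xi> = pairing U v (\<lambda>x. exp (- 2 * of_real pi * \<i> * of_real (x \<bullet> \<xi>)))"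

text \<open>Boundedness in \<open>C\<^sup>\<infinity>(U)\<close> refers to its usual Frechet topology, and boundedness in \<open>\<E>'(U)\<close> to
  the strong dual topology, that is, uniform boundedness on bounded subsets of \<open>C\<^sup>\<infinity>(U)\<close>. (By
  Banach-Steinhaus the weak-* topology has the same bounded sets.)\<close>

definition bounded_smooth ::
  "(real^'n::finite) set \<Rightarrow> (real^'n \<Rightarrow> complex) set \<Rightarrow> bool" where
  "bounded_smooth U B \<longleftrightarrow>
     (\<forall>f\<in>B. smooth_on U f) \<and>
     (\<forall>K \<alpha>. compact K \<and> K \<subseteq> U \<longrightarrow> (\<exists>C. \<forall>f\<in>B. \<forall>x\<in>K. norm (mi_deriv \<alpha> f x) \<le> C))"

definition bounded_compact_seq ::
  "(real^'n::finite) set \<Rightarrow> (nat \<Rightarrow> 'n functional) \<Rightarrow> bool" where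
  "bounded_compact_seq U v \<longleftrightarrow>
     (\<forall>N. compact_distribution U (v N)) \<and>
     (\<forall>B. bounded_smooth U B \<longrightarrow> (\<exists>C. \<forall>N. \<forall>f\<in>B. norm (pairing U (v N) f) \<le> C))"


section \<open>The ultradifferentiable classes and the wave front set\<close>

text \<open>The case distinction implements \<open>M\<^sub>0 = 1\<close>, since \<open>0 powr a = 0\<close>.\<close>

definition M_seq :: "real \<Rightarrow> real \<Rightarrow> nat \<Rightarrow> real" where
  "M_seq \<tau> \<sigma> p = (if p = 0 then 1 else real p powr (\<tau> * real p powr \<sigma>))"

definition regular_compact :: "(real^'n::finite) set \<Rightarrow> bool" where
  "regular_compact K \<longleftrightarrow> compact K \<and> closure (interior K) = K"

definition D_h :: "real \<Rightarrow> real \<Rightarrow> real \<Rightarrow> (real^'n::finite) set \<Rightarrow> (real^'n \<Rightarrow> complex) set" where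
  "D_h \<tau> \<sigma> h K =
     {\<phi>. smooth_on UNIV \<phi> \<and> supp \<phi> \<subseteq> K \<and>
        (\<exists>C. \<forall>\<alpha>. \<forall>x\<in>K.
           norm (mi_deriv \<alpha> \<phi> x) /
             (h powr (real (mi_order \<alpha>) powr \<sigma>) * M_seq \<tau> \<sigma> (mi_order \<alpha>)) \<le> C)}"

definition D_roumieu :: "real \<Rightarrow> real \<Rightarrow> (real^'n::finite) set \<Rightarrow> (real^'n \<Rightarrow> complex) set" where
  "D_roumieu \<tau> \<sigma> K = (\<Union>h\<in>{0<..}. D_h \<tau> \<sigma> h K)"

text \<open>The library's \<open>cone\<close> and \<open>conic\<close> are closed under multiplication by 0, hence not usable here.\<close>

definition conic_nhd :: "real^'n::finite \<Rightarrow> (real^'n) set \<Rightarrow> bool" where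
  "conic_nhd \<xi> \<Gamma> \<longleftrightarrow>
     0 \<notin> \<Gamma> \<and> (\<forall>\<eta>\<in>\<Gamma>. \<forall>c>0. c *\<^sub>R \<eta> \<in> \<Gamma>) \<and> \<xi> \<in> interior \<Gamma>"

definition WF :: "real \<Rightarrow> real \<Rightarrow> (real^'n::finite) set \<Rightarrow> 'n functional \<Rightarrow>
    ((real^'n) \<times> (real^'n)) set" where
  "WF \<tau> \<sigma> U u =
     {(x, \<xi>). x \<in> U \<and> \<xi> \<noteq> 0 \<and>
        \<not> (\<exists>\<Omega> \<Gamma> v. open \<Omega> \<and> x \<in> \<Omega> \<and> \<Omega> \<subseteq> U \<and> conic_nhd \<xi> \<Gamma> \<and>
             bounded_compact_seq U v \<and> (\<forall>N. equal_on \<Omega> (v N) u) \<and>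
             (\<exists>A>0. \<exists>h>0. \<forall>N. \<forall>\<eta>\<in>\<Gamma>.
                norm (fourier U (v N) \<eta>) \<le>
                  A * (h ^ N * fact N powr (\<tau> / \<sigma>)) /
                    norm \<eta> ^ nat \<lfloor>real N powr (1 / \<sigma>)\<rfloor>))}"

end

theory Submission
  imports Defs "HOL-Library.Sublist"
begin

text \<open>If \<open>\<phi>\<close> as in the theorem is given, the constant sequence \<open>u\<^sub>N = \<phi> u\<close> works, with
  \<open>p = \<lfloor>N\<^bsup>1/\<sigma>\<^esup>\<rfloor>\<close> as order of decay. Conversely, given \<open>u\<^sub>N\<close>, let \<open>\<phi>\<close> be a Gevrey cutoff supported
  where all \<open>u\<^sub>N\<close> agree with \<open>u\<close>; as \<open>\<sigma> > 1\<close>, Gevrey bounds are stronger than those of the class. A bounded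
  sequence in \<open>\<E>'\<close> is equicontinuous, so the \<open>u\<^sub>N\<close> live on a common cube, on which \<open>\<phi>\<close> is the sum of a
  Fourier series. This writes the Fourier transform of \<open>\<phi> u = \<phi> u\<^sub>N\<close> at \<open>\<xi>\<close> as a superposition of translates of that of \<open>u\<^sub>N\<close>.
  Short translations stay in \<open>\<Gamma>\<close>, where the hypothesis applies with \<open>N = \<lceil>p\<^sup>\<sigma>\<rceil>\<close>; for long ones
  the fast decay of the Fourier coefficients beats the uniform polynomial growth of the transforms.\<close>

section \<open>Iterated partial derivatives\<close>

text \<open>A Fourier series in place of a convolution integral leads to sums over lattice
  frequencies, and a tensor product as \<open>\<phi>\<close> makes derivatives, coefficients and
  these sums factor into one-dimensional ones. The obstacle is that the uniform bound on the
  \<open>u\<^sub>N\<close> involves m derivatives on a compact set K that can be much larger than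
  the support of \<phi>: the periodic series has to approximate \<phi> with its derivatives up to
  order m on all of K, so the period cell must contain K as well as that support in its interior.
  Since m, K and the constant do not depend on N, the index N may vary with the decay order p while
  \<phi> stays fixed. A long translation costs m + p powers of the frequency; the Gevrey
  coefficients pay for them with a factor const^p (2 p + const)!^d, of size p^(const p), and p is
  eventually below any positive multiple of p^\<sigma>. The index ceiling(p^\<sigma>) is right for
  two reasons: the floor of its \<sigma>-th root is exactly p, and its factorial to the power
  \<tau>/\<sigma> exceeds p^(\<tau> p^\<sigma>) by at most a factor h^(p^\<sigma>).\<close>

lemma iter_partial_Nil [simp]: "iter_partial [] f = f"
  and iter_partial_Cons [simp]: "iter_partial (i # is) f = partial_deriv i (iter_partial is f)"
  by (simp_all add: iter_partial_def)

lemma smooth_onD: "smooth_on U f \<Longrightarrow> x \<in> U \<Longrightarrow> iter_partial is f differentiable (at x)"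
  by (simp add: smooth_on_def)

lemma smooth_on_subset: "smooth_on U f \<Longrightarrow> V \<subseteq> U \<Longrightarrow> smooth_on V f"
  by (auto simp: smooth_on_def)

lemma partial_deriv_has_derivative:
  "(f has_derivative D) (at x) \<Longrightarrow> partial_deriv i f x = D (axis i 1)"
  unfolding partial_deriv_def by (metis frechet_derivative_at)

lemma differentiable_has_derivative:
  "f differentiable (at x) \<Longrightarrow> (f has_derivative frechet_derivative f (at x)) (at x)"
  using frechet_derivative_works by blast

lemma differentiable_cong_open:
  assumes "open U" "x \<in> U" "\<And>y. y \<in> U \<Longrightarrow> f y = g y" "g differentiable (at x)"
  shows "f differentiable (at x)"
  using assms by (metis differentiable_def has_derivative_transform_within_open)

lemma partial_deriv_cong_open:
  assumes "open U" "x \<in> U" "\<And>y. y \<in> U \<Longrightarrow> f y = g y" "g differentiable (at x)"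
  shows "partial_deriv i f x = partial_deriv i g x"
proof -
  have "(g has_derivative frechet_derivative g (at x)) (at x)"
    using assms(4) frechet_derivative_works by blast
  then have "(f has_derivative frechet_derivative g (at x)) (at x)"
    using assms by (metis has_derivative_transform_within_open)
  then show ?thesis
    by (metis partial_deriv_def frechet_derivative_at)
qed

text \<open>To compute all iterated derivatives of \<open>f\<close> it suffices to guess a family indexed by lists
  that is closed under partial differentiation.\<close>

lemma iter_partialI:
  assumes "open U" and f: "\<And>x. x \<in> U \<Longrightarrow> f x = G [] x"
    and diff: "\<And>is x. x \<in> U \<Longrightarrow> G is differentiable (at x)"
    and step: "\<And>is i x. x \<in> U \<Longrightarrow> partial_deriv i (G is) x = G (i # is) x"
  shows "x \<in> U \<Longrightarrow> iter_partial is f x = G is x" and "smooth_on U f"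
proof -
  have eq: "\<forall>x\<in>U. iter_partial is f x = G is x" for "is"
  proof (induction "is")
    case (Cons i "is")
    then show ?case
      using partial_deriv_cong_open[OF \<open>open U\<close>, of _ "iter_partial is f" "G is"] diff step by simp
  qed (simp add: f)
  then show "x \<in> U \<Longrightarrow> iter_partial is f x = G is x"
    by blast
  show "smooth_on U f"
    unfolding smooth_on_def using eq diff differentiable_cong_open[OF \<open>open U\<close>] by metis
qed

lemma iter_partial_cong:
  assumes "open U" "smooth_on U g" "\<And>x. x \<in> U \<Longrightarrow> f x = g x"
  shows "x \<in> U \<Longrightarrow> iter_partial is f x = iter_partial is g x" and "smooth_on U f"
  using iter_partialI[OF assms(1), of f "\<lambda>is. iter_partial is g"] assms
  by (auto simp: smooth_on_def)

lemma smooth_on_Un: 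
  assumes "smooth_on U f" "smooth_on V f" shows "smooth_on (U \<union> V) f"
  using assms by (auto simp: smooth_on_def)

lemma iter_partial_const:
  shows "iter_partial is (\<lambda>x. c) x = (if is = [] then c else 0)" and "smooth_on U (\<lambda>x. c)"
proof -
  note * = iter_partialI[of UNIV "\<lambda>x. c" "\<lambda>is x. if is = [] then c else 0"]
  show "iter_partial is (\<lambda>x. c) x = (if is = [] then c else 0)"
    by (rule *) (auto simp: partial_deriv_def)
  have "smooth_on UNIV (\<lambda>x. c)" by (rule *) (auto simp: partial_deriv_def)
  then show "smooth_on U (\<lambda>x. c)" using smooth_on_subset by blast
qed

lemma iter_partial_add:
  assumes U: "open U" and f: "smooth_on U f" and g: "smooth_on U g"
  shows "x \<in> U \<Longrightarrow> iter_partial is (\<lambda>x. f x + g x) x = iter_partial is f x + iter_partial is g x"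
    and "smooth_on U (\<lambda>x. f x + g x)"
proof -
  note * = iter_partialI[OF U, of "\<lambda>x. f x + g x"
      "\<lambda>is x. iter_partial is f x + iter_partial is g x"]
  have d: "partial_deriv i (\<lambda>x. iter_partial is f x + iter_partial is g x) x =
      iter_partial (i # is) f x + iter_partial (i # is) g x" if "x \<in> U" for i "is" x
    by (subst partial_deriv_has_derivative[OF has_derivative_add
          [OF differentiable_has_derivative[OF smooth_onD[OF f that]]
              differentiable_has_derivative[OF smooth_onD[OF g that]]]])
       (simp add: partial_deriv_def)
  show "x \<in> U \<Longrightarrow> iter_partial is (\<lambda>x. f x + g x) x = iter_partial is f x + iter_partial is g x"
    by (rule *) (use f g d in \<open>auto intro: smooth_onD differentiable_add\<close>)
  show "smooth_on U (\<lambda>x. f x + g x)"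
    by (rule *) (use f g d in \<open>auto intro: smooth_onD differentiable_add\<close>)
qed

lemma iter_partial_cmult:
  assumes U: "open U" and f: "smooth_on U f"
  shows "x \<in> U \<Longrightarrow> iter_partial is (\<lambda>x. c * f x) x = c * iter_partial is f x"
    and "smooth_on U (\<lambda>x. c * f x)"
proof -
  note * = iter_partialI[OF U, of "\<lambda>x. c * f x" "\<lambda>is x. c * iter_partial is f x"]
  have d: "partial_deriv i (\<lambda>x. c * iter_partial is f x) x = c * iter_partial (i # is) f x"
    if "x \<in> U" for i "is" x
    by (subst partial_deriv_has_derivative[OF has_derivative_mult_right
          [OF differentiable_has_derivative[OF smooth_onD[OF f that]]]])
       (simp add: partial_deriv_def)
  show "x \<in> U \<Longrightarrow> iter_partial is (\<lambda>x. c * f x) x = c * iter_partial is f x"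
    by (rule *) (use f d in \<open>auto intro: smooth_onD differentiable_mult differentiable_const\<close>)
  show "smooth_on U (\<lambda>x. c * f x)"
    by (rule *) (use f d in \<open>auto intro: smooth_onD differentiable_mult differentiable_const\<close>)
qed

lemma iter_partial_diff:
  assumes U: "open U" and f: "smooth_on U f" and g: "smooth_on U g"
  shows "x \<in> U \<Longrightarrow> iter_partial is (\<lambda>x. f x - g x) x = iter_partial is f x - iter_partial is g x"
    and "smooth_on U (\<lambda>x. f x - g x)"
  using iter_partial_add[OF U f iter_partial_cmult(2)[OF U g, of "-1"]]
    iter_partial_cmult(1)[OF U g, of _ _ "-1"] by simp_all

lemma smooth_on_sum:
  assumes U: "open U" and f: "\<And>k. k \<in> S \<Longrightarrow> smooth_on U (f k)"
  shows "smooth_on U (\<lambda>x. \<Sum>k\<in>S. f k x)"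
  using f by (induction S rule: infinite_finite_induct)
    (auto intro: iter_partial_const iter_partial_add(2)[OF U])

subsection \<open>The Leibniz rule\<close>

text \<open>All ways of distributing the derivatives in a list over two factors. The order within the
  list is kept, so the parts of a list representing a multi-index again represent multi-indices.\<close>

fun splits :: "'a list \<Rightarrow> ('a list \<times> 'a list) list" where
  "splits [] = [([], [])]"
| "splits (i # is) = map (\<lambda>(a, b). (i # a, b)) (splits is) @ map (\<lambda>(a, b). (a, i # b)) (splits is)"

lemma length_splits: "length (splits is) = 2 ^ length is"
  by (induction "is") auto

lemma splits_subseq: "(a, b) \<in> set (splits is) \<Longrightarrow> subseq a is \<and> subseq b is"
  by (induction "is" arbitrary: a b) auto

lemma has_derivative_sum_list:
  assumes "\<And>p. p \<in> set ps \<Longrightarrow> (f p has_derivative D p) (at x)"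
  shows "((\<lambda>x. \<Sum>p\<leftarrow>ps. f p x) has_derivative (\<lambda>h. \<Sum>p\<leftarrow>ps. D p h)) (at x)"
  using assms by (induction ps) (auto intro!: has_derivative_add)

text \<open>The recursion of \<open>splits\<close> is the product rule itself, so the family
  \<open>G\<close> is closed under \<open>partial_deriv\<close>.\<close>

lemma iter_partial_mult:
  assumes U: "open U" and f: "smooth_on U f" and g: "smooth_on U g"
  shows "x \<in> U \<Longrightarrow> iter_partial is (\<lambda>x. f x * g x) x =
      (\<Sum>(a, b)\<leftarrow>splits is. iter_partial a f x * iter_partial b g x)"
    and "smooth_on U (\<lambda>x. f x * g x)"
proof -
  define G where "G = (\<lambda>is x. \<Sum>p\<leftarrow>splits is. iter_partial (fst p) f x * iter_partial (snd p) g x)"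
  note * = iter_partialI[OF U, of "\<lambda>x. f x * g x" G]
  have D: "(G is has_derivative (\<lambda>h. \<Sum>p\<leftarrow>splits is.
      iter_partial (fst p) f x * frechet_derivative (iter_partial (snd p) g) (at x) h +
      frechet_derivative (iter_partial (fst p) f) (at x) h * iter_partial (snd p) g x)) (at x)"
    if "x \<in> U" for "is" x
    unfolding G_def
    by (intro has_derivative_sum_list has_derivative_mult differentiable_has_derivative
        smooth_onD[OF f that] smooth_onD[OF g that])
  have d1: "G is differentiable (at x)" if "x \<in> U" for "is" x
    using D[OF that] by (auto simp: differentiable_def)
  have d2: "partial_deriv i (G is) x = G (i # is) x" if "x \<in> U" for "is" i x
    unfolding partial_deriv_has_derivative[OF D[OF that]]
    by (simp add: G_def partial_deriv_def sum_list_addf o_def case_prod_unfold)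
  show "x \<in> U \<Longrightarrow> iter_partial is (\<lambda>x. f x * g x) x =
      (\<Sum>(a, b)\<leftarrow>splits is. iter_partial a f x * iter_partial b g x)"
    using *(1)[OF _ d1 d2] by (auto simp: G_def case_prod_unfold)
  show "smooth_on U (\<lambda>x. f x * g x)"
    using *(2)[OF _ d1 d2] by (auto simp: G_def)
qed

text \<open>The Leibniz sum has \<open>2 ^ length is\<close> terms. Bounds are demanded only on
  subsequences of the list, so that the lemma can be applied when nothing but the derivatives
  \<open>mi_deriv\<close> is controlled.\<close>

lemma norm_iter_partial_mult_le:
  assumes U: "open U" and f: "smooth_on U f" and g: "smooth_on U g" and "x \<in> U"
    and A: "\<And>a. subseq a is \<Longrightarrow> norm (iter_partial a f x) \<le> A"
    and B: "\<And>a. subseq a is \<Longrightarrow> norm (iter_partial a g x) \<le> B"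
  shows "norm (iter_partial is (\<lambda>x. f x * g x) x) \<le> 2 ^ length is * A * B"
proof -
  have "A \<ge> 0" using A[of "[]"] by (smt (verit) list_emb_Nil norm_ge_zero)
  have *: "norm (iter_partial a f x * iter_partial b g x) \<le> A * B" 
    if "(a, b) \<in> set (splits is)" for a b
    using A B splits_subseq[OF that] \<open>A \<ge> 0\<close> by (auto simp: norm_mult intro!: mult_mono)
  have "norm (\<Sum>p\<leftarrow>ps. iter_partial (fst p) f x * iter_partial (snd p) g x) \<le> length ps * (A * B)" 
    if "set ps \<subseteq> set (splits is)" for ps
    using that
  proof (induction ps)
    case (Cons p ps)
    then show ?case using *[of "fst p" "snd p"] 
      by (auto simp: algebra_simps intro!: order.trans[OF norm_triangle_ineq] add_mono)
  qed auto
  from this[of "splits is"] show ?thesis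
    by (simp add: iter_partial_mult(1)[OF U f g \<open>x \<in> U\<close>] case_prod_unfold length_splits mult.assoc)
qed

lemma smooth_on_prod:
  assumes U: "open U" and f: "\<And>k. k \<in> S \<Longrightarrow> smooth_on U (f k)"
  shows "smooth_on U (\<lambda>x. \<Prod>k\<in>S. f k x)"
  using f by (induction S rule: infinite_finite_induct)
    (auto intro: iter_partial_const iter_partial_mult(2)[OF U])

subsection \<open>Tensor products\<close>

text \<open>All derivatives are carried along as one sequence, so that products, chain rule and
  termwise bounds become statements about sequences.\<close>

definition deriv_seq :: "(nat \<Rightarrow> real \<Rightarrow> complex) \<Rightarrow> bool" where
  "deriv_seq F \<longleftrightarrow> (\<forall>k t. (F k has_vector_derivative F (Suc k) t) (at t))"

definition tensor :: "('n::finite \<Rightarrow> nat \<Rightarrow> real \<Rightarrow> complex) \<Rightarrow> real^'n \<Rightarrow> complex" where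
  "tensor F x = (\<Prod>i\<in>UNIV. F i 0 (x $ i))"

text \<open>A partial derivative hits exactly one factor, so only the number of occurrences of each
  coordinate in the list matters, not their order.\<close>

lemma iter_partial_tensor:
  fixes F :: "'n::finite \<Rightarrow> nat \<Rightarrow> real \<Rightarrow> complex"
  assumes F: "\<And>i. deriv_seq (F i)"
  shows "iter_partial is (tensor F) x = (\<Prod>i\<in>UNIV. F i (count_list is i) (x $ i))"
    and "smooth_on U (tensor F)"
proof -
  define G where "G = (\<lambda>is x. \<Prod>i\<in>UNIV. F i (count_list is i) (x $ i))"
  note * = iter_partialI[OF open_UNIV, of "tensor F" G]
  have D1: "((\<lambda>x. F i k (x $ i)) has_derivative (\<lambda>h. (h $ i) *\<^sub>R F i (Suc k) (x $ i))) (at x)"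
    for i k and x :: "real^'n"
  proof -
    have "(F i k has_derivative (\<lambda>h. h *\<^sub>R F i (Suc k) (x $ i))) (at (x $ i))"
      using F[of i] by (simp add: deriv_seq_def has_vector_derivative_def)
    from has_derivative_compose[OF bounded_linear.has_derivative
        [OF bounded_linear_vec_nth has_derivative_ident] this]
    show ?thesis .
  qed
  have D: "(G is has_derivative (\<lambda>h. \<Sum>i\<in>UNIV. ((h $ i) *\<^sub>R F i (Suc (count_list is i)) (x $ i)) *
      (\<Prod>j\<in>UNIV - {i}. F j (count_list is j) (x $ j)))) (at x)" for "is" x
    unfolding G_def by (intro has_derivative_prod D1)
  have d2: "partial_deriv i (G is) x = G (i # is) x" for "is" i x
  proof -
    have "partial_deriv i (G is) x = (\<Sum>j\<in>UNIV. if j = i then F i (Suc (count_list is i)) (x $ i) *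
      (\<Prod>j\<in>UNIV - {i}. F j (count_list is j) (x $ j)) else 0)"
      unfolding partial_deriv_has_derivative[OF D] by (intro sum.cong) (auto simp: axis_def)
    also have "(\<Prod>j\<in>UNIV - {i}. F j (count_list is j) (x $ j)) =
        (\<Prod>j\<in>UNIV - {i}. F j (count_list (i # is) j) (x $ j))"
      by (intro prod.cong) auto
    also have "(\<Sum>j\<in>UNIV. if j = i then F i (Suc (count_list is i)) (x $ i) *
        (\<Prod>j\<in>UNIV - {i}. F j (count_list (i # is) j) (x $ j)) else 0) =
      F i (count_list (i # is) i) (x $ i) *
        (\<Prod>j\<in>UNIV - {i}. F j (count_list (i # is) j) (x $ j))"
      by (simp del: count_list.simps(2)) simp
    also have "\<dots> = G (i # is) x"
      unfolding G_def by (subst (2) prod.remove[of _ i]) auto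
    finally show ?thesis .
  qed
  have d1: "G is differentiable (at x)" for "is" x
    using D by (auto simp: differentiable_def)
  have "tensor F x = G [] x" for x by (simp add: tensor_def G_def)
  note ** = *[OF this d1 d2]
  show "iter_partial is (tensor F) x = (\<Prod>i\<in>UNIV. F i (count_list is i) (x $ i))"
    using **(1) by (simp add: G_def)
  show "smooth_on U (tensor F)" using **(2) smooth_on_subset by blast
qed

section \<open>Plane waves and their derivatives\<close>

definition plane_wave :: "real^'n::finite \<Rightarrow> real^'n \<Rightarrow> complex" where
  "plane_wave \<xi> x = exp (- 2 * of_real pi * \<i> * of_real (x \<bullet> \<xi>))"

lemma iter_partial_plane_wave:
  shows "iter_partial is (plane_wave \<xi>) x = (\<Prod>i\<leftarrow>is. - 2 * of_real pi * \<i> * of_real (\<xi> $ i)) * plane_wave \<xi> x"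
    and "smooth_on U (plane_wave \<xi>)"
proof -
  define c where "c = (\<lambda>i. - 2 * of_real pi * \<i> * complex_of_real (\<xi> $ i))"
  define G where "G = (\<lambda>is x. (\<Prod>i\<leftarrow>is. c i) * plane_wave \<xi> x)"
  note * = iter_partialI[OF open_UNIV, of "plane_wave \<xi>" G]
  have D: "(G is has_derivative (\<lambda>h. (\<Prod>i\<leftarrow>is. c i) *
     (- 2 * of_real pi * \<i> * of_real (h \<bullet> \<xi>) * plane_wave \<xi> x))) (at x)" for "is" x
  proof -
    have "((\<lambda>x. - 2 * of_real pi * \<i> * complex_of_real (x \<bullet> \<xi>)) has_derivative
        (\<lambda>h. - 2 * of_real pi * \<i> * of_real (h \<bullet> \<xi>))) (at x)"
      by (auto intro!: derivative_eq_intros)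
    from has_derivative_compose[OF this, of exp] DERIV_exp
    have "(plane_wave \<xi> has_derivative
        (\<lambda>h. plane_wave \<xi> x * (- 2 * of_real pi * \<i> * of_real (h \<bullet> \<xi>)))) (at x)"
      unfolding plane_wave_def has_field_derivative_def by blast
    then show ?thesis
      unfolding G_def by (auto intro!: derivative_eq_intros simp: mult_ac)
  qed
  have d2: "partial_deriv i (G is) x = G (i # is) x" for "is" i x
    unfolding partial_deriv_has_derivative[OF D]
    by (simp add: G_def c_def inner_axis' algebra_simps)
  have d1: "G is differentiable (at x)" for "is" x
    using D by (auto simp: differentiable_def)
  have "plane_wave \<xi> x = G [] x" for x by (simp add: G_def)
  note ** = *[OF this d1 d2]
  show "iter_partial is (plane_wave \<xi>) x = (\<Prod>i\<leftarrow>is. - 2 * of_real pi * \<i> * of_real (\<xi> $ i)) * plane_wave \<xi> x"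
    using **(1) by (simp add: G_def c_def)
  show "smooth_on U (plane_wave \<xi>)" using **(2) smooth_on_subset by blast
qed

lemma norm_plane_wave [simp]: "norm (plane_wave \<xi> x) = 1"
  by (simp add: plane_wave_def)

text \<open>The summand 1 keeps the base at least 1, so that shorter lists are covered by the power
  for the maximal length.\<close>

lemma norm_iter_partial_plane_wave_le:
  "norm (iter_partial is (plane_wave \<xi>) x) \<le> (1 + 2 * pi * norm \<xi>) ^ length is"
proof -
  have "norm (\<Prod>i\<leftarrow>is. - 2 * of_real pi * \<i> * complex_of_real (\<xi> $ i)) \<le> (1 + 2 * pi * norm \<xi>) ^ length is"
  proof (induction "is")
    case (Cons i "is")
    have "norm (- 2 * of_real pi * \<i> * complex_of_real (\<xi> $ i)) \<le> 1 + 2 * pi * norm \<xi>"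
      using component_le_norm_cart[of \<xi> i] by (simp add: norm_mult)
        (smt (verit) mult_left_mono pi_gt_zero)
    with Cons show ?case by (auto simp: norm_mult intro!: mult_mono)
  qed auto
  then show ?thesis by (simp add: iter_partial_plane_wave norm_mult)
qed

section \<open>Seminorms and test functions\<close>

definition mi_list :: "('n::finite \<Rightarrow> nat) \<Rightarrow> 'n list" where
  "mi_list \<alpha> = concat (map (\<lambda>i. replicate (\<alpha> i) i) coords)"

lemma mi_deriv_eq: "mi_deriv \<alpha> f = iter_partial (mi_list \<alpha>) f"
  by (simp add: mi_deriv_def mi_list_def)

lemma coords: "distinct (coords :: 'n::finite list)" "set (coords :: 'n list) = UNIV"
proof -
  have "\<exists>is::'n list. distinct is \<and> set is = UNIV"
    using finite_distinct_list[of "UNIV :: 'n set"] by auto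
  from someI_ex[OF this] show "distinct (coords :: 'n list)" "set (coords :: 'n list) = UNIV"
    by (auto simp: coords_def)
qed

lemma length_mi_list [simp]: "length (mi_list \<alpha>) = mi_order \<alpha>"
proof -
  have "length (mi_list \<alpha>) = (\<Sum>i\<leftarrow>coords. \<alpha> i)"
    by (simp add: mi_list_def length_concat o_def)
  also have "\<dots> = mi_order \<alpha>"
    using coords[where 'n='a] by (simp add: sum_list_distinct_conv_sum_set mi_order_def)
  finally show ?thesis .
qed

lemma count_list_mi_list [simp]: "count_list (mi_list \<alpha>) i = \<alpha> i"
proof -
  have "count_list (concat (map (\<lambda>i. replicate (\<alpha> i) i) cs)) i = (if i \<in> set cs then \<alpha> i else 0)"
    if "distinct cs" for cs
  proof -
    have rep: "count_list (replicate n j) i = (if j = i then n else 0)" for n and j :: 'a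
      by (induction n) auto
    show ?thesis using that by (induction cs) (auto simp: count_list_append rep)
  qed
  then show ?thesis using coords[where 'n='a] by (auto simp: mi_list_def)
qed

text \<open>A subsequence of blocks arranged in the order of \<open>coords\<close> is again such an
  arrangement. This keeps the Leibniz rule inside the derivatives that the seminorms test.\<close>

lemma subseq_mi_list:
  assumes "subseq a (mi_list \<alpha>)"
  shows "\<exists>\<beta>. a = mi_list \<beta> \<and> mi_order \<beta> \<le> mi_order \<alpha>"
proof -
  have "\<exists>\<beta>. a = concat (map (\<lambda>i. replicate (\<beta> i) i) cs)"
    if "subseq a (concat (map (\<lambda>i. replicate (\<alpha> i) i) cs))" "distinct cs" for cs a
    using that
  proof (induction cs arbitrary: a)
    case (Cons i cs)
    have "subseq a (replicate (\<alpha> i) i @ concat (map (\<lambda>i. replicate (\<alpha> i) i) cs))"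
      using Cons.prems(1) by simp
    then obtain a1 a2 where a: "a = a1 @ a2" "subseq a1 (replicate (\<alpha> i) i)"
      "subseq a2 (concat (map (\<lambda>i. replicate (\<alpha> i) i) cs))"
      unfolding subseq_append_iff by blast
    then obtain \<beta> where b: "a2 = concat (map (\<lambda>i. replicate (\<beta> i) i) cs)"
      using Cons.IH[OF a(3)] Cons.prems(2) by auto
    have "\<forall>j\<in>set a1. j = i"
      using list_emb_set[OF a(2)] by (metis in_set_replicate)
    from replicate_length_same[OF this] obtain n where n: "a1 = replicate n i"
      by metis
    \<comment> \<open>Changing \<open>\<beta>\<close> at \<open>i\<close> does not affect the tail,
      because \<open>i\<close> does not occur in \<open>cs\<close>.\<close>
    have "map (\<lambda>j. replicate ((\<beta>(i := n)) j) j) cs = map (\<lambda>i. replicate (\<beta> i) i) cs"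
      using Cons.prems by (intro map_cong) auto
    then have "a = concat (map (\<lambda>j. replicate ((\<beta>(i := n)) j) j) (i # cs))"
      by (simp only: a(1) b n list.map concat.simps fun_upd_same)
    then show ?case by blast
  qed auto
  from this[of a coords] obtain \<beta> where "a = mi_list \<beta>"
    using assms coords[where 'n='a] by (auto simp: mi_list_def)
  then show ?thesis using list_emb_length[OF assms] by auto
qed

lemma finite_mi_order_le: "finite {\<alpha> :: 'n::finite \<Rightarrow> nat. mi_order \<alpha> \<le> m}"
proof (rule finite_subset)
  show "{\<alpha> :: 'n \<Rightarrow> nat. mi_order \<alpha> \<le> m} \<subseteq> PiE UNIV (\<lambda>_. {..m})"
  proof safe
    fix \<alpha> :: "'n \<Rightarrow> nat" and i assume "mi_order \<alpha> \<le> m"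
    then show "\<alpha> i \<le> m"
      using member_le_sum[of i UNIV \<alpha>] by (simp add: mi_order_def)
  qed simp
qed (auto intro: finite_PiE)

text \<open>A relation with an explicit bound avoids suprema and their boundedness conditions. For
  empty \<open>K\<close> it holds even for negative \<open>B\<close>, whence the separate hypotheses
  \<open>B \<ge> 0\<close> below.\<close>

definition deriv_le :: "nat \<Rightarrow> (real^'n::finite) set \<Rightarrow> (real^'n \<Rightarrow> complex) \<Rightarrow> real \<Rightarrow> bool" where
  "deriv_le m K f B \<longleftrightarrow> (\<forall>\<alpha>. mi_order \<alpha> \<le> m \<longrightarrow> (\<forall>x\<in>K. norm (mi_deriv \<alpha> f x) \<le> B))"

lemma deriv_leI:
  assumes "\<And>is x. length is \<le> m \<Longrightarrow> x \<in> K \<Longrightarrow> norm (iter_partial is f x) \<le> B"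
  shows "deriv_le m K f B"
  using assms by (auto simp: deriv_le_def mi_deriv_eq)

lemma deriv_le_mono: "deriv_le m K f B \<Longrightarrow> m' \<le> m \<Longrightarrow> K' \<subseteq> K \<Longrightarrow> B \<le> B' \<Longrightarrow> deriv_le m' K' f B'"
  unfolding deriv_le_def by (meson order_trans subsetD)

lemma deriv_le_mult:
  assumes "open U" "smooth_on U f" "smooth_on U g" "K \<subseteq> U" "A \<ge> 0" "B \<ge> 0"
    and A: "deriv_le m K f A" and B: "deriv_le m K g B"
  shows "deriv_le m K (\<lambda>x. f x * g x) (2 ^ m * A * B)"
  unfolding deriv_le_def
proof (intro allI impI ballI)
  fix \<alpha> :: "'a \<Rightarrow> nat" and x assume \<alpha>: "mi_order \<alpha> \<le> m" and x: "x \<in> K"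
  have "norm (mi_deriv \<alpha> (\<lambda>x. f x * g x) x) \<le> 2 ^ length (mi_list \<alpha>) * A * B"
    unfolding mi_deriv_eq
  proof (rule norm_iter_partial_mult_le[OF assms(1-3)])
    fix a assume "subseq a (mi_list \<alpha>)"
    then obtain \<beta> where "a = mi_list \<beta>" "mi_order \<beta> \<le> m"
      using subseq_mi_list \<alpha> by (meson order_trans)
    then show "norm (iter_partial a f x) \<le> A" "norm (iter_partial a g x) \<le> B"
      using A B x by (auto simp: deriv_le_def mi_deriv_eq)
  qed (use x assms in auto)
  also have "\<dots> \<le> 2 ^ m * A * B"
    using \<alpha> assms by (intro mult_right_mono) (auto intro: power_increasing)
  finally show "norm (mi_deriv \<alpha> (\<lambda>x. f x * g x) x) \<le> 2 ^ m * A * B" .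
qed

lemma deriv_le_cmult:
  assumes "open U" "smooth_on U f" "K \<subseteq> U" "deriv_le m K f B"
  shows "deriv_le m K (\<lambda>x. c * f x) (norm c * B)"
  using assms iter_partial_cmult(1)[OF assms(1,2)]
  by (auto simp: deriv_le_def mi_deriv_eq norm_mult subset_iff intro!: mult_left_mono)

lemma smooth_on_imp_continuous_on:
  assumes "smooth_on U f"
  shows "continuous_on U (iter_partial is f)"
  by (meson assms continuous_at_imp_continuous_on differentiable_imp_continuous_within smooth_onD)

lemma smooth_on_bounded:
  assumes "smooth_on U f" "compact K" "K \<subseteq> U"
  shows "\<exists>B\<ge>0. \<forall>x\<in>K. norm (iter_partial is f x) \<le> B"
proof -
  have "compact (iter_partial is f ` K)"
    by (rule compact_continuous_image[OF continuous_on_subset[OF smooth_on_imp_continuous_on]])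
      (use assms in auto)
  then obtain B where "\<forall>y\<in>iter_partial is f ` K. norm y \<le> B"
    using compact_imp_bounded bounded_iff by metis
  then show ?thesis by (intro exI[of _ "max B 0"]) auto
qed

lemma smooth_on_deriv_le:
  fixes f :: "real^'n::finite \<Rightarrow> complex"
  assumes "smooth_on U f" "compact K" "K \<subseteq> U"
  shows "\<exists>B\<ge>0. deriv_le m K f B"
proof -
  obtain B where B: "\<And>is. B is \<ge> 0" "\<And>is x. x \<in> K \<Longrightarrow> norm (iter_partial is f x) \<le> B is"
    using smooth_on_bounded[OF assms] by metis
  let ?S = "{\<alpha> :: 'n \<Rightarrow> nat. mi_order \<alpha> \<le> m}"
  show ?thesis
  proof (intro exI conjI)
    show "0 \<le> (\<Sum>\<alpha>\<in>?S. B (mi_list \<alpha>))" using B by (auto intro: sum_nonneg)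
    show "deriv_le m K f (\<Sum>\<alpha>\<in>?S. B (mi_list \<alpha>))"
      unfolding deriv_le_def mi_deriv_eq
    proof (intro allI impI ballI)
      fix \<alpha> :: "'n \<Rightarrow> nat" and x assume "mi_order \<alpha> \<le> m" "x \<in> K"
      then have "B (mi_list \<alpha>) \<le> (\<Sum>\<alpha>\<in>?S. B (mi_list \<alpha>))"
        using finite_mi_order_le B by (intro member_le_sum) auto
      then show "norm (iter_partial (mi_list \<alpha>) f x) \<le> (\<Sum>\<alpha>\<in>?S. B (mi_list \<alpha>))"
        using B(2)[OF \<open>x \<in> K\<close>, of "mi_list \<alpha>"] by linarith
    qed
  qed
qed

section \<open>Supports and test functions\<close>

lemma notin_supp: "x \<notin> supp f \<Longrightarrow> f x = 0"
  unfolding supp_def using closure_subset[of "{x. f x \<noteq> 0}"] by blast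

lemma closed_supp [simp]: "closed (supp f)"
  by (simp add: supp_def)

lemma supp_subsetI: "closed K \<Longrightarrow> (\<And>x. f x \<noteq> 0 \<Longrightarrow> x \<in> K) \<Longrightarrow> supp f \<subseteq> K"
  unfolding supp_def by (intro closure_minimal) auto

lemma iter_partial_eq_0:
  assumes "open V" "x \<in> V" "\<And>y. y \<in> V \<Longrightarrow> f y = 0"
  shows "iter_partial is f x = 0"
proof -
  have "iter_partial is f x = iter_partial is (\<lambda>_. 0) x"
    by (rule iter_partial_cong(1)[OF assms(1) iter_partial_const(2)]) (use assms in auto)
  then show ?thesis by (simp add: iter_partial_const)
qed

lemma iter_partial_notin_supp: "x \<notin> supp f \<Longrightarrow> iter_partial is f x = 0"
  by (rule iter_partial_eq_0[of "- supp f"]) (auto simp: notin_supp)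

lemma smooth_on_0: "open V \<Longrightarrow> (\<And>y. y \<in> V \<Longrightarrow> f y = 0) \<Longrightarrow> smooth_on V f"
  by (rule iter_partial_cong(2)[OF _ iter_partial_const(2)])

lemma test_functionsD:
  assumes "\<psi> \<in> test_functions U"
  shows "smooth_on V \<psi>" "compact (supp \<psi>)" "supp \<psi> \<subseteq> U"
  using assms smooth_on_subset by (auto simp: test_functions_def)

lemma test_functions_subset:
  "\<psi> \<in> test_functions U \<Longrightarrow> supp \<psi> \<subseteq> V \<Longrightarrow> \<psi> \<in> test_functions V"
  by (auto simp: test_functions_def)

lemma test_functions_bounded:
  assumes "\<psi> \<in> test_functions U"
  shows "\<exists>B\<ge>0. \<forall>x. norm (iter_partial is \<psi> x) \<le> B"
proof -
  obtain B where "B \<ge> 0" "\<forall>x\<in>supp \<psi>. norm (iter_partial is \<psi> x) \<le> B"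
    using smooth_on_bounded[of UNIV \<psi> "supp \<psi>" "is"] test_functionsD[OF assms] by auto
  then show ?thesis by (metis iter_partial_notin_supp norm_zero)
qed

text \<open>Smoothness of \<open>f\<close> on \<open>U\<close> suffices: the product is 0 on the
  open set \<open>- supp \<theta>\<close>, which together with \<open>U\<close> covers the whole
  space.\<close>

lemma test_functions_mult:
  assumes U: "open U" and \<theta>: "\<theta> \<in> test_functions U" and f: "smooth_on U f"
  shows "(\<lambda>x. \<theta> x * f x) \<in> test_functions U" and "supp (\<lambda>x. \<theta> x * f x) \<subseteq> supp \<theta>"
proof -
  show *: "supp (\<lambda>x. \<theta> x * f x) \<subseteq> supp \<theta>"
    by (rule supp_subsetI) (auto intro: ccontr simp: notin_supp)
  have "smooth_on (U \<union> - supp \<theta>) (\<lambda>x. \<theta> x * f x)"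
    by (intro smooth_on_Un iter_partial_mult(2) U f test_functionsD[OF \<theta>] smooth_on_0)
      (auto simp: notin_supp)
  moreover have "U \<union> - supp \<theta> = UNIV"
    using test_functionsD[OF \<theta>] by auto
  moreover have "compact (supp (\<lambda>x. \<theta> x * f x))"
    using * test_functionsD[OF \<theta>] by (metis closed_supp compact_Int_closed inf.absorb_iff2)
  ultimately show "(\<lambda>x. \<theta> x * f x) \<in> test_functions U"
    using * test_functionsD[OF \<theta>] by (auto simp: test_functions_def)
qed

lemma test_functions_add:
  assumes "\<phi> \<in> test_functions U" "\<psi> \<in> test_functions U"
  shows "(\<lambda>x. \<phi> x + \<psi> x) \<in> test_functions U" "supp (\<lambda>x. \<phi> x + \<psi> x) \<subseteq> supp \<phi> \<union> supp \<psi>"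
proof -
  note D = test_functionsD[OF assms(1)] test_functionsD[OF assms(2)]
  show *: "supp (\<lambda>x. \<phi> x + \<psi> x) \<subseteq> supp \<phi> \<union> supp \<psi>"
    by (rule supp_subsetI) (auto intro: ccontr simp: notin_supp closed_Un)
  then have "compact (supp (\<lambda>x. \<phi> x + \<psi> x))"
    using D by (metis closed_supp compact_Int_closed compact_Un inf.absorb_iff2)
  then show "(\<lambda>x. \<phi> x + \<psi> x) \<in> test_functions U"
    using * D iter_partial_add(2)[OF open_UNIV, of \<phi> \<psi>] by (auto simp: test_functions_def)
qed

lemma test_functions_cmult:
  assumes "\<psi> \<in> test_functions U"
  shows "(\<lambda>x. c * \<psi> x) \<in> test_functions U" "supp (\<lambda>x. c * \<psi> x) \<subseteq> supp \<psi>"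
proof -
  note D = test_functionsD[OF assms(1)]
  show *: "supp (\<lambda>x. c * \<psi> x) \<subseteq> supp \<psi>"
    by (rule supp_subsetI) (auto intro: ccontr simp: notin_supp closed_Un)
  then have "compact (supp (\<lambda>x. c * \<psi> x))"
    using D by (metis closed_supp compact_Int_closed inf.absorb_iff2)
  then show "(\<lambda>x. c * \<psi> x) \<in> test_functions U"
    using * D iter_partial_cmult(2)[OF open_UNIV, of \<psi>] by (auto simp: test_functions_def)
qed

section \<open>Distributions\<close>

lemma distribution_add:
  "distribution U u \<Longrightarrow> \<phi> \<in> test_functions U \<Longrightarrow> \<psi> \<in> test_functions U \<Longrightarrow>
    u (\<lambda>x. \<phi> x + \<psi> x) = u \<phi> + u \<psi>"
  by (simp add: distribution_def)

lemma distribution_cmult: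
  "distribution U u \<Longrightarrow> \<phi> \<in> test_functions U \<Longrightarrow> u (\<lambda>x. c * \<phi> x) = c * u \<phi>"
  by (simp add: distribution_def)

lemma distribution_diff:
  assumes "distribution U u" "\<phi> \<in> test_functions U" "\<psi> \<in> test_functions U"
  shows "u (\<lambda>x. \<phi> x - \<psi> x) = u \<phi> - u \<psi>"
  using distribution_add[OF assms(1,2) test_functions_cmult(1)[OF assms(3), of "-1"]]
    distribution_cmult[OF assms(1,3), of "-1"] by simp

text \<open>The finite sum of suprema is replaced by a single bound \<open>B\<close>, the number of
  multi-indices going into the constant. The absolute value of \<open>C\<close> is taken because the
  definition of a distribution fixes no sign.\<close>

lemma distribution_bound:
  fixes U :: "(real^'n::finite) set"
  assumes "distribution U u" "compact K" "K \<subseteq> U"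
  shows "\<exists>C\<ge>0. \<exists>m. \<forall>\<psi>\<in>test_functions U. \<forall>B. supp \<psi> \<subseteq> K \<longrightarrow> deriv_le m UNIV \<psi> B \<longrightarrow>
    norm (u \<psi>) \<le> C * B"
proof -
  obtain C m where C: "\<And>\<psi>. \<psi> \<in> test_functions U \<Longrightarrow> supp \<psi> \<subseteq> K \<Longrightarrow>
      norm (u \<psi>) \<le> C * (\<Sum>\<alpha> | mi_order \<alpha> \<le> m. (SUP x. norm (mi_deriv \<alpha> \<psi> x)))"
    using assms unfolding distribution_def by meson
  let ?S = "{\<alpha> :: 'n \<Rightarrow> nat. mi_order \<alpha> \<le> m}"
  show ?thesis
  proof (intro exI conjI ballI allI impI)
    show "0 \<le> \<bar>C\<bar> * real (card ?S)" by simp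
    fix \<psi> B assume \<psi>: "\<psi> \<in> test_functions U" "supp \<psi> \<subseteq> K" "deriv_le m UNIV \<psi> B"
    have S: "0 \<le> (SUP x. norm (mi_deriv \<alpha> \<psi> x)) \<and> (SUP x. norm (mi_deriv \<alpha> \<psi> x)) \<le> B" if "\<alpha> \<in> ?S" for \<alpha>
    proof -
      have le: "norm (mi_deriv \<alpha> \<psi> x) \<le> B" for x
        using \<psi>(3) that by (auto simp: deriv_le_def)
      then have "bdd_above (range (\<lambda>x. norm (mi_deriv \<alpha> \<psi> x)))"
        by (auto intro!: bdd_aboveI)
      then have "norm (mi_deriv \<alpha> \<psi> 0) \<le> (SUP x. norm (mi_deriv \<alpha> \<psi> x))"
        by (rule cSUP_upper2) auto
      moreover have "(SUP x. norm (mi_deriv \<alpha> \<psi> x)) \<le> B"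
        using le by (intro cSUP_least) auto
      ultimately show ?thesis using norm_ge_zero order_trans by blast
    qed
    have "norm (u \<psi>) \<le> C * (\<Sum>\<alpha>\<in>?S. (SUP x. norm (mi_deriv \<alpha> \<psi> x)))"
      using C[OF \<psi>(1,2)] .
    also have "\<dots> \<le> \<bar>C\<bar> * (\<Sum>\<alpha>\<in>?S. (SUP x. norm (mi_deriv \<alpha> \<psi> x)))"
      using S by (intro mult_right_mono sum_nonneg) auto
    also have "\<dots> \<le> \<bar>C\<bar> * (real (card ?S) * B)"
      using S by (intro mult_left_mono sum_bounded_above) auto
    finally show "norm (u \<psi>) \<le> \<bar>C\<bar> * real (card ?S) * B" by (simp add: mult.assoc)
  qed
qed

text \<open>The converse translation takes for \<open>B\<close> the sum of all suprema. These are
  finite since derivatives of test functions are bounded, and nonnegative, so the sum dominates each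
  of them.\<close>

lemma distributionI:
  fixes U :: "(real^'n::finite) set"
  assumes "\<And>\<phi> \<psi>. \<phi> \<in> test_functions U \<Longrightarrow> \<psi> \<in> test_functions U \<Longrightarrow> u (\<lambda>x. \<phi> x + \<psi> x) = u \<phi> + u \<psi>"
    and "\<And>\<phi> c. \<phi> \<in> test_functions U \<Longrightarrow> u (\<lambda>x. c * \<phi> x) = c * u \<phi>"
    and bound: "\<And>K. compact K \<Longrightarrow> K \<subseteq> U \<Longrightarrow> \<exists>C m. \<forall>\<psi>\<in>test_functions U. \<forall>B\<ge>0. supp \<psi> \<subseteq> K \<longrightarrow>
      deriv_le m UNIV \<psi> B \<longrightarrow> norm (u \<psi>) \<le> C * B"
  shows "distribution U u"
proof -
  have "\<exists>C m. \<forall>\<psi>\<in>test_functions U. supp \<psi> \<subseteq> K \<longrightarrow>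
      norm (u \<psi>) \<le> C * (\<Sum>\<alpha> | mi_order \<alpha> \<le> m. (SUP x. norm (mi_deriv \<alpha> \<psi> x)))"
    if K: "compact K" "K \<subseteq> U" for K
  proof -
    obtain C m where C: "\<And>\<psi> B. \<psi> \<in> test_functions U \<Longrightarrow> B \<ge> 0 \<Longrightarrow> supp \<psi> \<subseteq> K \<Longrightarrow>
        deriv_le m UNIV \<psi> B \<Longrightarrow> norm (u \<psi>) \<le> C * B"
      using bound[OF K] by metis
    let ?S = "{\<alpha> :: 'n \<Rightarrow> nat. mi_order \<alpha> \<le> m}"
    have "norm (u \<psi>) \<le> C * (\<Sum>\<alpha>\<in>?S. (SUP x. norm (mi_deriv \<alpha> \<psi> x)))"
      if \<psi>: "\<psi> \<in> test_functions U" "supp \<psi> \<subseteq> K" for \<psi>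
    proof -
      have le: "norm (mi_deriv \<alpha> \<psi> x) \<le> (SUP x. norm (mi_deriv \<alpha> \<psi> x))" for \<alpha> x
      proof (rule cSUP_upper)
        obtain B where "\<forall>x. norm (mi_deriv \<alpha> \<psi> x) \<le> B"
          using test_functions_bounded[OF \<psi>(1), of "mi_list \<alpha>"] by (auto simp: mi_deriv_eq)
        then show "bdd_above (range (\<lambda>x. norm (mi_deriv \<alpha> \<psi> x)))" by (auto intro!: bdd_aboveI)
      qed auto
      have pos: "0 \<le> (SUP x. norm (mi_deriv \<alpha> \<psi> x))" for \<alpha>
        using le[of \<alpha> 0] norm_ge_zero order_trans by blast
      show ?thesis
      proof (rule C[OF \<psi>(1) _ \<psi>(2)])
        show "0 \<le> (\<Sum>\<alpha>\<in>?S. (SUP x. norm (mi_deriv \<alpha> \<psi> x)))" using pos by (intro sum_nonneg) auto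
        show "deriv_le m UNIV \<psi> (\<Sum>\<alpha>\<in>?S. (SUP x. norm (mi_deriv \<alpha> \<psi> x)))"
          unfolding deriv_le_def
        proof (intro allI impI ballI)
          fix \<alpha> :: "'n \<Rightarrow> nat" and x assume "mi_order \<alpha> \<le> m"
          then have "(SUP x. norm (mi_deriv \<alpha> \<psi> x)) \<le> (\<Sum>\<alpha>\<in>?S. (SUP x. norm (mi_deriv \<alpha> \<psi> x)))"
            using finite_mi_order_le pos by (intro member_le_sum) auto
          with le show "norm (mi_deriv \<alpha> \<psi> x) \<le> (\<Sum>\<alpha>\<in>?S. (SUP x. norm (mi_deriv \<alpha> \<psi> x)))"
            using order_trans by blast
        qed
      qed
    qed
    then show ?thesis by blast
  qed
  then show ?thesis using assms(1,2) unfolding distribution_def by blast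
qed

section \<open>Gevrey cutoff functions\<close>

text \<open>A single term of the exponential series is at most its sum.\<close>

lemma power_le_fact_exp:
  fixes u :: real
  assumes "u \<ge> 0"
  shows "u ^ k \<le> fact k * exp u"
proof -
  have "(\<Sum>n<Suc k. u ^ n /\<^sub>R fact n) \<le> exp u"
    unfolding exp_def using assms by (intro sum_le_suminf summable_exp_generic) auto
  moreover have "u ^ k /\<^sub>R fact k \<le> (\<Sum>n<Suc k. u ^ n /\<^sub>R fact n)"
    using assms by (intro member_le_sum) auto
  ultimately have "u ^ k / fact k \<le> exp u"
    by (simp add: field_simps)
  then show ?thesis by (simp add: field_simps)
qed

text \<open>\<open>flat n k\<close> is the \<open>n\<close>-th derivative of \<open>t\<^sup>-\<^sup>k e\<^sup>-\<^sup>1\<^sup>/\<^sup>t\<close>, extended by 0 to \<open>t \<le> 0\<close>; the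
  recursion uses that the derivative of \<open>t\<^sup>-\<^sup>k e\<^sup>-\<^sup>1\<^sup>/\<^sup>t\<close> is a combination of two such functions.\<close>

fun flat :: "nat \<Rightarrow> nat \<Rightarrow> real \<Rightarrow> real" where
  "flat 0 k t = (if t \<le> 0 then 0 else exp (- inverse t) * inverse t ^ k)"
| "flat (Suc n) k t = flat n (k + 2) t - real k * flat n (k + 1) t"

lemma flat_nonpos [simp]: "t \<le> 0 \<Longrightarrow> flat n k t = 0"
  by (induction n arbitrary: k) auto

lemma flat_0_bounds: "0 \<le> flat 0 k t" "flat 0 k t \<le> fact k"
proof -
  show "flat 0 k t \<le> fact k"
  proof (cases "t \<le> 0")
    case False
    then have "inverse t ^ k \<le> fact k * exp (inverse t)"
      by (intro power_le_fact_exp) auto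
    then have "exp (- inverse t) * inverse t ^ k \<le> exp (- inverse t) * (fact k * exp (inverse t))"
      by (intro mult_left_mono) auto
    also have "\<dots> = fact k" by (simp add: exp_minus field_simps)
    finally show ?thesis using False by simp
  qed auto
qed auto

text \<open>Each step of the recursion either raises \<open>k\<close> by 2, or raises it by 1 at the
  price of a factor \<open>k\<close>. Both contributions fit under the same factorial, and adding
  them gives the factor 2 per derivative.\<close>

lemma abs_flat_le: "\<bar>flat n k t\<bar> \<le> 2 ^ n * fact (k + 2 * n)"
proof (induction n arbitrary: k)
  case 0
  show ?case using flat_0_bounds[of k t] by simp
next
  case (Suc n)
  have "real k * fact (k + 1 + 2 * n) \<le> real (k + 2 + 2 * n) * fact (k + 1 + 2 * n)"
    by (intro mult_right_mono) auto
  also have "\<dots> = fact (k + 2 + 2 * n)"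
    by (simp add: algebra_simps)
  finally have *: "real k * fact (k + 1 + 2 * n) \<le> (fact (k + 2 + 2 * n) :: real)" .
  have "\<bar>flat (Suc n) k t\<bar> \<le> \<bar>flat n (k + 2) t\<bar> + real k * \<bar>flat n (k + 1) t\<bar>"
    using abs_triangle_ineq4[of "flat n (k + 2) t" "real k * flat n (k + 1) t"]
    by (simp add: abs_mult)
  also have "\<dots> \<le> 2 ^ n * fact (k + 2 + 2 * n) + real k * (2 ^ n * fact (k + 1 + 2 * n))"
    by (intro add_mono mult_left_mono Suc.IH) auto
  also have "\<dots> = 2 ^ n * (fact (k + 2 + 2 * n) + real k * fact (k + 1 + 2 * n))"
    by (simp only: algebra_simps)
  also have "\<dots> \<le> 2 ^ n * (fact (k + 2 + 2 * n) + fact (k + 2 + 2 * n))"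
    using * by (intro mult_left_mono add_mono) auto
  also have "\<dots> = 2 ^ Suc n * fact (k + 2 * Suc n)" by (simp add: add_ac)
  finally show ?case .
qed

text \<open>The induction step is linear; the content is the base case at \<open>t = 0\<close>.
  There a factor t^2 splits off while \<open>k\<close> grows by 2, so the difference quotient is at
  most a constant times |h|.\<close>

lemma DERIV_flat: "(flat n k has_real_derivative flat (Suc n) k t) (at t)"
proof (induction n arbitrary: k)
  case 0
  consider "t < 0" | "t = 0" | "t > 0" by linarith
  then show ?case
  proof cases
    case 1
    have "((\<lambda>t. 0) has_real_derivative 0) (at t)" by simp
    then have "(flat 0 k has_real_derivative 0) (at t)"
      by (rule has_field_derivative_transform_within_open[where S = "{..<0}"]) (use 1 in auto)
    then show ?thesis using 1 by (simp del: flat.simps)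
  next
    case 2
    have sq: "flat 0 k t = t\<^sup>2 * flat 0 (k + 2) t" for t
      by (auto simp: power_add power2_eq_square field_simps)
    have *: "\<bar>flat 0 k h / h\<bar> \<le> fact (k + 2) * \<bar>h\<bar>" for h
    proof (cases "h = 0")
      case False
      have "\<bar>flat 0 k h / h\<bar> = \<bar>h\<bar> * \<bar>flat 0 (k + 2) h\<bar>"
        using False unfolding sq[of h] by (simp add: abs_mult power2_eq_square)
      also have "\<dots> \<le> \<bar>h\<bar> * fact (k + 2)"
        using flat_0_bounds[of "k + 2" h] by (intro mult_left_mono) auto
      finally show ?thesis by (simp only: mult.commute)
    qed auto
    have "((\<lambda>h. flat 0 k h / h) \<longlongrightarrow> 0) (at 0)"
    proof (rule Lim_null_comparison)
      show "\<forall>\<^sub>F h in at 0. norm (flat 0 k h / h) \<le> fact (k + 2) * \<bar>h\<bar>"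
        using * by auto
      show "((\<lambda>h. fact (k + 2) * \<bar>h\<bar>) \<longlongrightarrow> 0) (at (0::real))"
        by (rule tendsto_eq_intros refl | simp)+
    qed
    then show ?thesis using 2 by (simp add: DERIV_def del: flat.simps)
  next
    case 3
    have "((\<lambda>t. exp (- inverse t) * inverse t ^ k) has_real_derivative flat 1 k t) (at t)"
    proof -
      have i: "(inverse has_real_derivative - (inverse t ^ 2)) (at t)"
        using DERIV_inverse[of t UNIV] 3 by (simp add: numeral_2_eq_2)
      have e: "((\<lambda>t. exp (- inverse t)) has_real_derivative exp (- inverse t) * inverse t ^ 2) (at t)"
        using DERIV_chain2[OF DERIV_exp DERIV_minus[OF i]] by simp
      show ?thesis
        by (rule DERIV_cong[OF DERIV_mult[OF e DERIV_power[OF i]]])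
          (use 3 in \<open>cases k; simp add: algebra_simps power2_eq_square\<close>)
    qed
    then have "(flat 0 k has_real_derivative flat 1 k t) (at t)"
      by (rule has_field_derivative_transform_within_open[where S = "{0<..}"]) (use 3 in auto)
    then show ?thesis by (simp del: flat.simps)
  qed
next
  case (Suc n)
  have eq: "flat (Suc n) k = (\<lambda>t. flat n (k + 2) t - real k * flat n (k + 1) t)" for k
    by auto
  have "((\<lambda>t. flat n (k + 2) t - real k * flat n (k + 1) t) has_real_derivative
      flat (Suc n) (k + 2) t - real k * flat (Suc n) (k + 1) t) (at t)"
    by (intro DERIV_diff DERIV_cmult Suc)
  then show ?case unfolding eq[of k] by simp
qed

text \<open>These are Gevrey bounds of order 2, with (2k)! for (k!)^2, which differs from it by at
  most a factor 4^k. The exponent \<open>k + 1\<close> lets \<open>A\<close> absorb constant factors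
  too.\<close>

definition gevrey :: "(nat \<Rightarrow> real \<Rightarrow> complex) \<Rightarrow> real \<Rightarrow> bool" where
  "gevrey F A \<longleftrightarrow> A \<ge> 1 \<and> deriv_seq F \<and> (\<forall>k t. norm (F k t) \<le> A ^ (k + 1) * fact (2 * k))"

lemma gevreyD:
  assumes "gevrey F A"
  shows "A \<ge> 1" "deriv_seq F" "norm (F k t) \<le> A ^ (k + 1) * fact (2 * k)"
  using assms by (auto simp: gevrey_def)

lemma gevrey_flat: "gevrey (\<lambda>n t. of_real (flat n 0 t)) 2"
  unfolding gevrey_def deriv_seq_def
proof (intro conjI allI)
  fix n t
  show "((\<lambda>t. complex_of_real (flat n 0 t)) has_vector_derivative of_real (flat (Suc n) 0 t)) (at t)"
    by (intro has_vector_derivative_of_real DERIV_flat)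
  have "2 ^ n * fact (2 * n) \<le> (2 ^ (n + 1) * fact (2 * n) :: real)"
    by (intro mult_right_mono power_increasing) auto
  then show "norm (complex_of_real (flat n 0 t)) \<le> 2 ^ (n + 1) * fact (2 * n)"
    using abs_flat_le[of n 0 t] by simp
qed auto

text \<open>This is the n-th derivative of the product of \<open>F 0\<close> and \<open>G 0\<close>,
  written as an unfolded recursion instead of a binomial sum: inductions then only shift one of the
  two sequences.\<close>

fun leibniz :: "nat \<Rightarrow> (nat \<Rightarrow> real \<Rightarrow> complex) \<Rightarrow> (nat \<Rightarrow> real \<Rightarrow> complex) \<Rightarrow> real \<Rightarrow> complex" where
  "leibniz 0 F G t = F 0 t * G 0 t"
| "leibniz (Suc n) F G t = leibniz n (\<lambda>k. F (Suc k)) G t + leibniz n F (\<lambda>k. G (Suc k)) t"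

lemma deriv_seq_Suc: "deriv_seq F \<Longrightarrow> deriv_seq (\<lambda>k. F (Suc k))"
  by (simp add: deriv_seq_def)

lemma leibniz_zero:
  "(\<And>k. F k t = 0) \<Longrightarrow> leibniz n F G t = 0" "(\<And>k. G k t = 0) \<Longrightarrow> leibniz n F G t = 0"
  by (induction n arbitrary: F G) auto

lemma deriv_seq_leibniz:
  assumes "deriv_seq F" "deriv_seq G"
  shows "deriv_seq (\<lambda>n. leibniz n F G)"
proof -
  have "(leibniz n F G has_vector_derivative leibniz (Suc n) F G t) (at t)"
    if "deriv_seq F" "deriv_seq G" for n F G t
    using that
  proof (induction n arbitrary: F G)
    case 0
    have "((\<lambda>t. F 0 t * G 0 t) has_vector_derivative (F 0 t * G (Suc 0) t + F (Suc 0) t * G 0 t)) (at t)"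
      using 0 by (intro has_vector_derivative_mult) (auto simp: deriv_seq_def)
    moreover have "leibniz 0 F G = (\<lambda>t. F 0 t * G 0 t)" by auto
    ultimately show ?case by (simp add: add.commute)
  next
    case (Suc n)
    have eq: "leibniz (Suc n) F G =
        (\<lambda>t. leibniz n (\<lambda>k. F (Suc k)) G t + leibniz n F (\<lambda>k. G (Suc k)) t)" by auto
    show ?case unfolding eq leibniz.simps(2)[of "Suc n"]
      by (intro has_vector_derivative_add Suc.IH Suc.prems deriv_seq_Suc)
  qed
  then show ?thesis using assms by (auto simp: deriv_seq_def)
qed

lemma fact_mult_le: "fact m * fact n \<le> (fact (m + n) :: real)"
proof -
  have "(fact m * fact n :: nat) \<le> fact (m + n)"
    using fact_fact_dvd_fact[of m n] by (intro dvd_imp_le) auto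
  then show ?thesis by (metis of_nat_fact of_nat_le_iff of_nat_mult)
qed

text \<open>The offsets \<open>a\<close> and \<open>b\<close> record how often each sequence has
  been shifted. The recursion preserves the sum n + a + b, so both halves receive the same bound and
  merely double it.\<close>

lemma norm_leibniz_le:
  assumes "A \<ge> 1"
    and "\<And>k. norm (F k t) \<le> A ^ (k + a + 1) * fact (2 * (k + a))"
    and "\<And>k. norm (G k t) \<le> A ^ (k + b + 1) * fact (2 * (k + b))"
  shows "norm (leibniz n F G t) \<le> 2 ^ n * A ^ (n + a + b + 2) * fact (2 * (n + a + b))"
  using assms(2,3)
proof (induction n arbitrary: F G a b)
  case 0
  have "norm (F 0 t * G 0 t) \<le> (A ^ (a + 1) * fact (2 * a)) * (A ^ (b + 1) * fact (2 * b))"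
    unfolding norm_mult using 0(1)[of 0] 0(2)[of 0] assms(1) by (intro mult_mono) auto
  also have "\<dots> = A ^ (a + b + 2) * (fact (2 * a) * fact (2 * b))"
    by (simp add: power_add power2_eq_square)
  also have "\<dots> \<le> A ^ (a + b + 2) * fact (2 * a + 2 * b)"
    using assms(1) by (intro mult_left_mono fact_mult_le) auto
  finally show ?case by (simp add: algebra_simps)
next
  case (Suc n)
  have "norm (leibniz n (\<lambda>k. F (Suc k)) G t) \<le> 2 ^ n * A ^ (n + (a + 1) + b + 2) * fact (2 * (n + (a + 1) + b))"
    using Suc.prems(1)[of "Suc k" for k] Suc.prems(2) by (intro Suc.IH) (auto simp: add_ac)
  moreover have "norm (leibniz n F (\<lambda>k. G (Suc k)) t) \<le> 2 ^ n * A ^ (n + a + (b + 1) + 2) * fact (2 * (n + a + (b + 1)))"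
    using Suc.prems(2)[of "Suc k" for k] Suc.prems(1) by (intro Suc.IH) (auto simp: add_ac)
  ultimately have "norm (leibniz (Suc n) F G t) \<le> 2 ^ n * A ^ (Suc n + a + b + 2) * fact (2 * (Suc n + a + b)) +
      2 ^ n * A ^ (Suc n + a + b + 2) * fact (2 * (Suc n + a + b))"
    unfolding leibniz.simps by (intro order_trans[OF norm_triangle_ineq] add_mono) (simp_all only: add_ac Suc_eq_plus1)
  then show ?case by (simp only: power_Suc mult_2 algebra_simps)
qed

lemma gevrey_leibniz:
  assumes "gevrey F A" "gevrey G A"
  shows "gevrey (\<lambda>n. leibniz n F G) (2 * A\<^sup>2)"
proof -
  have A: "A \<ge> 1" using assms by (simp add: gevrey_def)
  show ?thesis unfolding gevrey_def
  proof (intro conjI allI)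
    show "deriv_seq (\<lambda>n. leibniz n F G)"
      using assms by (intro deriv_seq_leibniz) (auto simp: gevrey_def)
    show "2 * A\<^sup>2 \<ge> 1" using one_le_power[OF A, of 2] by linarith
    fix n t
    have "norm (leibniz n F G t) \<le> 2 ^ n * A ^ (n + 0 + 0 + 2) * fact (2 * (n + 0 + 0))"
      using A gevreyD(3)[OF assms(1)] gevreyD(3)[OF assms(2)] by (intro norm_leibniz_le) auto
    \<comment> \<open>Here n + 2 is at most 2 (n + 1) and \<open>A \<ge> 1\<close>; this is where
      the new constant \<open>2 * A\<^sup>2\<close> comes from.\<close>
    also have "\<dots> \<le> 2 ^ (n + 1) * A ^ (2 * (n + 1)) * fact (2 * n)"
      using A by (intro mult_mono power_increasing) (auto intro!: mult_nonneg_nonneg)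
    finally show "norm (leibniz n F G t) \<le> (2 * A\<^sup>2) ^ (n + 1) * fact (2 * n)"
      by (simp only: power_mult_distrib power_mult)
  qed
qed

lemma gevrey_affine:
  assumes "gevrey F A"
  shows "gevrey (\<lambda>k t. of_real (a ^ k) * F k (a * t + b)) (max 1 \<bar>a\<bar> * A)"
  unfolding gevrey_def deriv_seq_def
proof (intro conjI allI)
  note D = gevreyD[OF assms]
  show A: "1 \<le> max 1 \<bar>a\<bar> * A"
    using D(1) by (smt (verit) mult_le_cancel_right1 mult_cancel_right1 max.cobounded1)
  fix k t
  have "((\<lambda>t. a * t + b) has_real_derivative a) (at t)"
    by (auto intro!: derivative_eq_intros)
  then have "((\<lambda>t. a * t + b) has_vector_derivative a) (at t)"
    by (simp add: has_real_derivative_iff_has_vector_derivative)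
  from vector_diff_chain_at[OF this, of "F k" "F (Suc k) (a * t + b)"]
  have "((\<lambda>t. F k (a * t + b)) has_vector_derivative a *\<^sub>R F (Suc k) (a * t + b)) (at t)"
    using D(2) by (simp add: o_def deriv_seq_def)
  from has_vector_derivative_mult_right[OF this, of "of_real (a ^ k)"]
  show "((\<lambda>t. of_real (a ^ k) * F k (a * t + b)) has_vector_derivative
      of_real (a ^ Suc k) * F (Suc k) (a * t + b)) (at t)"
    by (simp add: scaleR_conv_of_real mult_ac)
  have "norm (of_real (a ^ k) * F k (a * t + b)) = \<bar>a\<bar> ^ k * norm (F k (a * t + b))"
    by (simp add: norm_mult power_abs norm_power)
  also have "\<dots> \<le> max 1 \<bar>a\<bar> ^ (k + 1) * (A ^ (k + 1) * fact (2 * k))"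
  proof (intro mult_mono D(3))
    have "\<bar>a\<bar> ^ k \<le> max 1 \<bar>a\<bar> ^ k" by (intro power_mono) auto
    also have "\<dots> \<le> max 1 \<bar>a\<bar> ^ (k + 1)" by (intro power_increasing) auto
    finally show "\<bar>a\<bar> ^ k \<le> max 1 \<bar>a\<bar> ^ (k + 1)" .
  qed auto
  finally show "norm (of_real (a ^ k) * F k (a * t + b)) \<le> (max 1 \<bar>a\<bar> * A) ^ (k + 1) * fact (2 * k)"
    by (simp only: power_mult_distrib mult_ac)
qed

text \<open>The step is the normalized primitive of the bump \<open>b\<close>, which vanishes
  outside the open unit interval. Its derivatives are those of the bump with the index shifted by
  one, and hence satisfy Gevrey bounds.\<close>

lemma gevrey_step:
  "\<exists>S A. gevrey S A \<and> (\<forall>k. \<forall>t\<le>0. S k t = 0) \<and> (\<forall>t\<ge>1. S 0 t = 1)"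
proof -
  define b where "b t = flat 0 0 t * flat 0 0 (1 - t)" for t
  define \<beta> where "\<beta> n = leibniz n (\<lambda>n t. of_real (flat n 0 t))
    (\<lambda>k t. of_real ((-1) ^ k) * of_real (flat k 0 ((-1) * t + 1)))" for n
  \<comment> \<open>Integrating from -1 instead of 0 makes \<open>t = 0\<close> an interior point of
    the interval on which the fundamental theorem is applied.\<close>
  define h where "h t = integral {-1..t} b" for t
  obtain A where \<beta>: "gevrey \<beta> A"
  proof -
    have "gevrey (\<lambda>n t. of_real (flat n 0 t)) (max 1 \<bar>-1\<bar> * 2)"
      using gevrey_flat by simp
    from gevrey_leibniz[OF this gevrey_affine[OF gevrey_flat, of "-1" 1]] that
    show ?thesis unfolding \<beta>_def by blast
  qed
  note A = gevreyD[OF \<beta>]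
  have \<beta>0: "\<beta> 0 t = of_real (b t)" for t
    by (simp add: \<beta>_def b_def)
  have \<beta>_zero: "\<beta> n t = 0" if "t \<le> 0 \<or> t \<ge> 1" for n t
    unfolding \<beta>_def using that by (auto intro: leibniz_zero)
  have b_nonneg: "b t \<ge> 0" for t by (simp add: b_def)
  have c: "isCont (flat 0 0) t" for t
    using DERIV_flat DERIV_isCont by blast
  have "isCont (\<lambda>t. flat 0 0 (1 - t)) t" for t
    by (rule isCont_o2[OF _ c]) (intro continuous_intros)
  then have cb: "continuous_on X b" for X
    unfolding b_def by (intro continuous_at_imp_continuous_on ballI isCont_mult c)
  have h0: "h t = 0" if "t \<le> 0" for t
    unfolding h_def using that by (intro integral_unique has_integral_is_0) (auto simp: b_def)
  have dh: "(h has_real_derivative b t) (at t)" for t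
  proof (cases "t < 0")
    case True
    have "((\<lambda>t. 0) has_real_derivative 0) (at t)" by simp
    then have "(h has_real_derivative 0) (at t)"
      by (rule has_field_derivative_transform_within_open[where S = "{..<0}"]) (use True h0 in auto)
    then show ?thesis using True by (simp add: b_def)
  next
    case False
    have "((\<lambda>x. integral {-1..x} b) has_real_derivative b t) (at t within {-1..t + 1})"
      using False by (intro integral_has_real_derivative cb) auto
    moreover have "at t within {-1..t + 1} = at t"
      using False by (intro at_within_interior) auto
    ultimately show ?thesis by (simp add: h_def[abs_def])
  qed
  have mono: "h s \<le> h t" if "s \<le> t" for s t
    using DERIV_nonneg_imp_nondecreasing[OF that, of h] dh b_nonneg by blast
  have "h 0 < h 1"
  proof (rule DERIV_pos_imp_increasing_open[of 0 1 h])
    show "\<And>x. 0 < x \<Longrightarrow> x < 1 \<Longrightarrow> \<exists>y. (h has_real_derivative y) (at x) \<and> 0 < y"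
      by (rule exI, rule conjI, rule dh) (auto simp: b_def)
    show "continuous_on {0..1} h"
      using dh DERIV_isCont by (intro continuous_at_imp_continuous_on) blast
  qed auto
  then have h1: "h 1 > 0" using h0 by simp
  have h_ge: "h t = h 1" if "t \<ge> 1" for t
  proof -
    have "h t \<le> h 1"
      by (rule DERIV_nonpos_imp_nonincreasing[OF that])
        (use dh in \<open>force simp: b_def\<close>)
    then show ?thesis using mono[OF that] by simp
  qed
  have h_range: "0 \<le> h t" "h t \<le> h 1" for t
    using mono[of t 0] mono[of 0 t] mono[of t 1] h_ge[of t] h0 by (smt (verit))+
  define S where "S n t = (case n of 0 \<Rightarrow> of_real (h t / h 1) | Suc m \<Rightarrow> \<beta> m t / of_real (h 1))" for n t
  \<comment> \<open>The normalizing factor 1 / \<open>h 1\<close> must be absorbed: derivatives of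
    the step lag one order behind those of the bump, which leaves one spare power of
    \<open>B\<close>.\<close>
  define B where "B = max A (1 / h 1)"
  have "B \<ge> 1" using A(1) by (auto simp: B_def)
  have "gevrey S B" unfolding gevrey_def deriv_seq_def
  proof (intro conjI allI)
    fix k t
    show "(S k has_vector_derivative S (Suc k) t) (at t)"
    proof (cases k)
      case 0
      have "((\<lambda>t. complex_of_real (h t / h 1)) has_vector_derivative of_real (b t / h 1)) (at t)"
        by (intro has_vector_derivative_of_real DERIV_cdivide dh)
      then show ?thesis using 0 by (simp add: S_def[abs_def] \<beta>0)
    next
      case (Suc m)
      have "((\<lambda>t. \<beta> m t / of_real (h 1)) has_vector_derivative \<beta> (Suc m) t / of_real (h 1)) (at t)"
        using A(2) by (intro has_vector_derivative_divide) (simp add: deriv_seq_def)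
      then show ?thesis using Suc by (simp add: S_def[abs_def])
    qed
    show "norm (S k t) \<le> B ^ (k + 1) * fact (2 * k)"
    proof (cases k)
      case 0
      have "norm (S k t) \<le> 1" using h_range[of t] h1 0 by (simp add: S_def norm_divide)
      then show ?thesis using 0 \<open>B \<ge> 1\<close> by simp
    next
      case (Suc m)
      have "norm (S k t) = norm (\<beta> m t) * (1 / h 1)"
        using h1 Suc by (simp add: S_def norm_divide)
      also have "\<dots> \<le> (A ^ (m + 1) * fact (2 * m)) * (1 / h 1)"
        using h1 by (intro mult_right_mono A) auto
      also have "\<dots> \<le> (B ^ (m + 1) * fact (2 * Suc m)) * B"
        using A(1) h1 by (intro mult_mono power_mono fact_mono) (auto simp: B_def)
      finally show ?thesis using Suc by (simp add: algebra_simps)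
    qed
  qed (fact \<open>B \<ge> 1\<close>)
  moreover have "\<forall>k. \<forall>t\<le>0. S k t = 0"
    using h0 \<beta>_zero by (auto simp: S_def split: nat.split)
  moreover have "\<forall>t\<ge>1. S 0 t = 1"
  proof (intro allI impI)
    fix t :: real assume "t \<ge> 1"
    then show "S 0 t = 1" using h_ge[of t] h1 by (simp add: S_def)
  qed
  ultimately show ?thesis by blast
qed

lemma gevrey_bump:
  assumes "r > 0"
  shows "\<exists>F A. gevrey F A \<and> (\<forall>k t. r \<le> \<bar>t\<bar> \<longrightarrow> F k t = 0) \<and> (\<forall>t. \<bar>t\<bar> \<le> r / 2 \<longrightarrow> F 0 t = 1)"
proof -
  obtain S A where S: "gevrey S A" "\<And>k t. t \<le> 0 \<Longrightarrow> S k t = 0" "\<And>t. t \<ge> 1 \<Longrightarrow> S 0 t = 1"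
    using gevrey_step by blast
  \<comment> \<open>The two steps are evaluated at 2 + a t and 2 - a t. With a = 2 / r both
    arguments are at least 1 for |t| up to r / 2, and one of them is nonpositive for |t| from r
    on.\<close>
  define a where "a = 2 / r"
  have a: "a > 0" "a * r = 2" using assms by (auto simp: a_def)
  define F where "F n = leibniz n (\<lambda>k t. of_real (a ^ k) * S k (a * t + 2))
    (\<lambda>k t. of_real ((- a) ^ k) * S k ((- a) * t + 2))" for n
  have "gevrey (\<lambda>k t. of_real (a ^ k) * S k (a * t + 2)) (max 1 \<bar>- a\<bar> * A)"
    using gevrey_affine[OF S(1), of a 2] by simp
  from gevrey_leibniz[OF this gevrey_affine[OF S(1)]]
  have "gevrey F (2 * (max 1 \<bar>- a\<bar> * A)\<^sup>2)" unfolding F_def .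
  moreover have "F k t = 0" if "r \<le> \<bar>t\<bar>" for k t
  proof (cases "t \<ge> 0")
    case True
    then have "a * r \<le> a * t" using a that by (intro mult_left_mono) auto
    then show ?thesis unfolding F_def using S(2) a(2) by (intro leibniz_zero(2)) auto
  next
    case False
    then have "a * t \<le> a * (- r)" using a that by (intro mult_left_mono) auto
    then show ?thesis unfolding F_def using S(2) a(2) by (intro leibniz_zero(1)) auto
  qed
  moreover have "F 0 t = 1" if "\<bar>t\<bar> \<le> r / 2" for t
  proof -
    have "\<bar>a * t\<bar> \<le> a * (r / 2)" using mult_left_mono[OF that, of a] a by (simp add: abs_mult)
    also have "\<dots> = 1" using a by simp
    finally show ?thesis by (simp add: F_def S(3))
  qed
  ultimately show ?thesis by blast
qed

text \<open>The product of the factorials is at most the factorial of the sum, and each coordinate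
  contributes one extra factor \<open>A\<close>.\<close>

lemma norm_prod_gevrey_le:
  assumes "\<And>i. gevrey (F i) A"
  shows "norm (\<Prod>i\<in>UNIV. F i (\<alpha> i) (x $ i)) \<le>
    A ^ (mi_order \<alpha> + CARD('n)) * fact (2 * mi_order (\<alpha> :: 'n::finite \<Rightarrow> nat))"
proof -
  have A: "A \<ge> 1" using gevreyD(1)[OF assms] .
  have "norm (\<Prod>i\<in>I. F i (\<alpha> i) (x $ i)) \<le> A ^ (sum \<alpha> I + card I) * fact (2 * sum \<alpha> I)"
    if "finite I" for I :: "'n set"
    using that
  proof induction
    case (insert i I)
    have "norm (\<Prod>i\<in>insert i I. F i (\<alpha> i) (x $ i)) \<le>
        (A ^ (\<alpha> i + 1) * fact (2 * \<alpha> i)) * (A ^ (sum \<alpha> I + card I) * fact (2 * sum \<alpha> I))"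
      unfolding prod.insert[OF insert(1,2)] norm_mult
      using insert A by (intro mult_mono gevreyD(3)[OF assms]) auto
    also have "\<dots> = A ^ (\<alpha> i + 1 + sum \<alpha> I + card I) * (fact (2 * \<alpha> i) * fact (2 * sum \<alpha> I))"
      by (simp add: power_add)
    also have "\<dots> \<le> A ^ (\<alpha> i + 1 + sum \<alpha> I + card I) * fact (2 * \<alpha> i + 2 * sum \<alpha> I)"
      using A by (intro mult_left_mono fact_mult_le) auto
    finally show ?case using insert by (simp add: algebra_simps)
  qed auto
  from this[of UNIV] show ?thesis by (simp add: mi_order_def)
qed

section \<open>Cubes and smooth cutoffs in several variables\<close>

definition cube :: "real^'n::finite \<Rightarrow> real \<Rightarrow> (real^'n) set" where
  "cube x\<^sub>0 r = cbox (\<chi> i. x\<^sub>0 $ i - r) (\<chi> i. x\<^sub>0 $ i + r)"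

lemma mem_cube: "x \<in> cube x\<^sub>0 r \<longleftrightarrow> (\<forall>i. \<bar>x $ i - x\<^sub>0 $ i\<bar> \<le> r)"
  by (auto simp: cube_def mem_box_cart abs_le_iff algebra_simps)

lemma compact_cube [simp]: "compact (cube x\<^sub>0 r)"
  by (simp add: cube_def)

lemma regular_compact_cube:
  assumes "r > 0"
  shows "regular_compact (cube x\<^sub>0 r)"
proof -
  have "box (\<chi> i. x\<^sub>0 $ i - r) (\<chi> i. x\<^sub>0 $ i + r) \<noteq> {}"
    using assms by (auto simp: interval_ne_empty_cart)
  then show ?thesis
    by (simp add: regular_compact_def cube_def interior_cbox closure_box)
qed

lemma cube_subset_open:
  fixes x\<^sub>0 :: "real^'n::finite"
  assumes "open U" "x\<^sub>0 \<in> U"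
  obtains r where "r > 0" "cube x\<^sub>0 r \<subseteq> U"
proof -
  obtain e where e: "e > 0" "ball x\<^sub>0 e \<subseteq> U"
    using assms openE by blast
  \<comment> \<open>The Euclidean norm is at most the sum of the coordinates' absolute values, here
    at most d r = e / 2.\<close>
  define r where "r = e / (2 * real CARD('n))"
  have "cube x\<^sub>0 r \<subseteq> ball x\<^sub>0 e"
  proof
    fix x assume "x \<in> cube x\<^sub>0 r"
    then have "norm (x - x\<^sub>0) \<le> (\<Sum>i\<in>(UNIV :: 'n set). r)"
      by (intro order_trans[OF norm_le_l1_cart] sum_mono) (auto simp: mem_cube)
    also have "\<dots> < e" using e by (simp add: r_def)
    finally show "x \<in> ball x\<^sub>0 e" by (simp add: dist_norm norm_minus_commute)
  qed
  moreover have "r > 0" using e by (simp add: r_def)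
  ultimately show ?thesis using that e by blast
qed

text \<open>The family of factors is returned along with the cutoff, because derivatives and Fourier
  series are later treated factor by factor, with one Gevrey constant for all coordinates.\<close>

lemma tensor_bump:
  fixes x\<^sub>0 :: "real^'n::finite"
  assumes "r > 0"
  obtains F A where "\<And>i. gevrey (F i) A" "\<And>i k t. r \<le> \<bar>t - x\<^sub>0 $ i\<bar> \<Longrightarrow> F i k t = 0"
    "\<And>x. x \<in> ball x\<^sub>0 (r / 2) \<Longrightarrow> tensor F x = 1" "smooth_on UNIV (tensor F)"
    "supp (tensor F) \<subseteq> cube x\<^sub>0 r"
proof -
  obtain G A where G: "gevrey G A" "\<And>k t. r \<le> \<bar>t\<bar> \<Longrightarrow> G k t = 0"
    "\<And>t. \<bar>t\<bar> \<le> r / 2 \<Longrightarrow> G 0 t = 1"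
    using gevrey_bump[OF assms] by blast
  define F where "F i k t = G k (t - x\<^sub>0 $ i)" for i :: 'n and k t
  have gev: "gevrey (F i) A" for i
    using gevrey_affine[OF G(1), of 1 "- x\<^sub>0 $ i"] by (simp add: F_def[abs_def])
  moreover have zero: "F i k t = 0" if "r \<le> \<bar>t - x\<^sub>0 $ i\<bar>" for i k t
    using G(2) that by (simp add: F_def)
  moreover have "tensor F x = 1" if "x \<in> ball x\<^sub>0 (r / 2)" for x
  proof -
    have "\<bar>x $ i - x\<^sub>0 $ i\<bar> \<le> r / 2" for i
      using component_le_norm_cart[of "x - x\<^sub>0" i] that by (simp add: dist_norm norm_minus_commute)
    then show ?thesis by (simp add: tensor_def F_def G(3))
  qed
  moreover have "smooth_on UNIV (tensor F)"
    by (rule iter_partial_tensor(2)) (use gev gevreyD(2) in blast)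
  moreover have "supp (tensor F) \<subseteq> cube x\<^sub>0 r"
  proof (rule supp_subsetI)
    show "x \<in> cube x\<^sub>0 r" if "tensor F x \<noteq> 0" for x
    proof -
      have "F i 0 (x $ i) \<noteq> 0" for i using that by (simp add: tensor_def)
      then show ?thesis using zero unfolding mem_cube by (meson linear)
    qed
  qed (simp add: compact_imp_closed)
  ultimately show ?thesis using that by blast
qed

text \<open>Finitely many local cutoffs \<open>\<psi> x\<close> are glued as one minus the product
  of the 1 - \<open>\<psi> x\<close>, which equals 1 as soon as one of them does and vanishes where
  all of them do.\<close>

lemma cutoff_exists:
  fixes U :: "(real^'n::finite) set"
  assumes U: "open U" and K: "compact K" "K \<subseteq> U"
  shows "\<exists>W \<theta>. open W \<and> K \<subseteq> W \<and> \<theta> \<in> test_functions U \<and> (\<forall>x\<in>W. \<theta> x = 1)"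
proof -
  have "\<forall>x\<in>K. \<exists>\<psi> e. \<psi> \<in> test_functions U \<and> e > 0 \<and> (\<forall>y\<in>ball x e. \<psi> y = 1)"
  proof
    fix x assume "x \<in> K"
    then obtain r where r: "r > 0" "cube x r \<subseteq> U" using cube_subset_open U K by blast
    obtain F A where F: "\<And>y. y \<in> ball x (r / 2) \<Longrightarrow> tensor F y = 1" "smooth_on UNIV (tensor F)"
      "supp (tensor F) \<subseteq> cube x r"
      using tensor_bump[OF r(1)] by metis
    have "compact (supp (tensor F))"
      using F(3) by (metis closed_supp compact_cube compact_Int_closed inf.absorb_iff2)
    then have "tensor F \<in> test_functions U" using F r by (auto simp: test_functions_def)
    then show "\<exists>\<psi> e. \<psi> \<in> test_functions U \<and> e > 0 \<and> (\<forall>y\<in>ball x e. \<psi> y = 1)"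
      using F(1) r(1) by (intro exI[of _ "tensor F"] exI[of _ "r / 2"]) auto
  qed
  then obtain \<psi> e where \<psi>: "\<And>x. x \<in> K \<Longrightarrow> \<psi> x \<in> test_functions U" "\<And>x. x \<in> K \<Longrightarrow> e x > (0::real)"
    "\<And>x y. x \<in> K \<Longrightarrow> y \<in> ball x (e x) \<Longrightarrow> \<psi> x y = 1"
    by metis
  obtain T where T: "T \<subseteq> K" "finite T" "K \<subseteq> (\<Union>x\<in>T. ball x (e x))"
  proof (rule compactE_image[OF K(1), of K "\<lambda>x. ball x (e x)"])
    show "K \<subseteq> (\<Union>x\<in>K. ball x (e x))" using \<psi>(2) by force
  qed auto
  define W where "W = (\<Union>x\<in>T. ball x (e x))"
  define \<theta> where "\<theta> y = 1 - (\<Prod>x\<in>T. 1 - \<psi> x y)" for y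
  have one: "\<theta> y = 1" if "y \<in> W" for y
  proof -
    obtain x where x: "x \<in> T" "y \<in> ball x (e x)" using \<open>y \<in> W\<close> unfolding W_def by blast
    then have "1 - \<psi> x y = 0" using \<psi>(3) T by auto
    then show ?thesis using x T(2) by (auto simp: \<theta>_def)
  qed
  have "smooth_on UNIV \<theta>"
    unfolding \<theta>_def using T(1) \<psi>(1)
    by (intro iter_partial_diff(2) smooth_on_prod iter_partial_const(2) open_UNIV
        test_functionsD(1)[of "\<psi> _" U]) auto
  moreover have sub: "supp \<theta> \<subseteq> (\<Union>x\<in>T. supp (\<psi> x))"
  proof (rule supp_subsetI)
    show "y \<in> (\<Union>x\<in>T. supp (\<psi> x))" if "\<theta> y \<noteq> 0" for y
    proof (rule ccontr)
      assume "y \<notin> (\<Union>x\<in>T. supp (\<psi> x))"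
      then have "\<psi> x y = 0" if "x \<in> T" for x using that notin_supp by blast
      then show False using that by (simp add: \<theta>_def)
    qed
  qed (use T in auto)
  moreover have "compact (\<Union>x\<in>T. supp (\<psi> x))"
    using T \<psi>(1) test_functionsD(2) by (intro compact_UN) blast+
  then have "compact (supp \<theta>)"
    using sub by (metis closed_supp compact_Int_closed inf.absorb_iff2)
  moreover have "(\<Union>x\<in>T. supp (\<psi> x)) \<subseteq> U"
    using T \<psi>(1) test_functionsD(3) by blast
  ultimately have "\<theta> \<in> test_functions U" by (auto simp: test_functions_def)
  moreover have "open W" "K \<subseteq> W" using T by (auto simp: W_def)
  ultimately show ?thesis using one by blast
qed

section \<open>Compactly supported distributions\<close>

lemma supported_in_vanishes:
  assumes "supported_in U v K" "open W" "K \<subseteq> W" "\<psi> \<in> test_functions U" "\<And>x. x \<in> W \<Longrightarrow> \<psi> x = 0"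
  shows "v \<psi> = 0"
proof -
  have "supp \<psi> \<subseteq> - W" using assms by (intro supp_subsetI) auto
  then have "\<psi> \<in> test_functions (U - K)"
    using assms(3) test_functionsD(3)[OF assms(4)] by (intro test_functions_subset[OF assms(4)]) blast
  then show ?thesis using assms(1) by (auto simp: supported_in_def equal_on_def)
qed

text \<open>Two cutoffs are compared through their product: v(\<theta> f) = v(\<theta> \<theta>' f)
  = v(\<theta>' f), since each difference vanishes near a compact set that carries
  \<open>v\<close>.\<close>

lemma pairing_eq:
  assumes U: "open U" and v: "distribution U v" and f: "smooth_on U f"
    and K: "compact K" "K \<subseteq> U" "supported_in U v K"
    and W: "open W" "K \<subseteq> W" and \<theta>: "\<theta> \<in> test_functions U" "\<And>x. x \<in> W \<Longrightarrow> \<theta> x = 1"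
  shows "pairing U v f = v (\<lambda>x. \<theta> x * f x)"
proof -
  have key: "v (\<lambda>x. \<theta> x * f x) = v (\<lambda>x. \<theta> x * (\<theta>' x * f x))"
    if "supported_in U v K" "open W" "K \<subseteq> W" "\<And>x. x \<in> W \<Longrightarrow> \<theta>' x = 1"
      "\<theta> \<in> test_functions U" "\<theta>' \<in> test_functions U" for \<theta> \<theta>' K W
  proof -
    have s: "smooth_on U (\<lambda>x. \<theta>' x * f x)"
      using that by (intro iter_partial_mult(2) U f test_functionsD(1))
    note t = test_functions_mult(1)[OF U that(5) f] test_functions_mult(1)[OF U that(5) s]
    have "(\<lambda>x. \<theta> x * f x - \<theta> x * (\<theta>' x * f x)) = (\<lambda>x. \<theta> x * (f x - \<theta>' x * f x))"
      by (simp add: algebra_simps)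
    then have "(\<lambda>x. \<theta> x * f x - \<theta> x * (\<theta>' x * f x)) \<in> test_functions U"
      using test_functions_mult(1)[OF U that(5) iter_partial_diff(2)[OF U f s]] by simp
    then have "v (\<lambda>x. \<theta> x * f x - \<theta> x * (\<theta>' x * f x)) = 0"
      by (rule supported_in_vanishes[OF that(1-3)]) (simp add: that(4))
    then show ?thesis using distribution_diff[OF v t] by simp
  qed
  show ?thesis unfolding pairing_def
  proof (rule the_equality)
    show "\<exists>K W \<theta>'. compact K \<and> K \<subseteq> U \<and> supported_in U v K \<and> open W \<and> K \<subseteq> W \<and>
        \<theta>' \<in> test_functions U \<and> (\<forall>x\<in>W. \<theta>' x = 1) \<and> v (\<lambda>x. \<theta> x * f x) = v (\<lambda>x. \<theta>' x * f x)"
      using assms by blast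
  next
    fix c
    assume "\<exists>K W \<theta>. compact K \<and> K \<subseteq> U \<and> supported_in U v K \<and> open W \<and> K \<subseteq> W \<and>
        \<theta> \<in> test_functions U \<and> (\<forall>x\<in>W. \<theta> x = 1) \<and> c = v (\<lambda>x. \<theta> x * f x)"
    then obtain K' W' \<theta>' where *: "supported_in U v K'" "open W'" "K' \<subseteq> W'"
      "\<theta>' \<in> test_functions U" "\<And>x. x \<in> W' \<Longrightarrow> \<theta>' x = 1" "c = v (\<lambda>x. \<theta>' x * f x)" by blast
    have "v (\<lambda>x. \<theta> x * f x) = v (\<lambda>x. \<theta> x * (\<theta>' x * f x))"
      using key[OF *(1-3,5) \<theta>(1) *(4)] .
    also have "(\<lambda>x. \<theta> x * (\<theta>' x * f x)) = (\<lambda>x. \<theta>' x * (\<theta> x * f x))" by (simp add: mult_ac)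
    also have "v \<dots> = c"
      using key[OF K(3) W \<theta>(2) *(4) \<theta>(1)] *(6) by simp
    finally show "c = v (\<lambda>x. \<theta> x * f x)" by simp
  qed
qed

text \<open>The description in \<open>pairing\<close> leaves the cutoff open for each
  \<open>f\<close>. One cutoff that serves all \<open>f\<close> at once reduces linearity of the
  pairing to that of \<open>v\<close>.\<close>

lemma pairing_cutoff:
  assumes U: "open U" and v: "compact_distribution U v"
  shows "\<exists>\<theta>\<in>test_functions U. \<forall>f. smooth_on U f \<longrightarrow> pairing U v f = v (\<lambda>x. \<theta> x * f x)"
    and "f \<in> test_functions U \<Longrightarrow> pairing U v f = v f"
proof -
  obtain K where K: "compact K" "K \<subseteq> U" "supported_in U v K" and d: "distribution U v"
    using v by (auto simp: compact_distribution_def)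
  obtain W \<theta> where W: "open W" "K \<subseteq> W" "\<theta> \<in> test_functions U" "\<And>x. x \<in> W \<Longrightarrow> \<theta> x = 1"
    using cutoff_exists[OF U K(1,2)] by blast
  have eq: "pairing U v f = v (\<lambda>x. \<theta> x * f x)" if "smooth_on U f" for f
    using pairing_eq[OF U d that K W] .
  with W show "\<exists>\<theta>\<in>test_functions U. \<forall>f. smooth_on U f \<longrightarrow> pairing U v f = v (\<lambda>x. \<theta> x * f x)"
    by blast
  assume f: "f \<in> test_functions U"
  have s: "smooth_on U f" using f by (rule test_functionsD)
  have t: "(\<lambda>x. \<theta> x * f x) \<in> test_functions U" by (rule test_functions_mult(1)[OF U W(3) s])
  have "(\<lambda>x. \<theta> x * f x - f x) \<in> test_functions U"
    using test_functions_add(1)[OF t test_functions_cmult(1)[OF f, of "-1"]] by simp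
  then have "v (\<lambda>x. \<theta> x * f x - f x) = 0"
    by (rule supported_in_vanishes[OF K(3) W(1,2)]) (simp add: W(4))
  then show "pairing U v f = v f" using distribution_diff[OF d t f] eq[OF s] by simp
qed

lemma pairing_add:
  assumes U: "open U" and v: "compact_distribution U v" and f: "smooth_on U f" "smooth_on U g"
  shows "pairing U v (\<lambda>x. f x + g x) = pairing U v f + pairing U v g"
proof -
  obtain \<theta> where \<theta>: "\<theta> \<in> test_functions U" "\<And>f. smooth_on U f \<Longrightarrow> pairing U v f = v (\<lambda>x. \<theta> x * f x)"
    using pairing_cutoff(1)[OF U v] by blast
  have d: "distribution U v" using v by (simp add: compact_distribution_def)
  show ?thesis
    using distribution_add[OF d test_functions_mult(1)[OF U \<theta>(1) f(1)] test_functions_mult(1)[OF U \<theta>(1) f(2)]]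
    by (simp add: \<theta>(2) f iter_partial_add(2)[OF U f] ring_distribs)
qed

lemma pairing_cmult:
  assumes U: "open U" and v: "compact_distribution U v" and f: "smooth_on U f"
  shows "pairing U v (\<lambda>x. c * f x) = c * pairing U v f"
proof -
  obtain \<theta> where \<theta>: "\<theta> \<in> test_functions U" "\<And>f. smooth_on U f \<Longrightarrow> pairing U v f = v (\<lambda>x. \<theta> x * f x)"
    using pairing_cutoff(1)[OF U v] by blast
  have d: "distribution U v" using v by (simp add: compact_distribution_def)
  show ?thesis
    using distribution_cmult[OF d test_functions_mult(1)[OF U \<theta>(1) f], of c]
    by (simp add: \<theta>(2) f iter_partial_cmult(2)[OF U f] mult_ac)
qed

lemma pairing_diff:
  assumes U: "open U" and v: "compact_distribution U v" and f: "smooth_on U f" "smooth_on U g"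
  shows "pairing U v (\<lambda>x. f x - g x) = pairing U v f - pairing U v g"
  using pairing_add[OF U v f(1) iter_partial_cmult(2)[OF U f(2), of "-1"]]
    pairing_cmult[OF U v f(2), of "-1"] by simp

lemma pairing_sum:
  assumes U: "open U" and v: "compact_distribution U v"
    and f: "\<And>k. k \<in> S \<Longrightarrow> smooth_on U (f k)" and "finite S"
  shows "pairing U v (\<lambda>x. \<Sum>k\<in>S. f k x) = (\<Sum>k\<in>S. pairing U v (f k))"
  using \<open>finite S\<close> f
proof (induction S)
  case empty
  show ?case using pairing_cmult[OF U v iter_partial_const(2)[of _ 0], of 0] by simp
next
  case (insert k S)
  then show ?case
    using pairing_add[OF U v, of "f k" "\<lambda>x. \<Sum>k\<in>S. f k x"] smooth_on_sum[OF U, of S f] by simp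
qed

lemma deriv_le_UNIV:
  assumes "deriv_le m K f B" "supp f \<subseteq> K" "B \<ge> 0"
  shows "deriv_le m UNIV f B"
  using assms iter_partial_notin_supp[of _ f] unfolding deriv_le_def mi_deriv_eq
  by (metis norm_zero subsetD)

text \<open>The product is carried by \<open>supp \<phi>\<close>, and any \<theta> equal to 1 near
  it satisfies \<phi> \<theta> = \<phi>; thus \<phi> itself acts as the cutoff in the
  pairing.\<close>

lemma mult_dist_compact:
  assumes U: "open U" and u: "distribution U u" and \<phi>: "\<phi> \<in> test_functions U"
  shows "compact_distribution U (mult_dist \<phi> u)"
    and "smooth_on U f \<Longrightarrow> pairing U (mult_dist \<phi> u) f = u (\<lambda>x. \<phi> x * f x)"
proof -
  note P = test_functionsD[OF \<phi>]
  have t: "(\<lambda>x. \<phi> x * \<psi> x) \<in> test_functions U" if "\<psi> \<in> test_functions U" for \<psi>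
    by (intro test_functions_mult(1)[OF U \<phi>] test_functionsD(1)[OF that])
  have d: "distribution U (mult_dist \<phi> u)"
  proof (rule distributionI)
    fix \<psi> \<psi>' assume "\<psi> \<in> test_functions U" "\<psi>' \<in> test_functions U"
    from distribution_add[OF u t[OF this(1)] t[OF this(2)]]
    show "mult_dist \<phi> u (\<lambda>x. \<psi> x + \<psi>' x) = mult_dist \<phi> u \<psi> + mult_dist \<phi> u \<psi>'"
      by (simp add: mult_dist_def ring_distribs)
  next
    fix \<psi> c assume "\<psi> \<in> test_functions U"
    from distribution_cmult[OF u t[OF this], of c]
    show "mult_dist \<phi> u (\<lambda>x. c * \<psi> x) = c * mult_dist \<phi> u \<psi>"
      by (simp add: mult_dist_def mult_ac)
  next
    fix K :: "(real^'a) set" assume K: "compact K" "K \<subseteq> U"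
    obtain C m where C: "C \<ge> 0" "\<And>\<psi> B. \<psi> \<in> test_functions U \<Longrightarrow> supp \<psi> \<subseteq> supp \<phi> \<Longrightarrow>
        deriv_le m UNIV \<psi> B \<Longrightarrow> norm (u \<psi>) \<le> C * B"
      using distribution_bound[OF u P(2,3)] by blast
    obtain A where A: "A \<ge> 0" "deriv_le m (supp \<phi>) \<phi> A"
      using smooth_on_deriv_le P by blast
    then have A': "deriv_le m UNIV \<phi> A" by (intro deriv_le_UNIV) auto
    have "norm (mult_dist \<phi> u \<psi>) \<le> (C * 2 ^ m * A) * B"
      if \<psi>: "\<psi> \<in> test_functions U" "B \<ge> 0" "deriv_le m UNIV \<psi> B" for \<psi> B
    proof -
      have "norm (u (\<lambda>x. \<phi> x * \<psi> x)) \<le> C * (2 ^ m * A * B)"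
        by (intro C(2) t \<psi> deriv_le_mult[of UNIV] test_functions_mult(2)[OF U \<phi>] A A'
            test_functionsD(1)[OF \<phi>] test_functionsD(1)[OF \<psi>(1)]) auto
      then show ?thesis by (simp add: mult_dist_def mult_ac)
    qed
    then show "\<exists>C m. \<forall>\<psi>\<in>test_functions U. \<forall>B\<ge>0. supp \<psi> \<subseteq> K \<longrightarrow> deriv_le m UNIV \<psi> B \<longrightarrow>
        norm (mult_dist \<phi> u \<psi>) \<le> C * B" by blast
  qed
  have s: "supported_in U (mult_dist \<phi> u) (supp \<phi>)"
    unfolding supported_in_def equal_on_def
  proof
    fix \<psi> assume \<psi>: "\<psi> \<in> test_functions (U - supp \<phi>)"
    have "\<phi> x * \<psi> x = 0 * \<psi> x" for x
      using notin_supp[of x \<phi>] notin_supp[of x \<psi>] test_functionsD(3)[OF \<psi>] by auto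
    then have "mult_dist \<phi> u \<psi> = u (\<lambda>x. 0 * \<psi> x)" unfolding mult_dist_def by presburger
    also have "\<dots> = 0 * u \<psi>"
    proof (rule distribution_cmult[OF u])
      show "\<psi> \<in> test_functions U"
        using \<psi> test_functionsD(3)[OF \<psi>] by (intro test_functions_subset[OF \<psi>]) auto
    qed
    finally show "mult_dist \<phi> u \<psi> = 0" by simp
  qed
  show "compact_distribution U (mult_dist \<phi> u)"
    using d s P unfolding compact_distribution_def by blast
  assume f: "smooth_on U f"
  obtain W \<theta> where W: "open W" "supp \<phi> \<subseteq> W" "\<theta> \<in> test_functions U" "\<And>x. x \<in> W \<Longrightarrow> \<theta> x = 1"
    using cutoff_exists[OF U P(2,3)] by blast
  have "\<phi> x * (\<theta> x * f x) = \<phi> x * f x" for x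
    using notin_supp[of x \<phi>] W(2,4) by (cases "x \<in> supp \<phi>") auto
  then have "mult_dist \<phi> u (\<lambda>x. \<theta> x * f x) = u (\<lambda>x. \<phi> x * f x)"
    unfolding mult_dist_def by presburger
  then show "pairing U (mult_dist \<phi> u) f = u (\<lambda>x. \<phi> x * f x)"
    using pairing_eq[OF U d f P(2,3) s W] by simp
qed

section \<open>Bounded sequences of compactly supported distributions\<close>

lemma bounded_smooth_deriv_le:
  fixes U :: "(real^'n::finite) set"
  assumes "bounded_smooth U B" "compact K" "K \<subseteq> U"
  shows "\<exists>C\<ge>0. \<forall>f\<in>B. deriv_le m K f C"
proof -
  let ?S = "{\<alpha> :: 'n \<Rightarrow> nat. mi_order \<alpha> \<le> m}"
  have "\<forall>\<alpha>. \<exists>C. \<forall>f\<in>B. \<forall>x\<in>K. norm (mi_deriv \<alpha> f x) \<le> C"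
    using assms by (auto simp: bounded_smooth_def)
  then obtain C where C: "\<And>\<alpha> f x. f \<in> B \<Longrightarrow> x \<in> K \<Longrightarrow> norm (mi_deriv \<alpha> f x) \<le> C \<alpha>"
    by metis
  have "\<forall>f\<in>B. deriv_le m K f (\<Sum>\<alpha>\<in>?S. \<bar>C \<alpha>\<bar>)"
    unfolding deriv_le_def
  proof (intro ballI allI impI)
    fix f x and \<alpha> :: "'n \<Rightarrow> nat" assume "f \<in> B" "mi_order \<alpha> \<le> m" "x \<in> K"
    then have "\<bar>C \<alpha>\<bar> \<le> (\<Sum>\<alpha>\<in>?S. \<bar>C \<alpha>\<bar>)"
      using finite_mi_order_le by (intro member_le_sum) auto
    then show "norm (mi_deriv \<alpha> f x) \<le> (\<Sum>\<alpha>\<in>?S. \<bar>C \<alpha>\<bar>)"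
      using C[OF \<open>f \<in> B\<close> \<open>x \<in> K\<close>, of \<alpha>] by linarith
  qed
  then show ?thesis by (intro exI[of _ "\<Sum>\<alpha>\<in>?S. \<bar>C \<alpha>\<bar>"]) (auto intro: sum_nonneg)
qed

text \<open>Continuity of \<open>u\<close> on functions supported in \<open>supp \<phi>\<close>
  bounds the pairing by finitely many derivatives of \<open>f\<close> there, and these are uniformly
  bounded over a bounded set.\<close>

lemma mult_dist_bounded:
  assumes U: "open U" and u: "distribution U u" and \<phi>: "\<phi> \<in> test_functions U"
  shows "bounded_compact_seq U (\<lambda>N. mult_dist \<phi> u)"
  unfolding bounded_compact_seq_def
proof (intro conjI allI impI)
  show "compact_distribution U (mult_dist \<phi> u)" by (rule mult_dist_compact[OF assms])
  fix B assume B: "bounded_smooth U B"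
  note P = test_functionsD[OF \<phi>]
  obtain C m where C: "C \<ge> 0" "\<And>\<psi> B. \<psi> \<in> test_functions U \<Longrightarrow> supp \<psi> \<subseteq> supp \<phi> \<Longrightarrow>
      deriv_le m UNIV \<psi> B \<Longrightarrow> norm (u \<psi>) \<le> C * B"
    using distribution_bound[OF u P(2,3)] by blast
  obtain A where A: "A \<ge> 0" "deriv_le m (supp \<phi>) \<phi> A"
    using smooth_on_deriv_le P by blast
  obtain D where D: "D \<ge> 0" "\<And>f. f \<in> B \<Longrightarrow> deriv_le m (supp \<phi>) f D"
    using bounded_smooth_deriv_le[OF B P(2,3)] by blast
  have "norm (pairing U (mult_dist \<phi> u) f) \<le> C * (2 ^ m * A * D)" if f: "f \<in> B" for f
  proof -
    have s: "smooth_on U f" using B f by (auto simp: bounded_smooth_def)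
    have "deriv_le m UNIV (\<lambda>x. \<phi> x * f x) (2 ^ m * A * D)"
      using test_functions_mult(2)[OF U \<phi> s] A(1) D(1)
      by (intro deriv_le_UNIV[of _ "supp \<phi>"] deriv_le_mult[OF U P(1) s P(3)] A D f) auto
    then show ?thesis
      unfolding mult_dist_compact(2)[OF assms s]
      by (intro C test_functions_mult[OF U \<phi> s])
  qed
  then show "\<exists>C. \<forall>N. \<forall>f\<in>B. norm (pairing U (mult_dist \<phi> u) f) \<le> C" by blast
qed

text \<open>A bounded sequence is equicontinuous, because \<open>C\<^sup>\<infinity>(U)\<close> is metrizable: functions violating
  the estimates with constants tending to infinity can be rescaled to a bounded set on which the
  sequence is unbounded.\<close>

lemma bounded_compact_seq_equicontinuous:
  fixes U :: "(real^'n::finite) set"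
  assumes U: "open U" and v: "bounded_compact_seq U v"
  obtains K C m where "compact K" "K \<subseteq> U" "C \<ge> 0"
    "\<And>N f B. smooth_on U f \<Longrightarrow> B \<ge> 0 \<Longrightarrow> deriv_le m K f B \<Longrightarrow> norm (pairing U (v N) f) \<le> C * B"
proof -
  have "\<exists>E :: nat \<Rightarrow> _. (\<forall>n. compact (E n)) \<and> (\<forall>n. E n \<subseteq> U) \<and>
      (\<forall>K. compact K \<longrightarrow> K \<subseteq> U \<longrightarrow> (\<exists>n0. \<forall>n\<ge>n0. K \<subseteq> E n))"
  proof (rule open_Union_compact_subsets[OF U])
    fix C :: "nat \<Rightarrow> (real^'n) set"
    assume "\<And>n. compact (C n)" "\<And>n. C n \<subseteq> U"
      "\<And>K. compact K \<Longrightarrow> K \<subseteq> U \<Longrightarrow> \<exists>N. \<forall>n\<ge>N. K \<subseteq> C n"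
    note C = this
    show ?thesis by (intro exI[of _ C] conjI allI impI C)
  qed
  then obtain E :: "nat \<Rightarrow> _" where E: "\<And>n. compact (E n)" "\<And>n. E n \<subseteq> U"
    "\<forall>K. compact K \<longrightarrow> K \<subseteq> U \<longrightarrow> (\<exists>n0. \<forall>n\<ge>n0. K \<subseteq> E n)"
    by blast
  have cd: "compact_distribution U (v N)" for N
    using v by (auto simp: bounded_compact_seq_def)
  \<comment> \<open>A single \<open>n\<close> plays three roles: order of differentiation, index in
    the exhaustion \<open>E\<close>, and constant. A failure for every \<open>n\<close> then yields
    one sequence of counterexamples.\<close>
  have "\<exists>n. \<forall>N f B. smooth_on U f \<longrightarrow> B \<ge> 0 \<longrightarrow> deriv_le n (E n) f B \<longrightarrow>
      norm (pairing U (v N) f) \<le> real n * B"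
  proof (rule ccontr)
    assume "\<not> ?thesis"
    then have "\<forall>n. \<exists>N f B. smooth_on U f \<and> B \<ge> 0 \<and> deriv_le n (E n) f B \<and>
        norm (pairing U (v N) f) > real n * B"
      by (meson not_le)
    then obtain N f B where f: "\<And>n. smooth_on U (f n)" "\<And>n. B n \<ge> 0" "\<And>n. deriv_le n (E n) (f n) (B n)"
      "\<And>n. norm (pairing U (v (N n)) (f n)) > real n * B n"
      by metis
    \<comment> \<open>If \<open>B n = 0\<close>, the seminorm bound survives any scaling, so the
      factor is chosen to give the pairing modulus \<open>n + 1\<close>; otherwise the seminorm
      bound is normalized to 1.\<close>
    define c where "c n = (if B n > 0 then 1 / B n else (real n + 1) / norm (pairing U (v (N n)) (f n)))" for n
    define g where "g n x = complex_of_real (c n) * f n x" for n x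
    have g: "smooth_on U (g n)" for n
      unfolding g_def by (rule iter_partial_cmult(2)[OF U f(1)])
    have c: "c n \<ge> 0" for n using f(2)[of n] by (auto simp: c_def)
    have gd: "deriv_le n (E n) (g n) 1" for n
    proof -
      have "deriv_le n (E n) (g n) (norm (complex_of_real (c n)) * B n)"
        unfolding g_def by (rule deriv_le_cmult[OF U f(1) E(2) f(3)])
      moreover have "norm (complex_of_real (c n)) * B n \<le> 1"
        using c[of n] f(2)[of n] by (auto simp: c_def)
      ultimately show ?thesis by (rule deriv_le_mono[OF _ order_refl order_refl])
    qed
    have big: "norm (pairing U (v (N n)) (g n)) \<ge> real n" for n
    proof -
      have eq: "norm (pairing U (v (N n)) (g n)) = c n * norm (pairing U (v (N n)) (f n))"
        unfolding g_def pairing_cmult[OF U cd f(1)] using c[of n] by (simp add: norm_mult)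
      show ?thesis
      proof (cases "B n > 0")
        case True
        then show ?thesis using f(4)[of n] unfolding eq by (simp add: c_def field_simps)
      next
        case False
        then have "B n = 0" using f(2)[of n] by simp
        then have "norm (pairing U (v (N n)) (f n)) > 0" using f(4)[of n] by simp
        then show ?thesis using False unfolding eq by (simp add: c_def)
      qed
    qed
    have "bounded_smooth U (range g)"
      unfolding bounded_smooth_def
    proof (intro conjI ballI allI impI)
      fix h assume "h \<in> range g" then show "smooth_on U h" using g by blast
    next
      fix K :: "(real^'n) set" and \<alpha> :: "'n \<Rightarrow> nat" assume K: "compact K \<and> K \<subseteq> U"
      obtain n0 where n0: "\<And>n. n \<ge> n0 \<Longrightarrow> K \<subseteq> E n" using E(3) K by blast
      have "\<forall>n. \<exists>b\<ge>0. \<forall>x\<in>K. norm (mi_deriv \<alpha> (g n) x) \<le> b"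
        using smooth_on_bounded[OF g] K by (auto simp: mi_deriv_eq)
      then obtain b where b: "\<And>n. b n \<ge> 0" "\<And>n x. x \<in> K \<Longrightarrow> norm (mi_deriv \<alpha> (g n) x) \<le> b n"
        by metis
      \<comment> \<open>From \<open>n1\<close> on, the seminorm of index \<open>n\<close> controls
        the derivative \<alpha> on \<open>K\<close>; the finitely many earlier functions are bounded
        one by one.\<close>
      define n1 where "n1 = max n0 (mi_order \<alpha>)"
      have "norm (mi_deriv \<alpha> (g n) x) \<le> 1 + sum b {..<n1}" if x: "x \<in> K" for n x
      proof (cases "n < n1")
        case True
        then have "b n \<le> sum b {..<n1}" using b(1) by (intro member_le_sum) auto
        then show ?thesis using b(2)[OF x, of n] by linarith
      next
        case False
        then have "n0 \<le> n" "mi_order \<alpha> \<le> n" by (auto simp: n1_def)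
        then have "norm (mi_deriv \<alpha> (g n) x) \<le> 1"
          using gd[of n] n0[of n] x unfolding deriv_le_def by blast
        then show ?thesis using b(1) by (smt (verit) sum_nonneg)
      qed
      then show "\<exists>C. \<forall>f\<in>range g. \<forall>x\<in>K. norm (mi_deriv \<alpha> f x) \<le> C" by blast
    qed
    then obtain C where C: "\<And>N n. norm (pairing U (v N) (g n)) \<le> C"
      using v unfolding bounded_compact_seq_def by blast
    obtain n where "real n > C" using reals_Archimedean2 by blast
    then show False using big[of n] C[of "N n" n] by linarith
  qed
  then show ?thesis using that[OF E(1,2), of "real n" n for n] by (metis of_nat_0_le_iff)
qed

section \<open>Fourier series\<close>

text \<open>Here \<open>w\<close> is the fundamental angular frequency: the period is 2 pi / w, with
  period interval from -pi / w to pi / w.\<close>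

definition fmode :: "real \<Rightarrow> int \<Rightarrow> real \<Rightarrow> complex" where
  "fmode w k t = exp (\<i> * of_real (w * of_int k * t))"

definition fcoeff :: "real \<Rightarrow> (real \<Rightarrow> complex) \<Rightarrow> int \<Rightarrow> complex" where
  "fcoeff w f k = of_real (w / (2 * pi)) * integral {- pi / w..pi / w} (\<lambda>t. f t * fmode w (- k) t)"

lemma norm_fmode [simp]: "norm (fmode w k t) = 1"
  by (simp add: fmode_def)

lemma fmode_0 [simp]: "fmode w 0 t = 1"
  by (simp add: fmode_def)

lemma fmode_at_0 [simp]: "fmode w k 0 = 1"
  by (simp add: fmode_def)

lemma fmode_add: "fmode w (k + l) t = fmode w k t * fmode w l t"
  by (simp add: fmode_def exp_add[symmetric] algebra_simps)

lemma fmode_diff: "fmode w k (t - x) = fmode w k t * fmode w (- k) x"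
  by (simp add: fmode_def exp_add[symmetric] algebra_simps)

lemma cnj_fmode: "cnj (fmode w k t) = fmode w (- k) t"
  by (simp add: fmode_def exp_cnj)

lemma fmode_has_vector_derivative:
  "(fmode w k has_vector_derivative (\<i> * of_real (w * of_int k) * fmode w k t)) (at t within S)"
proof -
  have "((\<lambda>z. exp (\<i> * of_real (w * of_int k) * z)) has_field_derivative
      exp (\<i> * of_real (w * of_int k) * of_real t) * (\<i> * of_real (w * of_int k))) (at (of_real t))"
    by (auto intro!: derivative_eq_intros)
  from has_vector_derivative_real_field[OF this]
  show ?thesis by (simp add: fmode_def[abs_def] mult_ac)
qed

lemma continuous_on_fmode [continuous_intros]: "continuous_on S (fmode w k)"
  by (meson continuous_on_vector_derivative fmode_has_vector_derivative)

lemma integral_fmode: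
  assumes "w > 0"
  shows "integral {- pi / w..pi / w} (fmode w k) = (if k = 0 then of_real (2 * pi / w) else 0)"
proof (cases "k = 0")
  case False
  define c where "c = \<i> * complex_of_real (w * of_int k)"
  have c: "c \<noteq> 0" using False assms by (simp add: c_def)
  have "((\<lambda>t. fmode w k t) has_integral (fmode w k (pi / w) / c - fmode w k (- pi / w) / c)) {- pi / w..pi / w}"
  proof (rule fundamental_theorem_of_calculus)
    show "- pi / w \<le> pi / w" using assms by (simp add: field_simps)
    fix t
    have "((\<lambda>t. fmode w k t / c) has_vector_derivative (c * fmode w k t) / c) (at t within {- pi / w..pi / w})"
      unfolding c_def by (intro has_vector_derivative_divide fmode_has_vector_derivative)
    then show "((\<lambda>t. fmode w k t / c) has_vector_derivative fmode w k t) (at t within {- pi / w..pi / w})"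
      using c by simp
  qed
  moreover have "fmode w k (pi / w) = fmode w k (- pi / w)"
  proof -
    have "w * of_int k * (pi / w) = of_int k * pi" "w * of_int k * (- pi / w) = - (of_int k * pi)"
      using assms by auto
    then show ?thesis
      unfolding fmode_def by (simp only: exp_eq) (intro exI[of _ k], simp add: algebra_simps)
  qed
  ultimately show ?thesis using False by (auto simp: integral_unique)
next
  case True
  then show ?thesis using assms by (simp add: fmode_def[abs_def] scaleR_conv_of_real)
qed

lemma fcoeff_add:
  assumes "continuous_on {- pi / w..pi / w} f" "continuous_on {- pi / w..pi / w} g"
  shows "fcoeff w (\<lambda>t. f t + c * g t) k = fcoeff w f k + c * fcoeff w g k"
proof -
  have "integral {- pi / w..pi / w} (\<lambda>t. (f t + c * g t) * fmode w (- k) t) =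
      integral {- pi / w..pi / w} (\<lambda>t. f t * fmode w (- k) t + c * (g t * fmode w (- k) t))"
    by (simp add: algebra_simps)
  also have "\<dots> = integral {- pi / w..pi / w} (\<lambda>t. f t * fmode w (- k) t) +
      integral {- pi / w..pi / w} (\<lambda>t. c * (g t * fmode w (- k) t))"
    by (intro Henstock_Kurzweil_Integration.integral_add integrable_continuous_interval continuous_intros assms)
  finally show ?thesis by (simp add: fcoeff_def algebra_simps)
qed

lemma fcoeff_fmode:
  assumes "w > 0"
  shows "fcoeff w (fmode w l) k = (if k = l then 1 else 0)"
  using assms integral_fmode[OF assms, of "l - k"]
  by (simp add: fcoeff_def fmode_add[symmetric])

lemma norm_fcoeff_le:
  assumes "w > 0" "continuous_on {- pi / w..pi / w} f" "\<And>t. norm (f t) \<le> B"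
  shows "norm (fcoeff w f k) \<le> B"
proof -
  have "norm (integral {- pi / w..pi / w} (\<lambda>t. f t * fmode w (- k) t)) \<le> B * (pi / w - - pi / w)"
    by (intro integral_bound continuous_intros assms) (use assms in \<open>auto simp: norm_mult field_simps\<close>)
  then have "w / (2 * pi) * norm (integral {- pi / w..pi / w} (\<lambda>t. f t * fmode w (- k) t)) \<le>
      w / (2 * pi) * (B * (pi / w - - pi / w))"
    using assms by (intro mult_left_mono) auto
  also have "\<dots> = B" using assms by (simp add: field_simps)
  finally show ?thesis using assms by (simp add: fcoeff_def norm_mult norm_divide)
qed

text \<open>Induction over \<open>S\<close>: removing the modes in \<open>S\<close> leaves all other
  coefficients of \<open>g\<close> unchanged (\<open>hc\<close>), so removing one more mode lowers
  the mean square of the remainder \<open>h\<close> by exactly the squared modulus of that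
  coefficient. The mean square stays nonnegative.\<close>

lemma bessel:
  assumes w: "w > 0" and g: "continuous_on {- pi / w..pi / w} g" and S: "finite S"
  shows "(\<Sum>k\<in>S. (norm (fcoeff w g k))\<^sup>2) \<le> w / (2 * pi) * integral {- pi / w..pi / w} (\<lambda>t. (norm (g t))\<^sup>2)"
proof -
  let ?J = "{- pi / w..pi / w}"
  define h where "h S t = g t - (\<Sum>l\<in>S. fcoeff w g l * fmode w l t)" for S t
  have ch: "continuous_on ?J (h S)" for S
    unfolding h_def by (intro continuous_intros g)
  have hc: "fcoeff w (h S) k = (if k \<in> S then 0 else fcoeff w g k)" if "finite S" for S k
    using that
  proof induction
    case (insert l S)
    have "h (insert l S) = (\<lambda>t. h S t + (- fcoeff w g l) * fmode w l t)"
      using insert by (auto simp: h_def fun_eq_iff)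
    then show ?case
      using insert fcoeff_add[OF ch[of S] continuous_on_fmode[of _ w l], of "- fcoeff w g l" k]
      by (auto simp: fcoeff_fmode[OF w])
  qed (simp add: h_def[abs_def])
  have "w / (2 * pi) * integral ?J (\<lambda>t. (norm (h S t))\<^sup>2) =
      w / (2 * pi) * integral ?J (\<lambda>t. (norm (g t))\<^sup>2) - (\<Sum>k\<in>S. (norm (fcoeff w g k))\<^sup>2)"
    using S
  proof induction
    case (insert l S)
    define c where "c = fcoeff w g l"
    have eq: "(norm (h (insert l S) t))\<^sup>2 =
        (norm (h S t))\<^sup>2 - 2 * Re (cnj c * (h S t * fmode w (- l) t)) + (norm c)\<^sup>2" for t
    proof -
      define z where "z = cnj c * (h S t * cnj (fmode w l t))"
      have hl: "h (insert l S) t = h S t - c * fmode w l t"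
        using insert by (simp add: h_def c_def)
      have "complex_of_real ((norm (h S t - c * fmode w l t))\<^sup>2) =
        of_real ((norm (h S t))\<^sup>2) + of_real ((norm c)\<^sup>2) * (fmode w l t * cnj (fmode w l t)) - (z + cnj z)"
        unfolding complex_norm_square z_def by (simp add: algebra_simps)
      also have "fmode w l t * cnj (fmode w l t) = of_real 1"
        by (simp add: complex_norm_square[symmetric])
      also have "z + cnj z = of_real (2 * Re z)"
        by (rule complex_add_cnj)
      also have "of_real ((norm (h S t))\<^sup>2) + of_real ((norm c)\<^sup>2) * of_real 1 - of_real (2 * Re z) =
          complex_of_real ((norm (h S t))\<^sup>2 + (norm c)\<^sup>2 * 1 - 2 * Re z)"
        by (simp only: of_real_add of_real_diff of_real_mult)
      finally have "(norm (h S t - c * fmode w l t))\<^sup>2 = (norm (h S t))\<^sup>2 + (norm c)\<^sup>2 * 1 - 2 * Re z"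
        unfolding of_real_eq_iff .
      then show ?thesis unfolding hl z_def cnj_fmode by linarith
    qed
    have R: "integral ?J (\<lambda>t. 2 * Re (cnj c * (h S t * fmode w (- l) t))) =
        2 * (2 * pi / w) * (norm c)\<^sup>2"
    proof -
      have "fcoeff w (h S) l = c" using hc[of S l] insert by (simp add: c_def)
      then have I: "integral ?J (\<lambda>t. h S t * fmode w (- l) t) = of_real (2 * pi / w) * c"
        using w unfolding fcoeff_def by (auto simp: field_simps)
      have "(\<lambda>t. h S t * fmode w (- l) t) integrable_on ?J"
        by (intro integrable_continuous_interval continuous_intros ch)
      then have "((\<lambda>t. h S t * fmode w (- l) t) has_integral of_real (2 * pi / w) * c) ?J"
        using I by (metis integrable_integral)
      from has_integral_mult_right[OF this, of "cnj c"]
      have "((\<lambda>t. cnj c * (h S t * fmode w (- l) t)) has_integral cnj c * (of_real (2 * pi / w) * c)) ?J" .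
      from has_integral_mult_right[OF has_integral_Re[OF this], of 2]
      have "integral ?J (\<lambda>t. 2 * Re (cnj c * (h S t * fmode w (- l) t))) =
          2 * Re (cnj c * (of_real (2 * pi / w) * c))"
        by (rule integral_unique)
      also have "cnj c * (of_real (2 * pi / w) * c) = of_real (2 * pi / w * (norm c)\<^sup>2)"
        unfolding of_real_mult complex_norm_square by (simp only: mult_ac)
      finally show ?thesis by simp
    qed
    have "integral ?J (\<lambda>t. (norm (h (insert l S) t))\<^sup>2) =
        integral ?J (\<lambda>t. (norm (h S t))\<^sup>2 - 2 * Re (cnj c * (h S t * fmode w (- l) t))) +
        integral ?J (\<lambda>t. (norm c)\<^sup>2)"
      unfolding eq
      by (intro Henstock_Kurzweil_Integration.integral_add integrable_continuous_interval continuous_intros ch)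
    also have "integral ?J (\<lambda>t. (norm (h S t))\<^sup>2 - 2 * Re (cnj c * (h S t * fmode w (- l) t))) =
        integral ?J (\<lambda>t. (norm (h S t))\<^sup>2) - integral ?J (\<lambda>t. 2 * Re (cnj c * (h S t * fmode w (- l) t)))"
      by (intro Henstock_Kurzweil_Integration.integral_diff integrable_continuous_interval continuous_intros ch)
    finally have "integral ?J (\<lambda>t. (norm (h (insert l S) t))\<^sup>2) =
        integral ?J (\<lambda>t. (norm (h S t))\<^sup>2) - (2 * pi / w) * (norm c)\<^sup>2"
      unfolding R using w by (simp add: field_simps)
    then have "w / (2 * pi) * integral ?J (\<lambda>t. (norm (h (insert l S) t))\<^sup>2) =
        w / (2 * pi) * integral ?J (\<lambda>t. (norm (h S t))\<^sup>2) - (norm c)\<^sup>2"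
      using w by (simp add: field_simps)
    then show ?case using insert by (simp add: c_def)
  qed (simp add: h_def)
  moreover have "0 \<le> w / (2 * pi) * integral ?J (\<lambda>t. (norm (h S t))\<^sup>2)"
    using w by (intro mult_nonneg_nonneg integral_nonneg integrable_continuous_interval continuous_intros ch) auto
  ultimately show ?thesis by linarith
qed

text \<open>Riemann-Lebesgue along an injective enumeration of frequencies: by Bessel's inequality
  the squared coefficients are summable.\<close>

lemma fcoeff_tendsto_0:
  assumes w: "w > 0" and g: "continuous_on {- pi / w..pi / w} g" and \<iota>: "inj (\<iota> :: nat \<Rightarrow> int)"
  shows "(\<lambda>n. fcoeff w g (\<iota> n)) \<longlonglongrightarrow> 0"
proof -
  have "summable (\<lambda>n. (norm (fcoeff w g (\<iota> n)))\<^sup>2)"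
  proof (rule summableI_nonneg_bounded)
    fix n
    have "(\<Sum>i<n. (norm (fcoeff w g (\<iota> i)))\<^sup>2) = (\<Sum>k\<in>\<iota> ` {..<n}. (norm (fcoeff w g k))\<^sup>2)"
      using \<iota> by (simp add: sum.reindex inj_on_subset)
    also have "\<dots> \<le> w / (2 * pi) * integral {- pi / w..pi / w} (\<lambda>t. (norm (g t))\<^sup>2)"
      by (intro bessel w g) auto
    finally show "(\<Sum>i<n. (norm (fcoeff w g (\<iota> i)))\<^sup>2) \<le>
        w / (2 * pi) * integral {- pi / w..pi / w} (\<lambda>t. (norm (g t))\<^sup>2)" .
  qed auto
  from tendsto_real_sqrt[OF summable_LIMSEQ_zero[OF this]]
  show ?thesis by (auto intro: tendsto_norm_zero_cancel)
qed

lemma sum_symmetric_Suc: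
  fixes f :: "int \<Rightarrow> 'a::comm_monoid_add"
  shows "(\<Sum>k\<in>{- int (Suc M)..int (Suc M)}. f k) =
    (\<Sum>k\<in>{- int M..int M}. f k) + (f (int (Suc M)) + f (- int (Suc M)))"
proof -
  have "{- int (Suc M)..int (Suc M)} = insert (int (Suc M)) (insert (- int (Suc M)) {- int M..int M})"
    by auto
  then show ?thesis by (simp add: add_ac)
qed

lemma has_vector_derivative_quotient:
  fixes f :: "real \<Rightarrow> complex"
  assumes "(f has_vector_derivative d) (at x)"
  shows "((\<lambda>y. (f y - f x) / of_real (y - x)) \<longlongrightarrow> d) (at x)"
proof -
  have "((\<lambda>y. norm (f y - f x - (y - x) *\<^sub>R d) / norm (y - x)) \<longlongrightarrow> 0) (at x)"
    using assms by (simp add: has_vector_derivative_def has_derivative_iff_norm)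
  moreover have "\<forall>\<^sub>F y in at x. norm (f y - f x - (y - x) *\<^sub>R d) / norm (y - x) =
      norm ((f y - f x) / of_real (y - x) - d)"
    unfolding eventually_at_filter
  proof (intro always_eventually allI impI)
    fix y assume "y \<noteq> x"
    then have "(f y - f x) / of_real (y - x) - d = (f y - f x - (y - x) *\<^sub>R d) / of_real (y - x)"
      by (simp add: scaleR_conv_of_real diff_divide_distrib)
    then show "norm (f y - f x - (y - x) *\<^sub>R d) / norm (y - x) = norm ((f y - f x) / of_real (y - x) - d)"
      by (simp only: norm_divide norm_of_real real_norm_def)
  qed
  ultimately have "((\<lambda>y. norm ((f y - f x) / of_real (y - x) - d)) \<longlongrightarrow> 0) (at x)"
    by (rule Lim_transform_eventually)
  then show ?thesis by (rule LIM_zero_cancel[OF tendsto_norm_zero_cancel])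
qed

text \<open>Chernoff's argument: dividing \<open>f - f x\<close> by \<open>fmode w 1 (t - x) - 1\<close> leaves a continuous
  function, whose Fourier coefficients tend to 0, and makes the partial sums telescope.\<close>

lemma fourier_series_pointwise:
  assumes w: "w > 0" and f: "continuous_on {- pi / w..pi / w} f"
    and d: "(f has_vector_derivative d) (at x)" and x: "\<bar>x\<bar> < pi / w"
  shows "(\<lambda>M. \<Sum>k\<in>{- int M..int M}. fcoeff w f k * fmode w k x) \<longlonglongrightarrow> f x"
proof -
  let ?J = "{- pi / w..pi / w}"
  define D where "D t = fmode w 1 (t - x) - 1" for t
  \<comment> \<open>The value at \<open>x\<close> is the limit of the quotient, because
    \<open>D\<close> vanishes at \<open>x\<close> with derivative i w.\<close>
  define g where "g t = (if t = x then d / (\<i> * of_real w) else (f t - f x) / D t)" for t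
  \<comment> \<open>Since \<open>x\<close> lies strictly inside the closed period interval, |w (t -
    x)| stays below 2 pi, and \<open>D\<close> has no zero other than \<open>t = x\<close>.\<close>
  have D0: "D t \<noteq> 0" if t: "t \<in> ?J" "t \<noteq> x" for t
  proof
    assume "D t = 0"
    then obtain n :: int where "w * (t - x) = of_int (2 * n) * pi"
      unfolding D_def fmode_def by (auto simp: exp_eq_1)
    moreover have "\<bar>w * (t - x)\<bar> < 2 * pi"
    proof -
      have "\<bar>t\<bar> \<le> pi / w" using t by auto
      then have "\<bar>t - x\<bar> < pi / w + pi / w" using x by linarith
      then have "w * \<bar>t - x\<bar> < w * (pi / w + pi / w)" using w by (intro mult_strict_left_mono) auto
      moreover have "w * (pi / w + pi / w) = 2 * pi" using w by (simp add: field_simps)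
      moreover have "\<bar>w * (t - x)\<bar> = w * \<bar>t - x\<bar>" using w by (simp add: abs_mult)
      ultimately show ?thesis by simp
    qed
    ultimately have "\<bar>real_of_int n\<bar> * (2 * pi) < 1 * (2 * pi)" by (simp add: abs_mult)
    then have "\<bar>real_of_int n\<bar> < 1" using pi_gt_zero by simp
    then have "n = 0" by linarith
    then show False using \<open>w * (t - x) = of_int (2 * n) * pi\<close> w t by simp
  qed
  have Dcont: "continuous_on X D" for X
    unfolding D_def by (intro continuous_intros continuous_on_compose2[OF continuous_on_fmode[of UNIV]]) auto
  have gD: "g t * D t = f t - f x" if "t \<in> ?J" for t
    using D0[OF that] by (simp add: g_def D_def)
  have cg: "continuous_on ?J g"
    unfolding continuous_on_eq_continuous_within
  proof
    fix t assume t: "t \<in> ?J"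
    show "continuous (at t within ?J) g"
    proof (cases "t = x")
      case False
      have "continuous (at t within ?J) (\<lambda>t. (f t - f x) / D t)"
        using f Dcont[of ?J] t False D0 unfolding continuous_on_eq_continuous_within
        by (intro continuous_intros) auto
      moreover have "\<forall>\<^sub>F s in at t within ?J. (f s - f x) / D s = g s"
        unfolding eventually_at_filter
        by (rule eventually_mono[OF t1_space_nhds[OF False]]) (simp add: g_def)
      moreover have "(f t - f x) / D t = g t" using False by (simp add: g_def)
      ultimately show ?thesis
        unfolding continuous_within by (simp only: Lim_transform_eventually)
    next
      case True
      have Dq: "((\<lambda>y. (D y - D x) / of_real (y - x)) \<longlongrightarrow> \<i> * of_real w) (at x)"
      proof (rule has_vector_derivative_quotient)
        have "((\<lambda>t. t - x) has_vector_derivative 1) (at x)"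
          by (auto intro!: derivative_eq_intros)
        from vector_diff_chain_at[OF this fmode_has_vector_derivative[of w 1]]
        have "((\<lambda>t. fmode w 1 (t - x)) has_vector_derivative \<i> * of_real w) (at x)"
          by (simp add: o_def)
        then show "(D has_vector_derivative \<i> * of_real w) (at x)"
          unfolding D_def has_vector_derivative_diff_const .
      qed
      have "((\<lambda>y. ((f y - f x) / of_real (y - x)) / ((D y - D x) / of_real (y - x))) \<longlongrightarrow> d / (\<i> * of_real w)) (at x)"
        using w by (intro tendsto_divide has_vector_derivative_quotient[OF d] Dq) auto
      moreover have "\<forall>\<^sub>F y in at x. ((f y - f x) / of_real (y - x)) / ((D y - D x) / of_real (y - x)) = g y"
        unfolding eventually_at_filter
        by (intro always_eventually allI impI) (simp add: g_def D_def)
      ultimately have "(g \<longlongrightarrow> g x) (at x)"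
        by (simp add: g_def Lim_transform_eventually)
      then show ?thesis using True by (auto simp: continuous_within intro: tendsto_within_subset)
    qed
  qed
  define \<gamma> where "\<gamma> k = fcoeff w g k * fmode w k x" for k
  \<comment> \<open>From f = f x + g D: the factor \<open>fmode w 1\<close> inside \<open>D\<close>
    shifts the coefficients of \<open>g\<close> by one, and the constant \<open>f x\<close>
    contributes only at \<open>k = 0\<close>.\<close>
  have tele: "fcoeff w f k * fmode w k x = (if k = 0 then f x else 0) + (\<gamma> (k - 1) - \<gamma> k)" for k
  proof -
    have "fcoeff w f k = fcoeff w (\<lambda>t. (f t + (- f x) * fmode w 0 t) + f x * fmode w 0 t) k"
      by simp
    also have "\<dots> = fcoeff w (\<lambda>t. f t + (- f x) * fmode w 0 t) k + f x * fcoeff w (fmode w 0) k"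
      by (intro fcoeff_add continuous_intros f)
    also have "fcoeff w (\<lambda>t. f t + (- f x) * fmode w 0 t) k = fcoeff w (\<lambda>t. g t * D t) k"
      unfolding fcoeff_def using gD by (intro arg_cong2[of _ _ _ _ "(*)"] integral_cong) auto
    also have "(\<lambda>t. g t * D t) = (\<lambda>t. (- 1) * g t + fmode w (- 1) x * (g t * fmode w 1 t))"
      by (simp add: D_def fmode_diff algebra_simps)
    also have "fcoeff w \<dots> k = fcoeff w (\<lambda>t. (- 1) * g t) k + fmode w (- 1) x * fcoeff w (\<lambda>t. g t * fmode w 1 t) k"
      by (intro fcoeff_add continuous_intros cg)
    also have "fcoeff w (\<lambda>t. (- 1) * g t) k = - fcoeff w g k"
      by (simp add: fcoeff_def)
    also have "fcoeff w (\<lambda>t. g t * fmode w 1 t) k = fcoeff w g (k - 1)"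
      unfolding fcoeff_def by (simp add: mult.assoc fmode_add[symmetric])
    also have "fcoeff w (fmode w 0) k = (if k = 0 then 1 else 0)"
      by (rule fcoeff_fmode[OF w])
    finally have "fcoeff w f k * fmode w k x = (- fcoeff w g k + fmode w (- 1) x * fcoeff w g (k - 1) +
        f x * (if k = 0 then 1 else 0)) * fmode w k x"
      by simp
    moreover have "fmode w (- 1) x * fmode w k x = fmode w (k - 1) x"
      by (simp add: fmode_add[symmetric])
    ultimately show ?thesis by (auto simp: \<gamma>_def algebra_simps)
  qed
  have S: "(\<Sum>k\<in>{- int M..int M}. fcoeff w f k * fmode w k x) = f x + (\<gamma> (- int M - 1) - \<gamma> (int M))" for M
  proof (induction M)
    case (Suc M)
    have "int (Suc M) - 1 = int M" "- int (Suc M) = - int M - 1" by auto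
    then have "\<gamma> (int (Suc M) - 1) = \<gamma> (int M)" "\<gamma> (- int (Suc M)) = \<gamma> (- int M - 1)"
      by (simp_all only:)
    then show ?case unfolding sum_symmetric_Suc Suc unfolding tele by (simp del: of_nat_Suc)
  qed (use tele[of 0] in simp)
  have g0: "(\<lambda>M. \<gamma> (\<iota> M)) \<longlonglongrightarrow> 0" if "inj \<iota>" for \<iota>
    unfolding \<gamma>_def using fcoeff_tendsto_0[OF w cg that]
    by (intro tendsto_norm_zero_cancel[of "\<lambda>M. fcoeff w g (\<iota> M) * fmode w (\<iota> M) x"])
      (simp add: norm_mult tendsto_norm_zero)
  have "(\<lambda>M. f x + (\<gamma> (- int M - 1) - \<gamma> (int M))) \<longlonglongrightarrow> f x + (0 - 0)"
    by (intro tendsto_intros g0) (auto simp: inj_def)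
  then show ?thesis unfolding S by simp
qed

section \<open>Fourier coefficients and Fourier series of Gevrey functions\<close>

lemma sum_inverse_square_le: "(\<Sum>k\<in>{- int M..int M}. 1 / (1 + real_of_int \<bar>k\<bar>)\<^sup>2) \<le> 3 - 2 / (real M + 1)"
proof (induction M)
  case (Suc M)
  \<comment> \<open>The subtracted term in the claim makes the induction close: twice this
    telescoping difference bounds the two new summands.\<close>
  have "1 / (real M + 2)\<^sup>2 \<le> 1 / ((real M + 1) * (real M + 2))"
    by (intro divide_left_mono) (auto simp: power2_eq_square)
  also have "\<dots> = 1 / (real M + 1) - 1 / (real M + 2)"
    by (simp add: field_simps)
  finally have "2 * (1 / (real M + 2)\<^sup>2) \<le> 2 / (real M + 1) - 2 / (real M + 2)" by simp
  then show ?case using Suc unfolding sum_symmetric_Suc by (simp add: add_ac)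
qed simp

text \<open>\<open>F\<close> is supported strictly inside the period interval, so its periodic
  continuation stays smooth and integration by parts leaves no boundary terms.\<close>

locale gevrey_fourier =
  fixes F :: "nat \<Rightarrow> real \<Rightarrow> complex" and A w R :: real
  assumes gevrey: "gevrey F A" and w: "w > 0" and R: "R < pi / w"
    and zero: "\<And>k t. R \<le> \<bar>t\<bar> \<Longrightarrow> F k t = 0"
begin

lemma cont: "continuous_on S (F j)"
  using gevreyD(2)[OF gevrey] unfolding deriv_seq_def
  by (meson continuous_on_vector_derivative has_vector_derivative_at_within)

text \<open>One integration by parts per derivative; the boundary terms vanish because pi / w lies
  beyond \<open>R\<close>.\<close>

lemma fcoeff_deriv: "fcoeff w (F j) k = (\<i> * of_real (w * of_int k)) ^ j * fcoeff w (F 0) k"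
proof (induction j)
  case (Suc j)
  let ?J = "{- pi / w..pi / w}" and ?c = "\<i> * complex_of_real (w * of_int k)"
  have "((\<lambda>t. F (Suc j) t * fmode w (- k) t + (- ?c) * (F j t * fmode w (- k) t)) has_integral
     (F j (pi / w) * fmode w (- k) (pi / w) - F j (- pi / w) * fmode w (- k) (- pi / w))) ?J"
  proof (rule fundamental_theorem_of_calculus)
    show "- pi / w \<le> pi / w" using w by (simp add: field_simps)
    fix t
    have "(F j has_vector_derivative F (Suc j) t) (at t within ?J)"
      using gevreyD(2)[OF gevrey] by (simp add: deriv_seq_def has_vector_derivative_at_within)
    from has_vector_derivative_mult[OF this fmode_has_vector_derivative[of w "- k"]]
    show "((\<lambda>t. F j t * fmode w (- k) t) has_vector_derivative
        F (Suc j) t * fmode w (- k) t + (- ?c) * (F j t * fmode w (- k) t)) (at t within ?J)"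
      by (simp add: mult_ac add.commute)
  qed
  moreover have "F j (pi / w) = 0" "F j (- pi / w) = 0" using R w by (auto intro: zero)
  ultimately have "integral ?J (\<lambda>t. F (Suc j) t * fmode w (- k) t + (- ?c) * (F j t * fmode w (- k) t)) = 0"
    by (simp add: integral_unique)
  also have "integral ?J (\<lambda>t. F (Suc j) t * fmode w (- k) t + (- ?c) * (F j t * fmode w (- k) t)) =
      integral ?J (\<lambda>t. F (Suc j) t * fmode w (- k) t) + integral ?J (\<lambda>t. (- ?c) * (F j t * fmode w (- k) t))"
    by (intro Henstock_Kurzweil_Integration.integral_add integrable_continuous_interval continuous_intros cont)
  finally have "integral ?J (\<lambda>t. F (Suc j) t * fmode w (- k) t) = ?c * integral ?J (\<lambda>t. F j t * fmode w (- k) t)"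
    unfolding integral_mult_right by (simp add: algebra_simps)
  then have "fcoeff w (F (Suc j)) k = ?c * fcoeff w (F j) k"
    unfolding fcoeff_def by (simp only: mult_ac)
  then show ?case using Suc by simp
qed simp

lemma norm_fcoeff_power_le: "norm (fcoeff w (F 0) k) * (w * \<bar>of_int k\<bar>) ^ j \<le> A ^ (j + 1) * fact (2 * j)"
proof -
  have "norm (fcoeff w (F j) k) \<le> A ^ (j + 1) * fact (2 * j)"
    by (intro norm_fcoeff_le w cont gevreyD(3)[OF gevrey])
  then show ?thesis
    using w unfolding fcoeff_deriv[of j] by (simp add: norm_mult norm_power abs_mult mult.commute)
qed

text \<open>Passing from w |k| to 1 + |k| includes the zero frequency. For nonzero \<open>k\<close>
  the latter is at most 2 |k|, which explains the factor 2 / w.\<close>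

lemma norm_fcoeff_le_Gevrey:
  "norm (fcoeff w (F 0) k) * (1 + \<bar>of_int k\<bar>) ^ n \<le> (max 1 (2 / w) * A) ^ (n + 1) * fact (2 * n)"
proof (cases "k = 0")
  case True
  note A = gevreyD(1)[OF gevrey]
  have "norm (fcoeff w (F 0) k) \<le> A * 1" using norm_fcoeff_power_le[of k 0] by simp
  also have "\<dots> \<le> (max 1 (2 / w) * A) ^ 1 * fact (2 * n)"
    using A by (intro mult_mono) (auto intro: mult_right_mono[of 1 "max 1 (2 / w)" A, simplified])
  also have "\<dots> \<le> (max 1 (2 / w) * A) ^ (n + 1) * fact (2 * n)"
    using mult_mono[of 1 "max 1 (2 / w)" 1 A] A by (intro mult_right_mono power_increasing) auto
  finally show ?thesis using True by simp
next
  case False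
  note A = gevreyD(1)[OF gevrey]
  have "1 + \<bar>real_of_int k\<bar> \<le> 2 / w * (w * \<bar>of_int k\<bar>)"
    using False w by simp
  then have "norm (fcoeff w (F 0) k) * (1 + \<bar>of_int k\<bar>) ^ n \<le>
      norm (fcoeff w (F 0) k) * (2 / w * (w * \<bar>of_int k\<bar>)) ^ n"
    by (intro mult_left_mono power_mono) auto
  also have "\<dots> = (2 / w) ^ n * (norm (fcoeff w (F 0) k) * (w * \<bar>of_int k\<bar>) ^ n)"
    by (simp only: power_mult_distrib mult_ac)
  also have "\<dots> \<le> max 1 (2 / w) ^ (n + 1) * (A ^ (n + 1) * fact (2 * n))"
  proof (rule mult_mono[OF _ norm_fcoeff_power_le])
    have "(2 / w) ^ n \<le> max 1 (2 / w) ^ n" using w by (intro power_mono) auto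
    also have "\<dots> \<le> max 1 (2 / w) ^ (n + 1)" by (intro power_increasing) auto
    finally show "(2 / w) ^ n \<le> max 1 (2 / w) ^ (n + 1)" .
  qed (use w A in auto)
  finally show ?thesis by (simp only: power_mult_distrib mult_ac)
qed

text \<open>Two further powers of 1 + |k| are spent to make the sum over \<open>k\<close> converge;
  hence the shifts to q + 3 and 2q + 4, and the factor 3 from the inverse squares.\<close>

lemma sum_fcoeff_le:
  "(\<Sum>k\<in>{- int M..int M}. norm (fcoeff w (F 0) k) * (1 + \<bar>of_int k\<bar>) ^ q) \<le>
    3 * ((max 1 (2 / w) * A) ^ (q + 3) * fact (2 * q + 4))"
proof -
  let ?B = "(max 1 (2 / w) * A) ^ (q + 3) * fact (2 * q + 4)"
  have "norm (fcoeff w (F 0) k) * (1 + \<bar>of_int k\<bar>) ^ q \<le> ?B * (1 / (1 + real_of_int \<bar>k\<bar>)\<^sup>2)" for k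
  proof -
    define x where "x = 1 + real_of_int \<bar>k\<bar>"
    have "x > 0" by (simp add: x_def)
    then have "norm (fcoeff w (F 0) k) * x ^ q = norm (fcoeff w (F 0) k) * x ^ (q + 2) * (1 / x\<^sup>2)"
      by (simp add: power_add field_simps power2_eq_square)
    then have "norm (fcoeff w (F 0) k) * (1 + \<bar>of_int k\<bar>) ^ q =
        norm (fcoeff w (F 0) k) * (1 + \<bar>of_int k\<bar>) ^ (q + 2) * (1 / (1 + real_of_int \<bar>k\<bar>)\<^sup>2)"
      by (simp only: x_def of_int_abs)
    also have "\<dots> \<le> (max 1 (2 / w) * A) ^ (q + 2 + 1) * fact (2 * (q + 2)) * (1 / (1 + real_of_int \<bar>k\<bar>)\<^sup>2)"
      by (intro mult_right_mono norm_fcoeff_le_Gevrey) auto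
    also have "q + 2 + 1 = q + 3" by simp
    also have "2 * (q + 2) = 2 * q + 4" by simp
    finally show ?thesis .
  qed
  then have "(\<Sum>k\<in>{- int M..int M}. norm (fcoeff w (F 0) k) * (1 + \<bar>of_int k\<bar>) ^ q) \<le>
      (\<Sum>k\<in>{- int M..int M}. ?B * (1 / (1 + real_of_int \<bar>k\<bar>)\<^sup>2))"
    by (rule sum_mono)
  also have "\<dots> = ?B * (\<Sum>k\<in>{- int M..int M}. 1 / (1 + real_of_int \<bar>k\<bar>)\<^sup>2)"
    by (simp only: sum_distrib_left)
  also have "\<dots> \<le> ?B * 3"
  proof (rule mult_left_mono)
    show "(\<Sum>k\<in>{- int M..int M}. 1 / (1 + real_of_int \<bar>k\<bar>)\<^sup>2) \<le> 3"
      using sum_inverse_square_le[of M] by (smt (verit) divide_nonneg_nonneg of_nat_0_le_iff)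
    show "?B \<ge> 0" using gevreyD(1)[OF gevrey] by (intro mult_nonneg_nonneg zero_le_power) auto
  qed
  finally show ?thesis by (simp add: mult.commute)
qed

text \<open>The index \<open>j\<close> makes \<open>partial_sum M\<close> a derivative sequence; its
  j-th member is at the same time the Fourier partial sum of \<open>F j\<close>.\<close>

definition partial_sum :: "nat \<Rightarrow> nat \<Rightarrow> real \<Rightarrow> complex" where
  "partial_sum M j t = (\<Sum>k\<in>{- int M..int M}. fcoeff w (F 0) k * (\<i> * of_real (w * of_int k)) ^ j * fmode w k t)"

lemma deriv_seq_partial_sum: "deriv_seq (partial_sum M)"
  unfolding deriv_seq_def
proof (intro allI)
  fix j t
  have "((\<lambda>t. \<Sum>k\<in>{- int M..int M}. fcoeff w (F 0) k * (\<i> * of_real (w * of_int k)) ^ j * fmode w k t)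
     has_vector_derivative (\<Sum>k\<in>{- int M..int M}. fcoeff w (F 0) k * (\<i> * of_real (w * of_int k)) ^ j *
       (\<i> * of_real (w * of_int k) * fmode w k t))) (at t)"
    by (intro has_vector_derivative_sum has_vector_derivative_mult_right fmode_has_vector_derivative)
  then show "(partial_sum M j has_vector_derivative partial_sum M (Suc j) t) (at t)"
    by (simp add: partial_sum_def[abs_def] mult_ac)
qed

text \<open>Two derivatives beyond \<open>j\<close> bound the k-th term of the series by C / k^2, so
  the distance between partial sums telescopes to at most 2 C / M. Pointwise convergence identifies
  the limit and carries the bound over to it.\<close>

lemma partial_sum_error:
  assumes t: "\<bar>t\<bar> < pi / w" and M: "M \<ge> 1"
  shows "norm (F j t - partial_sum M j t) \<le> 2 * (A ^ (j + 3) * fact (2 * (j + 2)) / w\<^sup>2) / real M"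
proof -
  define C where "C = A ^ (j + 3) * fact (2 * (j + 2)) / w\<^sup>2"
  have C0: "C \<ge> 0" using gevreyD(1)[OF gevrey] by (simp add: C_def)
  have lim: "(\<lambda>M. partial_sum M j t) \<longlonglongrightarrow> F j t"
    using fourier_series_pointwise[OF w cont[of _ j] _ t, of "F (Suc j) t"] gevreyD(2)[OF gevrey]
    by (simp add: partial_sum_def fcoeff_deriv[of j] deriv_seq_def mult.commute)
  have summand: "norm (fcoeff w (F 0) k * (\<i> * of_real (w * of_int k)) ^ j * fmode w k t) \<le> C / (real n)\<^sup>2"
    if k: "\<bar>k\<bar> = int n" "n > 0" for k n
  proof -
    have kn: "\<bar>real_of_int k\<bar> = real n" using k by (metis of_int_abs of_int_of_nat_eq)
    have "norm (fcoeff w (F 0) k) * (w * real n) ^ (j + 2) \<le> A ^ (j + 3) * fact (2 * (j + 2))"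
      using norm_fcoeff_power_le[of k "j + 2"] by (simp add: kn numeral_eq_Suc)
    then have "norm (fcoeff w (F 0) k) * (w * real n) ^ j * (w\<^sup>2 * (real n)\<^sup>2) \<le> A ^ (j + 3) * fact (2 * (j + 2))"
      by (simp only: power_add power_mult_distrib mult_ac)
    then have "norm (fcoeff w (F 0) k) * (w * real n) ^ j \<le> C / (real n)\<^sup>2"
      using w k by (simp add: C_def field_simps)
    then show ?thesis using w by (simp add: norm_mult norm_power abs_mult kn)
  qed
  have diff: "norm (partial_sum (M + n) j t - partial_sum M j t) \<le> 2 * C * (1 / real M - 1 / real (M + n))" for n
  proof (induction n)
    case (Suc n)
    let ?a = "\<lambda>k. fcoeff w (F 0) k * (\<i> * of_real (w * of_int k)) ^ j * fmode w k t"
    have "partial_sum (M + Suc n) j t - partial_sum M j t =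
        (partial_sum (M + n) j t - partial_sum M j t) + (?a (int (Suc (M + n))) + ?a (- int (Suc (M + n))))"
      unfolding partial_sum_def add_Suc_right sum_symmetric_Suc by simp
    also have "norm \<dots> \<le> 2 * C * (1 / real M - 1 / real (M + n)) +
        (C / (real (Suc (M + n)))\<^sup>2 + C / (real (Suc (M + n)))\<^sup>2)"
      by (intro norm_triangle_mono Suc summand) auto
    also have "\<dots> = 2 * C * (1 / real M - 1 / real (M + n)) + 2 * C * (1 / (real (Suc (M + n)))\<^sup>2)"
      by simp
    also have "\<dots> \<le> 2 * C * (1 / real M - 1 / real (M + n)) + 2 * C * (1 / real (M + n) - 1 / real (Suc (M + n)))"
    proof (intro add_left_mono mult_left_mono)
      have "1 / (real (Suc (M + n)))\<^sup>2 \<le> 1 / (real (M + n) * real (Suc (M + n)))"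
        using M by (intro divide_left_mono) (auto simp: power2_eq_square)
      also have "\<dots> = 1 / real (M + n) - 1 / real (Suc (M + n))"
        using M by (simp add: field_simps)
      finally show "1 / (real (Suc (M + n)))\<^sup>2 \<le> 1 / real (M + n) - 1 / real (Suc (M + n))" .
    qed (use C0 in auto)
    finally show ?case by (simp add: algebra_simps)
  qed auto
  have "norm (partial_sum (n + M) j t - partial_sum M j t) \<le> 2 * C / real M" for n
  proof -
    have "2 * C * (1 / real M - 1 / real (M + n)) \<le> 2 * C * (1 / real M)"
      using C0 by (intro mult_left_mono) auto
    then show ?thesis using diff[of n] by (simp add: add.commute)
  qed
  moreover have "(\<lambda>n. norm (partial_sum (n + M) j t - partial_sum M j t)) \<longlonglongrightarrow> norm (F j t - partial_sum M j t)"
    by (intro tendsto_intros LIMSEQ_ignore_initial_segment lim)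
  ultimately have "norm (F j t - partial_sum M j t) \<le> 2 * C / real M"
    by (intro LIMSEQ_le_const2[where X = "\<lambda>n. norm (partial_sum (n + M) j t - partial_sum M j t)"]) auto
  then show ?thesis by (simp add: C_def)
qed

end

section \<open>Growth of the weight sequence\<close>

text \<open>This is the growth allowed for the constants in the decay estimate; \<open>A\<close> and
  \<open>h\<close> may differ from one function to the next.\<close>

definition dominated :: "real \<Rightarrow> real \<Rightarrow> (nat \<Rightarrow> real) \<Rightarrow> bool" where
  "dominated \<tau> \<sigma> f \<longleftrightarrow> (\<exists>A>0. \<exists>h>0. \<forall>p. f p \<le> A * (h powr (real p powr \<sigma>) * M_seq \<tau> \<sigma> p))"

lemma M_seq_ge_1:
  assumes "\<tau> > 0"
  shows "M_seq \<tau> \<sigma> p \<ge> 1"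
  using assms by (auto simp: M_seq_def intro!: ge_one_powr_ge_zero)

lemma le_powr_self:
  assumes "\<sigma> > 1" "p \<ge> 1"
  shows "real p \<le> real p powr \<sigma>"
  using powr_mono[of 1 \<sigma> "real p"] assms by simp

lemma power_le_powr_powr:
  assumes "\<sigma> > 1" "B \<ge> 1"
  shows "B ^ p \<le> B powr (real p powr \<sigma>)"
proof (cases "p = 0")
  case False
  have "B ^ p = B powr real p" using assms by (simp add: powr_realpow)
  also have "\<dots> \<le> B powr (real p powr \<sigma>)"
    using assms False by (intro powr_mono le_powr_self) auto
  finally show ?thesis .
qed (use assms in simp)

lemma dominated_mono:
  assumes "dominated \<tau> \<sigma> g" "\<And>p. f p \<le> g p"
  shows "dominated \<tau> \<sigma> f"
  using assms unfolding dominated_def by (meson order_trans)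

lemma dominated_add:
  assumes \<tau>: "\<tau> > 0" and f: "dominated \<tau> \<sigma> f" and g: "dominated \<tau> \<sigma> g"
  shows "dominated \<tau> \<sigma> (\<lambda>p. f p + g p)"
proof -
  obtain A h where A: "A > 0" "h > 0" "\<And>p. f p \<le> A * (h powr (real p powr \<sigma>) * M_seq \<tau> \<sigma> p)"
    using f by (auto simp: dominated_def)
  obtain B k where B: "B > 0" "k > 0" "\<And>p. g p \<le> B * (k powr (real p powr \<sigma>) * M_seq \<tau> \<sigma> p)"
    using g by (auto simp: dominated_def)
  have M0: "M_seq \<tau> \<sigma> p \<ge> 0" for p using M_seq_ge_1[OF \<tau>, of \<sigma> p] by simp
  have "f p + g p \<le> (A + B) * (max h k powr (real p powr \<sigma>) * M_seq \<tau> \<sigma> p)" for p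
  proof -
    have "f p \<le> A * (max h k powr (real p powr \<sigma>) * M_seq \<tau> \<sigma> p)"
      using A M0[of p] by (intro order_trans[OF A(3)] mult_left_mono mult_right_mono powr_mono2) auto
    moreover have "g p \<le> B * (max h k powr (real p powr \<sigma>) * M_seq \<tau> \<sigma> p)"
      using B M0[of p] by (intro order_trans[OF B(3)] mult_left_mono mult_right_mono powr_mono2) auto
    ultimately show ?thesis by (simp add: algebra_simps)
  qed
  moreover have "A + B > 0" "max h k > 0" using A B by auto
  ultimately show ?thesis unfolding dominated_def by blast
qed

text \<open>As B^p is at most B^(p^\<sigma>), geometric factors go into \<open>h\<close>. The
  constant C + 1 in place of \<open>C\<close> keeps the new \<open>A\<close> positive.\<close>

lemma dominated_geometric:
  assumes \<tau>: "\<tau> > 0" and \<sigma>: "\<sigma> > 1" and f: "dominated \<tau> \<sigma> f" and C: "C \<ge> 0" and B: "B \<ge> 1"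
  shows "dominated \<tau> \<sigma> (\<lambda>p. C * B ^ p * f p)"
proof -
  obtain A h where A: "A > 0" "h > 0" "\<And>p. f p \<le> A * (h powr (real p powr \<sigma>) * M_seq \<tau> \<sigma> p)"
    using f by (auto simp: dominated_def)
  have M0: "M_seq \<tau> \<sigma> p \<ge> 0" for p using M_seq_ge_1[OF \<tau>, of \<sigma> p] by simp
  have "C * B ^ p * f p \<le> ((C + 1) * A) * ((B * h) powr (real p powr \<sigma>) * M_seq \<tau> \<sigma> p)" for p
  proof -
    have "C * B ^ p * f p \<le> C * B ^ p * (A * (h powr (real p powr \<sigma>) * M_seq \<tau> \<sigma> p))"
      using B C by (intro mult_left_mono A) auto
    also have "\<dots> \<le> (C + 1) * B powr (real p powr \<sigma>) * (A * (h powr (real p powr \<sigma>) * M_seq \<tau> \<sigma> p))"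
      using A C B M0[of p] power_le_powr_powr[OF \<sigma> B, of p]
      by (intro mult_right_mono mult_mono) auto
    also have "\<dots> = ((C + 1) * A) * ((B * h) powr (real p powr \<sigma>) * M_seq \<tau> \<sigma> p)"
      using A B by (simp add: powr_mult)
    finally show ?thesis .
  qed
  moreover have "(C + 1) * A > 0" "B * h > 0" using A B C by auto
  ultimately show ?thesis unfolding dominated_def by blast
qed

text \<open>For p at least 1 the factorial power is at most const^p p^(c p). The exponent c p is at
  most \<tau> p^\<sigma> once p^(\<sigma> - 1) reaches c / \<tau>, which happens because \<sigma> >
  1.\<close>

lemma dominated_gevrey:
  assumes \<tau>: "\<tau> > 0" and \<sigma>: "\<sigma> > 1" and E: "E \<ge> 1"
  shows "dominated \<tau> \<sigma> (\<lambda>p. E ^ p * fact (2 * p + a) ^ s)"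
proof -
  define c where "c = (2 + a) * s"
  define B where "B = E * real (2 + a) ^ c"
  have B: "B \<ge> 1" using E mult_mono[of 1 E 1 "real (2 + a) ^ c"] by (simp add: B_def)
  have M0: "M_seq \<tau> \<sigma> p \<ge> 1" for p by (rule M_seq_ge_1[OF \<tau>])
  obtain p0 :: nat where p0: "\<And>p. p \<ge> p0 \<Longrightarrow> real c / \<tau> \<le> real p powr (\<sigma> - 1)" "p0 \<ge> 1"
  proof -
    have "filterlim (\<lambda>p. real p powr (\<sigma> - 1)) at_top sequentially"
      using \<sigma> by (intro filterlim_compose[OF real_powr_at_top filterlim_real_sequentially]) auto
    then have "eventually (\<lambda>p. real c / \<tau> \<le> real p powr (\<sigma> - 1)) sequentially"
      by (simp add: filterlim_at_top)
    then obtain p0 where "\<And>p. p \<ge> p0 \<Longrightarrow> real c / \<tau> \<le> real p powr (\<sigma> - 1)"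
      by (auto simp: eventually_sequentially)
    then show ?thesis using that[of "max p0 1"] by auto
  qed
  \<comment> \<open>The first summand covers the \<open>p\<close> from 1 up to \<open>p0\<close>,
    the second covers \<open>p = 0\<close>.\<close>
  define A where "A = real p0 ^ (c * p0) + fact a ^ s"
  have A1: "A \<ge> 1" using p0(2) by (simp add: A_def add_increasing2)
  have pc: "real p ^ (c * p) \<le> A * M_seq \<tau> \<sigma> p" if p: "p \<ge> 1" for p
  proof (cases "p \<ge> p0")
    case True
    have "real p ^ (c * p) = real p powr (real c * real p)"
      using p by (simp add: powr_realpow[symmetric])
    also have "\<dots> \<le> real p powr (\<tau> * real p powr \<sigma>)"
    proof (rule powr_mono)
      have "real c * real p \<le> (\<tau> * real p powr (\<sigma> - 1)) * real p"
        using p0(1)[OF True] \<tau> by (intro mult_right_mono) (auto simp: field_simps)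
      also have "\<dots> = \<tau> * real p powr \<sigma>"
        using p by (simp add: powr_diff)
      finally show "real c * real p \<le> \<tau> * real p powr \<sigma>" .
    qed (use p in auto)
    also have "\<dots> = 1 * M_seq \<tau> \<sigma> p" using p by (simp add: M_seq_def)
    also have "\<dots> \<le> A * M_seq \<tau> \<sigma> p"
      using A1 M0[of p] by (intro mult_right_mono) auto
    finally show ?thesis .
  next
    case False
    have "real p ^ (c * p) \<le> real p0 ^ (c * p)" using False by (intro power_mono) auto
    also have "\<dots> \<le> real p0 ^ (c * p0)" using False p0(2) by (intro power_increasing) auto
    also have "\<dots> \<le> A" by (simp add: A_def)
    also have "\<dots> \<le> A * M_seq \<tau> \<sigma> p" using A1 M0[of p] by (simp add: mult_left_mono[of 1, simplified])
    finally show ?thesis .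
  qed
  have "E ^ p * fact (2 * p + a) ^ s \<le> A * (B powr (real p powr \<sigma>) * M_seq \<tau> \<sigma> p)" for p
  proof (cases "p = 0")
    case True
    then show ?thesis using E B by (simp add: A_def M_seq_def)
  next
    case False
    have le: "2 * p + a \<le> (2 + a) * p"
      using mult_le_mono2[of 1 p a] False by (simp add: algebra_simps)
    have "fact (2 * p + a) \<le> real (2 * p + a) ^ (2 * p + a)"
      by (metis fact_le_power of_nat_fact of_nat_le_iff of_nat_power order_refl)
    also have "\<dots> \<le> real ((2 + a) * p) ^ (2 * p + a)"
      using le by (intro power_mono) (simp_all only: of_nat_le_iff of_nat_0_le_iff)
    also have "\<dots> \<le> real ((2 + a) * p) ^ ((2 + a) * p)"
    proof (rule power_increasing[OF le])
      have "(2 + a) * p \<ge> 1" using False by simp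
      then show "1 \<le> real ((2 + a) * p)" by (metis of_nat_1 of_nat_le_iff)
    qed
    finally have "fact (2 * p + a) ^ s \<le> (real ((2 + a) * p) ^ ((2 + a) * p)) ^ s"
      by (intro power_mono) auto
    also have "\<dots> = (real (2 + a) ^ c) ^ p * real p ^ (c * p)"
      by (simp only: power_mult[symmetric] of_nat_mult power_mult_distrib c_def mult_ac)
    finally have "E ^ p * fact (2 * p + a) ^ s \<le> E ^ p * ((real (2 + a) ^ c) ^ p * real p ^ (c * p))"
      using E by (intro mult_left_mono) auto
    also have "\<dots> = B ^ p * real p ^ (c * p)" by (simp add: B_def power_mult_distrib)
    also have "\<dots> \<le> B powr (real p powr \<sigma>) * (A * M_seq \<tau> \<sigma> p)"
      using False B by (intro mult_mono power_le_powr_powr[OF \<sigma> B] pc) auto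
    finally show ?thesis by (simp add: mult_ac)
  qed
  moreover have "A > 0" "B > 0" using A1 B by auto
  ultimately show ?thesis unfolding dominated_def by blast
qed

text \<open>Since (p + 1)^\<sigma> is at least p^\<sigma> + 1, the ceiling of p^\<sigma> is still
  below (p + 1)^\<sigma>. At this index the wave front hypothesis thus gives decay of order exactly
  p.\<close>

lemma floor_root_ceiling:
  assumes \<sigma>: "\<sigma> > 1"
  shows "nat \<lfloor>real (nat \<lceil>real p powr \<sigma>\<rceil>) powr (1 / \<sigma>)\<rfloor> = p"
proof -
  define N where "N = nat \<lceil>real p powr \<sigma>\<rceil>"
  have N: "real p powr \<sigma> \<le> real N" "real N < real p powr \<sigma> + 1"
    unfolding N_def by (simp_all add: of_nat_ceiling) linarith
  have "real p = (real p powr \<sigma>) powr (1 / \<sigma>)" using \<sigma> by (simp add: powr_powr)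
  also have "\<dots> \<le> real N powr (1 / \<sigma>)" using \<sigma> N by (intro powr_mono2) auto
  finally have lo: "real p \<le> real N powr (1 / \<sigma>)" .
  have "real p powr \<sigma> + 1 \<le> (real p + 1) powr \<sigma>"
  proof (cases "p = 0")
    case False
    have "(real p + 1) powr \<sigma> = (real p + 1) powr (\<sigma> - 1) * (real p + 1)"
      by (simp add: powr_diff)
    also have "\<dots> = (real p + 1) powr (\<sigma> - 1) * real p + (real p + 1) powr (\<sigma> - 1)"
      by (simp add: algebra_simps)
    also have "\<dots> \<ge> real p powr (\<sigma> - 1) * real p + 1"
      using \<sigma> by (intro add_mono mult_right_mono powr_mono2 ge_one_powr_ge_zero) auto
    also have "real p powr (\<sigma> - 1) * real p = real p powr \<sigma>"
      using False by (simp add: powr_diff)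
    finally show ?thesis .
  qed simp
  then have "real N < (real p + 1) powr \<sigma>" using N by linarith
  then have "real N powr (1 / \<sigma>) < ((real p + 1) powr \<sigma>) powr (1 / \<sigma>)"
    using \<sigma> by (intro powr_less_mono2) auto
  also have "\<dots> = real p + 1" using \<sigma> by (simp add: powr_powr)
  finally have "\<lfloor>real N powr (1 / \<sigma>)\<rfloor> = int p" using lo by (simp add: floor_eq_iff)
  then show ?thesis by (simp add: N_def)
qed

text \<open>With P = p^\<sigma> the factorial is at most (2P)^(P + 1), and P^((P + 1)
  \<tau>/\<sigma>) is p^\<tau> times \<open>M_seq \<tau> \<sigma> p\<close>. All remaining factors
  are exponential in P.\<close>

lemma dominated_fact_ceiling:
  assumes \<tau>: "\<tau> > 0" and \<sigma>: "\<sigma> > 1" and h: "h > 0"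
  shows "dominated \<tau> \<sigma> (\<lambda>p. h ^ nat \<lceil>real p powr \<sigma>\<rceil> * fact (nat \<lceil>real p powr \<sigma>\<rceil>) powr (\<tau> / \<sigma>))"
proof -
  \<comment> \<open>The three factors absorb h^N with N at most 2P, the power of 2 from (2P)^(P +
    1), and p^\<tau> through p at most exp P.\<close>
  define H where "H = (max 1 h) powr 2 * 2 powr (2 * \<tau> / \<sigma>) * exp \<tau>"
  have "h ^ nat \<lceil>real p powr \<sigma>\<rceil> * fact (nat \<lceil>real p powr \<sigma>\<rceil>) powr (\<tau> / \<sigma>) \<le>
      1 * (H powr (real p powr \<sigma>) * M_seq \<tau> \<sigma> p)" for p
  proof (cases "p = 0")
    case True
    then show ?thesis using h by (simp add: M_seq_def H_def)
  next
    case False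
    define P where "P = real p powr \<sigma>"
    define N where "N = nat \<lceil>P\<rceil>"
    have P: "P \<ge> 1" "real p \<le> P"
      using le_powr_self[OF \<sigma>, of p] False by (auto simp: P_def)
    have N: "N > 0" "real N \<le> P + 1" "real N \<le> 2 * P"
      using P by (simp_all add: N_def) linarith+
    have 1: "h ^ N \<le> ((max 1 h) powr 2) powr P"
    proof -
      have "h ^ N \<le> max 1 h ^ N" using h by (intro power_mono) auto
      also have "\<dots> = max 1 h powr real N" by (simp add: powr_realpow)
      also have "\<dots> \<le> max 1 h powr (2 * P)" using N by (intro powr_mono) auto
      finally show ?thesis by (simp only: powr_powr)
    qed
    have 2: "fact N powr (\<tau> / \<sigma>) \<le> (2 powr (2 * \<tau> / \<sigma>)) powr P * (exp \<tau> powr P * M_seq \<tau> \<sigma> p)"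
    proof -
      have "fact N \<le> real N ^ N"
        by (metis fact_le_power of_nat_fact of_nat_le_iff of_nat_power order_refl)
      also have "\<dots> = real N powr real N" using N by (simp add: powr_realpow)
      also have "\<dots> \<le> (2 * P) powr real N" using N by (intro powr_mono2) auto
      also have "\<dots> \<le> (2 * P) powr (P + 1)" using N P by (intro powr_mono) auto
      finally have "fact N powr (\<tau> / \<sigma>) \<le> ((2 * P) powr (P + 1)) powr (\<tau> / \<sigma>)"
        using \<tau> \<sigma> by (intro powr_mono2) auto
      also have "\<dots> = 2 powr ((P + 1) * (\<tau> / \<sigma>)) * P powr ((P + 1) * (\<tau> / \<sigma>))"
        using P by (simp only: powr_powr powr_mult)
      also have "P powr ((P + 1) * (\<tau> / \<sigma>)) = real p powr (\<tau> * P + \<tau>)"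
      proof -
        have "P powr ((P + 1) * (\<tau> / \<sigma>)) = real p powr (\<sigma> * ((P + 1) * (\<tau> / \<sigma>)))"
          by (simp only: P_def powr_powr)
        also have "\<sigma> * ((P + 1) * (\<tau> / \<sigma>)) = \<tau> * P + \<tau>"
          using \<sigma> by (simp add: field_simps)
        finally show ?thesis .
      qed
      also have "\<dots> = real p powr \<tau> * M_seq \<tau> \<sigma> p"
        using False by (simp add: powr_add M_seq_def P_def)
      also have "2 powr ((P + 1) * (\<tau> / \<sigma>)) * (real p powr \<tau> * M_seq \<tau> \<sigma> p) \<le>
          2 powr (2 * \<tau> / \<sigma> * P) * (exp P powr \<tau> * M_seq \<tau> \<sigma> p)"
      proof (rule mult_mono[OF powr_mono mult_right_mono[OF powr_mono2]])
        have "(P + 1) * (\<tau> / \<sigma>) \<le> (2 * P) * (\<tau> / \<sigma>)"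
          using P \<tau> \<sigma> by (intro mult_right_mono) auto
        then show "(P + 1) * (\<tau> / \<sigma>) \<le> 2 * \<tau> / \<sigma> * P" by (simp add: mult_ac)
        show "real p \<le> exp P" using P exp_ge_add_one_self[of P] by linarith
      qed (use \<tau> M_seq_ge_1[OF \<tau>, of \<sigma> p] in auto)
      also have "exp P powr \<tau> = exp \<tau> powr P" by (simp add: powr_def mult.commute)
      finally show ?thesis by (simp only: powr_powr)
    qed
    have "h ^ N * fact N powr (\<tau> / \<sigma>) \<le>
        ((max 1 h) powr 2) powr P * ((2 powr (2 * \<tau> / \<sigma>)) powr P * (exp \<tau> powr P * M_seq \<tau> \<sigma> p))"
      using h by (intro mult_mono 1 2) auto
    also have "\<dots> = 1 * (H powr P * M_seq \<tau> \<sigma> p)"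
      by (simp add: H_def powr_mult)
    finally show ?thesis by (simp only: N_def P_def)
  qed
  moreover have "H > 0" by (simp add: H_def)
  ultimately show ?thesis unfolding dominated_def using zero_less_one by blast
qed

text \<open>With P = p^\<sigma>, at most N, the weight is (P^P)^(\<tau>/\<sigma>); it is bounded
  through N^N, which is at most N! exp N.\<close>

lemma M_seq_floor_root_le:
  assumes \<tau>: "\<tau> > 0" and \<sigma>: "\<sigma> > 1" and h: "h > 0" and p: "p = nat \<lfloor>real N powr (1 / \<sigma>)\<rfloor>"
  shows "h powr (real p powr \<sigma>) * M_seq \<tau> \<sigma> p \<le> (max 1 h * exp (\<tau> / \<sigma>)) ^ N * fact N powr (\<tau> / \<sigma>)"
proof -
  define P where "P = real p powr \<sigma>"
  have "real p \<le> real N powr (1 / \<sigma>)" unfolding p by simp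
  then have "P \<le> (real N powr (1 / \<sigma>)) powr \<sigma>"
    unfolding P_def using \<sigma> by (intro powr_mono2) auto
  then have PN: "P \<le> real N" using \<sigma> by (simp add: powr_powr)
  have P0: "P \<ge> 0" by (simp add: P_def)
  have 1: "h powr P \<le> max 1 h ^ N"
  proof -
    have "h powr P \<le> max 1 h powr P" using h P0 by (intro powr_mono2) auto
    also have "\<dots> \<le> max 1 h powr real N" using PN by (intro powr_mono) auto
    finally show ?thesis by (simp add: powr_realpow)
  qed
  have 2: "M_seq \<tau> \<sigma> p \<le> exp (\<tau> / \<sigma>) ^ N * fact N powr (\<tau> / \<sigma>)"
  proof (cases "p = 0")
    case True
    have "1 * 1 \<le> exp (\<tau> / \<sigma>) ^ N * fact N powr (\<tau> / \<sigma>)"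
      using \<tau> \<sigma> by (intro mult_mono one_le_power ge_one_powr_ge_zero fact_ge_1) auto
    then show ?thesis using True by (simp add: M_seq_def)
  next
    case False
    have P1: "P \<ge> 1" using le_powr_self[OF \<sigma>, of p] False by (simp add: P_def)
    have "M_seq \<tau> \<sigma> p = (P powr P) powr (\<tau> / \<sigma>)"
      using False \<sigma> unfolding P_def by (simp add: M_seq_def powr_powr field_simps)
    also have "\<dots> \<le> (real N ^ N) powr (\<tau> / \<sigma>)"
    proof (rule powr_mono2)
      have "P powr P \<le> real N powr P" using PN P1 by (intro powr_mono2) auto
      also have "\<dots> \<le> real N powr real N" using PN P1 by (intro powr_mono) auto
      finally show "P powr P \<le> real N ^ N" using PN P1 by (simp add: powr_realpow)
    qed (use \<tau> \<sigma> in auto)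
    also have "\<dots> \<le> (fact N * exp (real N)) powr (\<tau> / \<sigma>)"
      using \<tau> \<sigma> by (intro powr_mono2 power_le_fact_exp) auto
    also have "\<dots> = fact N powr (\<tau> / \<sigma>) * exp (real N) powr (\<tau> / \<sigma>)"
      by (simp add: powr_mult)
    also have "exp (real N) powr (\<tau> / \<sigma>) = exp (\<tau> / \<sigma>) ^ N"
      by (simp add: powr_def exp_of_nat_mult[symmetric] mult.commute)
    finally show ?thesis by (simp only: mult.commute)
  qed
  have "h powr P * M_seq \<tau> \<sigma> p \<le> max 1 h ^ N * (exp (\<tau> / \<sigma>) ^ N * fact N powr (\<tau> / \<sigma>))"
    using M_seq_ge_1[OF \<tau>, of \<sigma> p] by (intro mult_mono 1 2) auto
  then show ?thesis by (simp add: P_def power_mult_distrib mult.assoc)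
qed

section \<open>Superposition of plane waves\<close>

text \<open>Division by 2 pi converts the angular frequencies of \<open>fmode\<close> to the
  normalization of the Fourier transform with 2 pi in the exponent.\<close>

definition freq :: "real \<Rightarrow> ('n::finite \<Rightarrow> int) \<Rightarrow> real^'n" where
  "freq w k = (w / (2 * pi)) *\<^sub>R (\<chi> i. of_int (k i))"

lemma plane_wave_freq:
  "(\<Prod>i\<in>UNIV. fmode w (k i) (x $ i)) * plane_wave \<xi> x = plane_wave (\<xi> - freq w k) x"
proof -
  have "(\<Prod>i\<in>UNIV. fmode w (k i) (x $ i)) = exp (\<Sum>i\<in>UNIV. \<i> * of_real (w * of_int (k i) * x $ i))"
    by (simp add: fmode_def exp_sum)
  also have "(\<Sum>i\<in>UNIV. \<i> * of_real (w * of_int (k i) * x $ i)) =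
      \<i> * of_real (\<Sum>i\<in>UNIV. w * of_int (k i) * x $ i)"
    by (simp add: sum_distrib_left)
  also have "(\<Sum>i\<in>UNIV. w * of_int (k i) * x $ i) = 2 * pi * (x \<bullet> freq w k)"
    by (simp add: freq_def inner_vec_def sum_distrib_left mult_ac)
  finally show ?thesis
    by (simp add: plane_wave_def exp_add[symmetric] inner_diff_right algebra_simps)
qed

lemma one_plus_sum_le_prod:
  fixes a :: "'i \<Rightarrow> real"
  assumes "finite I" "\<And>i. i \<in> I \<Longrightarrow> a i \<ge> 0"
  shows "1 + sum a I \<le> (\<Prod>i\<in>I. 1 + a i)"
  using assms
proof (induction I)
  case (insert j I)
  have "1 + sum a (insert j I) \<le> (1 + a j) * (1 + sum a I)"
    using insert by (simp add: algebra_simps sum_nonneg)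
  also have "\<dots> \<le> (1 + a j) * (\<Prod>i\<in>I. 1 + a i)"
    using insert by (intro mult_left_mono) auto
  finally show ?case using insert by simp
qed simp

text \<open>A bound in product form is needed so that sums over multi-frequencies factor over the
  coordinates.\<close>

lemma one_plus_norm_freq_le:
  assumes "w > 0"
  shows "1 + norm (freq w k) \<le> max 1 (w / (2 * pi)) * (\<Prod>i\<in>UNIV. 1 + \<bar>of_int (k i)\<bar>)"
proof -
  define H where "H = max 1 (w / (2 * pi))"
  have "norm (\<chi> i. real_of_int (k i)) \<le> (\<Sum>i\<in>UNIV. \<bar>real_of_int (k i)\<bar>)"
    using norm_le_l1_cart[of "\<chi> i. real_of_int (k i)"] by simp
  then have "norm (freq w k) \<le> H * (\<Sum>i\<in>UNIV. \<bar>real_of_int (k i)\<bar>)"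
    using assms unfolding freq_def norm_scaleR H_def by (intro mult_mono) auto
  then have "1 + norm (freq w k) \<le> H * (1 + (\<Sum>i\<in>UNIV. \<bar>real_of_int (k i)\<bar>))"
    by (simp add: algebra_simps H_def)
  also have "\<dots> \<le> H * (\<Prod>i\<in>UNIV. 1 + \<bar>real_of_int (k i)\<bar>)"
    by (intro mult_left_mono one_plus_sum_le_prod) (auto simp: H_def)
  finally show ?thesis by (simp add: H_def)
qed

text \<open>Dividing all factors by \<open>Z\<close> puts them into the closed unit disc, where the
  difference of products is at most the sum of the differences.\<close>

lemma norm_prod_diff_le:
  fixes z y :: "'i::finite \<Rightarrow> complex"
  assumes Z: "Z \<ge> 1" and z: "\<And>i. norm (z i) \<le> Z" and y: "\<And>i. norm (y i) \<le> Z"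
    and d: "\<And>i. norm (z i - y i) \<le> d"
  shows "norm ((\<Prod>i\<in>UNIV. z i) - (\<Prod>i\<in>UNIV. y i)) \<le> Z ^ CARD('i) * (real CARD('i) * d)"
proof -
  have eq: "(\<Prod>i\<in>UNIV. f i) = of_real Z ^ CARD('i) * (\<Prod>i\<in>UNIV. f i / of_real Z)" for f :: "'i \<Rightarrow> complex"
    using Z by (simp add: prod_dividef)
  have "norm ((\<Prod>i\<in>UNIV. z i / of_real Z) - (\<Prod>i\<in>UNIV. y i / of_real Z)) \<le>
      (\<Sum>i\<in>UNIV. norm (z i / of_real Z - y i / of_real Z))"
    using Z z y by (intro norm_prod_diff) (auto simp: norm_divide)
  also have "\<dots> \<le> (\<Sum>i\<in>(UNIV :: 'i set). d)"
  proof (rule sum_mono)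
    fix i
    have "norm (z i / of_real Z - y i / of_real Z) = norm (z i - y i) / Z"
      using Z by (simp add: diff_divide_distrib[symmetric] norm_divide)
    also have "\<dots> \<le> norm (z i - y i) / 1" using Z by (intro divide_left_mono) auto
    finally show "norm (z i / of_real Z - y i / of_real Z) \<le> d" using d[of i] by simp
  qed
  also have "\<dots> = real CARD('i) * d" by simp
  finally have "Z ^ CARD('i) * norm ((\<Prod>i\<in>UNIV. z i / of_real Z) - (\<Prod>i\<in>UNIV. y i / of_real Z)) \<le>
      Z ^ CARD('i) * (real CARD('i) * d)"
    using Z by (intro mult_left_mono) auto
  moreover have "(\<Prod>i\<in>UNIV. z i) - (\<Prod>i\<in>UNIV. y i) =
      of_real Z ^ CARD('i) * ((\<Prod>i\<in>UNIV. z i / of_real Z) - (\<Prod>i\<in>UNIV. y i / of_real Z))"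
    by (subst eq[of z], subst eq[of y]) (simp add: algebra_simps)
  ultimately show ?thesis using Z by (simp add: norm_mult norm_power)
qed

locale tensor_fourier =
  fixes F :: "'n::finite \<Rightarrow> nat \<Rightarrow> real \<Rightarrow> complex" and A w R :: real
  assumes fourier: "\<And>i. gevrey_fourier (F i) A w R"
begin

lemma w: "w > 0" and gevrey: "gevrey (F i) A"
  using fourier by (auto simp: gevrey_fourier_def)

abbreviation c :: "'n \<Rightarrow> int \<Rightarrow> complex" where
  "c i \<equiv> fcoeff w (F i 0)"

definition PS :: "nat \<Rightarrow> 'n \<Rightarrow> nat \<Rightarrow> real \<Rightarrow> complex" where
  "PS M i = gevrey_fourier.partial_sum (F i) w M"

text \<open>Truncation to a cube of frequencies, because the product of one-dimensional partial sums
  expands into exactly these modes.\<close>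

definition modes :: "nat \<Rightarrow> ('n \<Rightarrow> int) set" where
  "modes M = PiE UNIV (\<lambda>_. {- int M..int M})"

lemma finite_modes [simp]: "finite (modes M)"
  by (simp add: modes_def finite_PiE)

lemma deriv_seq_PS: "deriv_seq (PS M i)"
  unfolding PS_def by (rule gevrey_fourier.deriv_seq_partial_sum[OF fourier])

lemma tensor_PS_plane_wave:
  "tensor (PS M) x * plane_wave \<xi> x =
    (\<Sum>k\<in>modes M. (\<Prod>i\<in>UNIV. c i (k i)) * plane_wave (\<xi> - freq w k) x)"
proof -
  have "tensor (PS M) x = (\<Prod>i\<in>UNIV. \<Sum>k\<in>{- int M..int M}. c i k * fmode w k (x $ i))"
    by (simp add: tensor_def PS_def gevrey_fourier.partial_sum_def[OF fourier])
  also have "\<dots> = (\<Sum>k\<in>modes M. \<Prod>i\<in>UNIV. c i (k i) * fmode w (k i) (x $ i))"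
    unfolding modes_def by (rule prod_sum_PiE) auto
  finally have "tensor (PS M) x = (\<Sum>k\<in>modes M. (\<Prod>i\<in>UNIV. c i (k i)) * (\<Prod>i\<in>UNIV. fmode w (k i) (x $ i)))"
    by (simp add: prod.distrib)
  then show ?thesis
    by (simp add: sum_distrib_right mult.assoc plane_wave_freq)
qed

text \<open>The one-dimensional error 1 / M is transferred to the product. Convergence with all
  derivatives up to order \<open>m\<close> on \<open>K\<close> is what the continuity estimate for
  the pairing requires.\<close>

lemma deriv_le_tensor_diff:
  assumes K: "\<And>x i. x \<in> K \<Longrightarrow> \<bar>x $ i\<bar> < pi / w"
  obtains D where "D \<ge> 0" "\<And>M. M \<ge> 1 \<Longrightarrow> deriv_le m K (\<lambda>x. tensor F x - tensor (PS M) x) (D / real M)"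
proof -
  have A: "A \<ge> 1" using gevreyD(1)[OF gevrey] .
  define e where "e = 2 * (A ^ (m + 3) * fact (2 * (m + 2)) / w\<^sup>2)"
  \<comment> \<open>One bound for both families of factors: for M at least 1 the partial sums differ
    from \<open>F\<close> by at most \<open>e\<close>.\<close>
  define Z where "Z = A ^ (m + 1) * fact (2 * m) + e"
  have e0: "e \<ge> 0" using A by (simp add: e_def)
  have "1 * 1 \<le> A ^ (m + 1) * fact (2 * m)"
    using A by (intro mult_mono one_le_power fact_ge_1) auto
  then have Z1: "Z \<ge> 1" using e0 by (simp add: Z_def)
  have F: "norm (F i j t) \<le> A ^ (m + 1) * fact (2 * m)" if "j \<le> m" for i j t
  proof -
    have "norm (F i j t) \<le> A ^ (j + 1) * fact (2 * j)" by (rule gevreyD(3)[OF gevrey])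
    also have "\<dots> \<le> A ^ (m + 1) * fact (2 * m)"
      using A that by (intro mult_mono power_increasing fact_mono) auto
    finally show ?thesis .
  qed
  have err: "norm (F i j t - PS M i j t) \<le> e / real M" if "j \<le> m" "\<bar>t\<bar> < pi / w" "M \<ge> 1" for i j t M
  proof -
    have "norm (F i j t - PS M i j t) \<le> 2 * (A ^ (j + 3) * fact (2 * (j + 2)) / w\<^sup>2) / real M"
      unfolding PS_def by (rule gevrey_fourier.partial_sum_error[OF fourier that(2,3)])
    also have "\<dots> \<le> e / real M"
      unfolding e_def using A that(1)
      by (intro divide_right_mono mult_left_mono mult_mono power_increasing fact_mono) auto
    finally show ?thesis .
  qed
  have P: "norm (PS M i j t) \<le> Z" if "j \<le> m" "\<bar>t\<bar> < pi / w" "M \<ge> 1" for i j t M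
  proof -
    have "norm (PS M i j t) \<le> norm (F i j t) + norm (F i j t - PS M i j t)"
      using norm_triangle_sub[of "PS M i j t" "F i j t"] by (simp add: norm_minus_commute)
    moreover have "e / real M \<le> e / 1" using e0 that by (intro divide_left_mono) auto
    ultimately show ?thesis using F[OF that(1), of i t] err[OF that, of i] by (simp add: Z_def)
  qed
  show ?thesis
  proof (rule that)
    show "Z ^ CARD('n) * (real CARD('n) * e) \<ge> 0" using Z1 e0 by simp
    fix M :: nat assume M: "M \<ge> 1"
    show "deriv_le m K (\<lambda>x. tensor F x - tensor (PS M) x) (Z ^ CARD('n) * (real CARD('n) * e) / real M)"
    proof (rule deriv_leI)
      fix "is" :: "'n list" and x assume l: "length is \<le> m" and x: "x \<in> K"
      have j: "count_list is i \<le> m" for i using count_le_length[of "is" i] l by linarith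
      have "iter_partial is (\<lambda>x. tensor F x - tensor (PS M) x) x =
          iter_partial is (tensor F) x - iter_partial is (tensor (PS M)) x"
        by (rule iter_partial_diff(1)[OF open_UNIV])
          (auto intro!: iter_partial_tensor(2) gevreyD(2)[OF gevrey] deriv_seq_PS)
      also have "\<dots> = (\<Prod>i\<in>UNIV. F i (count_list is i) (x $ i)) -
          (\<Prod>i\<in>UNIV. PS M i (count_list is i) (x $ i))"
        by (simp add: iter_partial_tensor gevreyD(2)[OF gevrey] deriv_seq_PS)
      also have "norm \<dots> \<le> Z ^ CARD('n) * (real CARD('n) * (e / real M))"
      proof (rule norm_prod_diff_le[OF Z1])
        fix i
        show "norm (F i (count_list is i) (x $ i)) \<le> Z"
          using F[OF j] e0 unfolding Z_def by (smt (verit))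
        show "norm (PS M i (count_list is i) (x $ i)) \<le> Z"
          by (rule P[OF j K[OF x] M])
        show "norm (F i (count_list is i) (x $ i) - PS M i (count_list is i) (x $ i)) \<le> e / real M"
          by (rule err[OF j K[OF x] M])
      qed
      finally show "norm (iter_partial is (\<lambda>x. tensor F x - tensor (PS M) x) x) \<le>
          Z ^ CARD('n) * (real CARD('n) * e) / real M" by simp
    qed
  qed
qed

text \<open>The weight is a product over the coordinates, so the sum over the cube of modes is the
  product of one-dimensional sums.\<close>

lemma sum_modes_le:
  "(\<Sum>k\<in>modes M. (\<Prod>i\<in>UNIV. norm (c i (k i))) * (\<Prod>i\<in>UNIV. 1 + \<bar>of_int (k i)\<bar>) ^ q) \<le>
    (3 * ((max 1 (2 / w) * A) ^ (q + 3) * fact (2 * q + 4))) ^ CARD('n)"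
proof -
  have "(\<Sum>k\<in>modes M. (\<Prod>i\<in>UNIV. norm (c i (k i))) * (\<Prod>i\<in>UNIV. 1 + \<bar>of_int (k i)\<bar>) ^ q) =
      (\<Sum>k\<in>modes M. \<Prod>i\<in>UNIV. norm (c i (k i)) * (1 + \<bar>of_int (k i)\<bar>) ^ q)"
    by (simp add: prod.distrib prod_power_distrib)
  also have "\<dots> = (\<Prod>i\<in>UNIV. \<Sum>k\<in>{- int M..int M}. norm (c i k) * (1 + \<bar>of_int k\<bar>) ^ q)"
    unfolding modes_def by (rule prod_sum_PiE[symmetric]) auto
  also have "\<dots> \<le> (\<Prod>i\<in>(UNIV :: 'n set). 3 * ((max 1 (2 / w) * A) ^ (q + 3) * fact (2 * q + 4)))"
    by (intro prod_mono conjI sum_nonneg gevrey_fourier.sum_fcoeff_le[OF fourier]) auto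
  finally show ?thesis by simp
qed

text \<open>The Fourier transform of the product with \<open>tensor F\<close> is a limit of sums of translates
  \<open>fourier U (v N) (\<xi> - freq w k)\<close>, weighted by the Fourier coefficients of \<open>tensor F\<close>.\<close>

lemma pairing_tensor_le:
  fixes U :: "(real^'n) set"
  assumes U: "open U" and v: "compact_distribution U v"
    and K: "K \<subseteq> U" "\<And>x i. x \<in> K \<Longrightarrow> \<bar>x $ i\<bar> < pi / w"
    and C: "C \<ge> 0" "\<And>f B. smooth_on U f \<Longrightarrow> B \<ge> 0 \<Longrightarrow> deriv_le m K f B \<Longrightarrow> norm (pairing U v f) \<le> C * B"
    and T: "\<And>k. norm (pairing U v (plane_wave (\<xi> - freq w k))) \<le> X + Y * (\<Prod>i\<in>UNIV. 1 + \<bar>of_int (k i)\<bar>) ^ q"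
    and XY: "X \<ge> 0" "Y \<ge> 0"
  shows "norm (pairing U v (\<lambda>x. tensor F x * plane_wave \<xi> x)) \<le>
    X * (3 * ((max 1 (2 / w) * A) ^ 3 * fact 4)) ^ CARD('n) +
    Y * (3 * ((max 1 (2 / w) * A) ^ (q + 3) * fact (2 * q + 4))) ^ CARD('n)" (is "_ \<le> ?T")
proof -
  obtain D where D: "D \<ge> 0" "\<And>M. M \<ge> 1 \<Longrightarrow> deriv_le m K (\<lambda>x. tensor F x - tensor (PS M) x) (D / real M)"
    using deriv_le_tensor_diff[of K m] K(2) by blast
  have sF: "smooth_on U (tensor F)" and sP: "smooth_on U (tensor (PS M))" for M
    by (auto intro!: iter_partial_tensor(2) gevreyD(2)[OF gevrey] deriv_seq_PS)
  note sw = iter_partial_plane_wave(2)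
  \<comment> \<open>The constant of the truncation error. It depends on \<xi>, which is harmless
    since M tends to infinity with \<xi> fixed.\<close>
  define W where "W = C * (2 ^ m * D * (1 + 2 * pi * norm \<xi>) ^ m)"
  have bound: "norm (pairing U v (\<lambda>x. tensor F x * plane_wave \<xi> x)) \<le> ?T + W / real M" if M: "M \<ge> 1" for M
  proof -
    have main: "norm (pairing U v (\<lambda>x. tensor (PS M) x * plane_wave \<xi> x)) \<le> ?T"
    proof -
      have "pairing U v (\<lambda>x. tensor (PS M) x * plane_wave \<xi> x) =
          (\<Sum>k\<in>modes M. pairing U v (\<lambda>x. (\<Prod>i\<in>UNIV. c i (k i)) * plane_wave (\<xi> - freq w k) x))"
        unfolding tensor_PS_plane_wave
        by (intro pairing_sum U v iter_partial_cmult(2) sw finite_modes)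
      also have "\<dots> = (\<Sum>k\<in>modes M. (\<Prod>i\<in>UNIV. c i (k i)) * pairing U v (plane_wave (\<xi> - freq w k)))"
        by (intro sum.cong refl pairing_cmult U v sw)
      also have "norm \<dots> \<le> (\<Sum>k\<in>modes M. (\<Prod>i\<in>UNIV. norm (c i (k i))) *
          (X + Y * (\<Prod>i\<in>UNIV. 1 + \<bar>of_int (k i)\<bar>) ^ q))"
        by (intro order_trans[OF norm_sum] sum_mono)
          (auto simp: norm_mult prod_norm[symmetric] intro!: mult_left_mono T prod_nonneg)
      \<comment> \<open>The exponent 0 is written out so that \<open>sum_modes_le\<close> applies to
        both sums.\<close>
      also have "\<dots> = X * (\<Sum>k\<in>modes M. (\<Prod>i\<in>UNIV. norm (c i (k i))) * (\<Prod>i\<in>UNIV. 1 + \<bar>of_int (k i)\<bar>) ^ 0) +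
          Y * (\<Sum>k\<in>modes M. (\<Prod>i\<in>UNIV. norm (c i (k i))) * (\<Prod>i\<in>UNIV. 1 + \<bar>of_int (k i)\<bar>) ^ q)"
        by (simp add: sum_distrib_left sum.distrib algebra_simps)
      also have "\<dots> \<le> X * (3 * ((max 1 (2 / w) * A) ^ (0 + 3) * fact (2 * 0 + 4))) ^ CARD('n) +
          Y * (3 * ((max 1 (2 / w) * A) ^ (q + 3) * fact (2 * q + 4))) ^ CARD('n)"
        by (intro add_mono mult_left_mono sum_modes_le XY)
      finally show ?thesis by simp
    qed
    have "pairing U v (\<lambda>x. tensor F x * plane_wave \<xi> x) - pairing U v (\<lambda>x. tensor (PS M) x * plane_wave \<xi> x) =
        pairing U v (\<lambda>x. (tensor F x - tensor (PS M) x) * plane_wave \<xi> x)"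
      unfolding left_diff_distrib
      by (intro pairing_diff[symmetric] U v iter_partial_mult(2) sF sP sw)
    also have "norm \<dots> \<le> C * (2 ^ m * (D / real M) * (1 + 2 * pi * norm \<xi>) ^ m)"
    proof (intro C(2) deriv_le_mult[OF U] iter_partial_mult(2)[OF U] iter_partial_diff(2)[OF U] sF sP sw K(1) D(2) M)
      show "deriv_le m K (plane_wave \<xi>) ((1 + 2 * pi * norm \<xi>) ^ m)"
      proof (rule deriv_leI)
        fix "is" :: "'n list" and x assume "length is \<le> m"
        then have "(1 + 2 * pi * norm \<xi>) ^ length is \<le> (1 + 2 * pi * norm \<xi>) ^ m"
          by (intro power_increasing) auto
        then show "norm (iter_partial is (plane_wave \<xi>) x) \<le> (1 + 2 * pi * norm \<xi>) ^ m"
          using norm_iter_partial_plane_wave_le order_trans by blast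
      qed
    qed (use D(1) in auto)
    also have "\<dots> = W / real M" by (simp add: W_def)
    finally show ?thesis
      using main norm_triangle_sub[of "pairing U v (\<lambda>x. tensor F x * plane_wave \<xi> x)"
          "pairing U v (\<lambda>x. tensor (PS M) x * plane_wave \<xi> x)"] by linarith
  qed
  have "(\<lambda>M. ?T + W / real M) \<longlonglongrightarrow> ?T + 0"
    by (intro tendsto_intros lim_const_over_n)
  then show ?thesis
    using bound by (intro LIMSEQ_le_const[where X = "\<lambda>M. ?T + W / real M"]) auto
qed

end

section \<open>The wave front set\<close>

lemma fourier_eq_pairing: "fourier U v \<xi> = pairing U v (plane_wave \<xi>)"
  by (simp add: fourier_def plane_wave_def[abs_def])

text \<open>Continuity of order \<open>m\<close> gives polynomial growth of degree \<open>m\<close>,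
  with the same \<open>C\<close> and \<open>m\<close> for every distribution sharing the
  estimate.\<close>

lemma norm_pairing_plane_wave_le:
  assumes C: "\<And>f B. smooth_on U f \<Longrightarrow> B \<ge> 0 \<Longrightarrow> deriv_le m K f B \<Longrightarrow> norm (pairing U v f) \<le> C * B"
  shows "norm (pairing U v (plane_wave \<eta>)) \<le> C * (1 + 2 * pi * norm \<eta>) ^ m"
proof (intro C iter_partial_plane_wave(2))
  show "deriv_le m K (plane_wave \<eta>) ((1 + 2 * pi * norm \<eta>) ^ m)"
  proof (rule deriv_leI)
    fix "is" :: "'a list" and x assume "length is \<le> m"
    then have "(1 + 2 * pi * norm \<eta>) ^ length is \<le> (1 + 2 * pi * norm \<eta>) ^ m"
      by (intro power_increasing) auto
    then show "norm (iter_partial is (plane_wave \<eta>) x) \<le> (1 + 2 * pi * norm \<eta>) ^ m"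
      using norm_iter_partial_plane_wave_le order_trans by blast
  qed
qed auto

text \<open>The smaller cone is spanned by the ball of half the radius around
  \<open>\<xi>\<^sub>0\<close>, which leaves room for a perturbation; by homogeneity the room is
  proportional to the norm.\<close>

lemma conic_nhd_shrink:
  fixes \<xi>\<^sub>0 :: "real^'n::finite"
  assumes \<Gamma>: "conic_nhd \<xi>\<^sub>0 \<Gamma>" and "\<xi>\<^sub>0 \<noteq> 0"
  obtains \<Gamma>\<^sub>0 c where "conic_nhd \<xi>\<^sub>0 \<Gamma>\<^sub>0" "0 < c" "c < 1"
    "\<And>\<xi> \<zeta>. \<xi> \<in> \<Gamma>\<^sub>0 \<Longrightarrow> norm \<zeta> \<le> c * norm \<xi> \<Longrightarrow> \<xi> - \<zeta> \<in> \<Gamma>"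
proof -
  have "\<xi>\<^sub>0 \<in> interior \<Gamma>" using \<Gamma> by (simp add: conic_nhd_def)
  then obtain e where e: "e > 0" "ball \<xi>\<^sub>0 e \<subseteq> \<Gamma>"
    by (meson mem_interior)
  define d where "d = e / 2"
  define \<Gamma>\<^sub>0 where "\<Gamma>\<^sub>0 = {t *\<^sub>R z |t z. t > 0 \<and> z \<in> ball \<xi>\<^sub>0 d}"
  \<comment> \<open>A point of the ball has norm at most that of \<open>\<xi>\<^sub>0\<close> plus
    \<open>d\<close>, so \<open>c\<close> times its norm is at most \<open>d\<close>.\<close>
  define c where "c = d / (norm \<xi>\<^sub>0 + d)"
  have d: "d > 0" using e by (simp add: d_def)
  have n0: "norm \<xi>\<^sub>0 > 0" using assms by simp
  have scale: "t *\<^sub>R z \<in> \<Gamma>" if "t > 0" "z \<in> \<Gamma>" for t z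
    using \<Gamma> that by (simp add: conic_nhd_def)
  have sub: "\<xi> - \<zeta> \<in> \<Gamma>" if \<xi>: "\<xi> \<in> \<Gamma>\<^sub>0" and \<zeta>: "norm \<zeta> \<le> c * norm \<xi>" for \<xi> \<zeta>
  proof -
    obtain t z where t: "\<xi> = t *\<^sub>R z" "t > 0" "norm (z - \<xi>\<^sub>0) < d"
      using \<xi> by (auto simp: \<Gamma>\<^sub>0_def dist_norm norm_minus_commute)
    have "norm z \<le> norm \<xi>\<^sub>0 + d" using t(3) norm_triangle_sub[of z \<xi>\<^sub>0] by linarith
    then have "c * norm \<xi> \<le> c * (t * (norm \<xi>\<^sub>0 + d))"
      using t d n0 by (intro mult_left_mono) (auto simp: c_def)
    also have "\<dots> = t * (c * (norm \<xi>\<^sub>0 + d))" by (simp only: mult_ac)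
    also have "c * (norm \<xi>\<^sub>0 + d) = d"
      using add_pos_pos[OF n0 d] unfolding c_def by (intro nonzero_eq_divide_eq[THEN iffD1, OF _ refl]) linarith
    finally have "norm \<zeta> \<le> t * d" using \<zeta> by simp
    then have "norm (inverse t *\<^sub>R \<zeta>) \<le> d" using t by (simp add: field_simps)
    moreover have "norm (z - inverse t *\<^sub>R \<zeta> - \<xi>\<^sub>0) \<le> norm (z - \<xi>\<^sub>0) + norm (inverse t *\<^sub>R \<zeta>)"
      using norm_triangle_ineq4[of "z - \<xi>\<^sub>0" "inverse t *\<^sub>R \<zeta>"] by (simp add: algebra_simps)
    ultimately have "norm (z - inverse t *\<^sub>R \<zeta> - \<xi>\<^sub>0) < e" using t(3) by (simp add: d_def)
    then have "z - inverse t *\<^sub>R \<zeta> \<in> ball \<xi>\<^sub>0 e" by (simp add: dist_norm norm_minus_commute)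
    then have "t *\<^sub>R (z - inverse t *\<^sub>R \<zeta>) \<in> \<Gamma>" using e scale t by blast
    then show ?thesis using t by (simp add: scaleR_diff_right)
  qed
  have "conic_nhd \<xi>\<^sub>0 \<Gamma>\<^sub>0" unfolding conic_nhd_def
  proof (intro conjI ballI allI impI)
    \<comment> \<open>The perturbation property with zero translation puts
      \<open>\<Gamma>\<^sub>0\<close> inside \<Gamma>, which omits 0.\<close>
    show "0 \<notin> \<Gamma>\<^sub>0" using sub[of 0 0] \<Gamma> by (auto simp: conic_nhd_def)
  next
    fix \<eta> s assume "\<eta> \<in> \<Gamma>\<^sub>0" "(s::real) > 0"
    then obtain t z where "\<eta> = t *\<^sub>R z" "t > 0" "z \<in> ball \<xi>\<^sub>0 d" by (auto simp: \<Gamma>\<^sub>0_def)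
    then show "s *\<^sub>R \<eta> \<in> \<Gamma>\<^sub>0"
      using \<open>s > 0\<close> unfolding \<Gamma>\<^sub>0_def by (intro CollectI exI[of _ "s * t"] exI[of _ z]) auto
  next
    have "ball \<xi>\<^sub>0 d \<subseteq> \<Gamma>\<^sub>0"
      unfolding \<Gamma>\<^sub>0_def by (auto intro!: exI[of _ "1::real"])
    then show "\<xi>\<^sub>0 \<in> interior \<Gamma>\<^sub>0"
      using d by (meson centre_in_ball interior_maximal open_ball subsetD)
  qed
  moreover have "0 < c" "c < 1" using d n0 add_pos_pos[OF n0 d] by (simp_all only: c_def divide_pos_pos divide_less_eq_1_pos)
  ultimately show ?thesis using that sub by blast
qed

lemma tensor_in_D_roumieu:
  fixes F :: "'n::finite \<Rightarrow> nat \<Rightarrow> real \<Rightarrow> complex"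
  assumes \<tau>: "\<tau> > 0" and \<sigma>: "\<sigma> > 1" and F: "\<And>i. gevrey (F i) A"
    and s: "smooth_on UNIV (tensor F)" "supp (tensor F) \<subseteq> K"
  shows "tensor F \<in> D_roumieu \<tau> \<sigma> K"
proof -
  have A: "A \<ge> 1" using gevreyD(1)[OF F] .
  obtain B h where B: "B > 0" "h > 0"
    "\<And>p. A ^ p * fact (2 * p + 0) ^ 1 \<le> B * (h powr (real p powr \<sigma>) * M_seq \<tau> \<sigma> p)"
    using dominated_gevrey[OF \<tau> \<sigma> A, of 0 1] unfolding dominated_def by blast
  have "norm (mi_deriv \<alpha> (tensor F) x) / (h powr (real (mi_order \<alpha>) powr \<sigma>) * M_seq \<tau> \<sigma> (mi_order \<alpha>))
      \<le> A ^ CARD('n) * B" for \<alpha> x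
  proof -
    define p where "p = mi_order \<alpha>"
    have pos: "h powr (real p powr \<sigma>) * M_seq \<tau> \<sigma> p > 0"
      using B M_seq_ge_1[OF \<tau>, of \<sigma> p] by (intro mult_pos_pos) auto
    have "norm (mi_deriv \<alpha> (tensor F) x) = norm (\<Prod>i\<in>UNIV. F i (\<alpha> i) (x $ i))"
      by (simp add: mi_deriv_eq iter_partial_tensor gevreyD(2)[OF F])
    also have "\<dots> \<le> A ^ (p + CARD('n)) * fact (2 * p)"
      unfolding p_def by (rule norm_prod_gevrey_le[OF F])
    also have "\<dots> = A ^ CARD('n) * (A ^ p * fact (2 * p + 0) ^ 1)"
      by (simp add: power_add)
    also have "\<dots> \<le> A ^ CARD('n) * (B * (h powr (real p powr \<sigma>) * M_seq \<tau> \<sigma> p))"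
      using A by (intro mult_left_mono B(3)) auto
    finally show ?thesis using pos unfolding p_def[symmetric]
      by (simp add: divide_le_eq mult.assoc)
  qed
  then have "tensor F \<in> D_h \<tau> \<sigma> h K" using s unfolding D_h_def by blast
  then show ?thesis using B(2) by (auto simp: D_roumieu_def)
qed

text \<open>Decay at \<open>\<xi> \<in> \<Gamma>\<^sub>0\<close>: small frequencies \<open>\<zeta>\<close> leave \<open>\<xi> - \<zeta>\<close> in \<open>\<Gamma>\<close>, where the
  hypothesis applies; for large ones polynomial growth suffices, at the cost of powers of \<open>\<zeta>\<close>.\<close>

lemma translate_le:
  fixes \<xi> \<zeta> :: "real^'n::finite"
  assumes c: "0 < c" "c < 1" and \<xi>: "\<xi> \<noteq> 0" and C: "C \<ge> 0" and X: "X \<ge> 0"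
    and near: "norm \<zeta> \<le> c * norm \<xi> \<Longrightarrow> g \<le> X / norm (\<xi> - \<zeta>) ^ p"
    and far: "g \<le> C * (1 + 2 * pi * norm (\<xi> - \<zeta>)) ^ m"
    and H: "H \<ge> 0" "1 + norm \<zeta> \<le> H * P"
  shows "g \<le> (1 / (1 - c)) ^ p * X / norm \<xi> ^ p +
    C * (1 + 2 * pi * (1 / c + 1)) ^ m * (H ^ (m + p) * (1 / c) ^ p) / norm \<xi> ^ p * P ^ (m + p)"
proof (cases "norm \<zeta> \<le> c * norm \<xi>")
  case True
  have "(1 - c) * norm \<xi> \<le> norm (\<xi> - \<zeta>)"
    using True norm_triangle_ineq2[of \<xi> \<zeta>] by (simp add: algebra_simps)
  moreover from this have "\<xi> \<noteq> \<zeta>" using c \<xi> by (auto simp: mult_le_0_iff)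
  ultimately have "((1 - c) * norm \<xi>) ^ p \<le> norm (\<xi> - \<zeta>) ^ p" "\<xi> \<noteq> \<zeta>"
    using c by (auto intro: power_mono)
  then have "X / norm (\<xi> - \<zeta>) ^ p \<le> X / ((1 - c) * norm \<xi>) ^ p"
    using c \<xi> X by (intro divide_left_mono mult_pos_pos) auto
  also have "\<dots> = (1 / (1 - c)) ^ p * X / norm \<xi> ^ p"
    by (simp add: power_mult_distrib power_divide)
  finally have "g \<le> (1 / (1 - c)) ^ p * X / norm \<xi> ^ p" using near[OF True] by linarith
  moreover have "P \<ge> 0"
    using H by (smt (verit) mult_nonneg_nonpos norm_ge_zero)
  then have "0 \<le> C * (1 + 2 * pi * (1 / c + 1)) ^ m * (H ^ (m + p) * (1 / c) ^ p) / norm \<xi> ^ p * P ^ (m + p)"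
    using c C H by (intro mult_nonneg_nonneg divide_nonneg_nonneg zero_le_power add_nonneg_nonneg) auto
  ultimately show ?thesis by linarith
next
  case False
  define G where "G = 1 + 2 * pi * (1 / c + 1)"
  have G: "G \<ge> 1" using c by (simp add: G_def)
  have far1: "norm \<xi> \<le> 1 / c * norm \<zeta>" using False c by (simp add: field_simps)
  have "norm (\<xi> - \<zeta>) \<le> (1 / c + 1) * norm \<zeta>"
    using norm_triangle_ineq4[of \<xi> \<zeta>] far1 by (simp add: algebra_simps)
  then have "1 + 2 * pi * norm (\<xi> - \<zeta>) \<le> 1 + 2 * pi * ((1 / c + 1) * norm \<zeta>)" by simp
  also have "\<dots> = 1 + (G - 1) * norm \<zeta>" by (simp add: G_def)
  also have "\<dots> \<le> G * (1 + norm \<zeta>)" using G norm_ge_zero[of \<zeta>] by (simp add: algebra_simps del: norm_ge_zero)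
  finally have "(1 + 2 * pi * norm (\<xi> - \<zeta>)) ^ m \<le> (G * (1 + norm \<zeta>)) ^ m"
    by (intro power_mono) auto
  then have "g \<le> C * (G * (1 + norm \<zeta>)) ^ m" using far mult_left_mono[OF _ C] order_trans by blast
  also have "\<dots> = C * G ^ m * (1 + norm \<zeta>) ^ m * 1" by (simp add: power_mult_distrib)
  \<comment> \<open>In this case the norm of \<xi> is at most (1 + norm \<zeta>) / c, so the
    inserted quotient is at least 1; its p-th power creates the required denominator.\<close>
  also have "\<dots> \<le> C * G ^ m * (1 + norm \<zeta>) ^ m * ((1 / c * (1 + norm \<zeta>)) / norm \<xi>) ^ p"
  proof (intro mult_left_mono one_le_power mult_nonneg_nonneg)
    have "1 / c * norm \<zeta> \<le> 1 / c * (1 + norm \<zeta>)" using c by (intro mult_left_mono) auto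
    then have "norm \<xi> \<le> 1 / c * (1 + norm \<zeta>)" using far1 by linarith
    then show "1 \<le> 1 / c * (1 + norm \<zeta>) / norm \<xi>"
      using \<xi> by (subst le_divide_eq_1_pos) simp_all
  qed (use C G in auto)
  also have "\<dots> = C * G ^ m * (1 / c) ^ p / norm \<xi> ^ p * (1 + norm \<zeta>) ^ (m + p)"
    by (simp add: power_add power_mult_distrib power_divide)
  also have "\<dots> \<le> C * G ^ m * (1 / c) ^ p / norm \<xi> ^ p * (H * P) ^ (m + p)"
    using C G c H by (intro mult_left_mono power_mono) auto
  also have "\<dots> = C * G ^ m * (H ^ (m + p) * (1 / c) ^ p) / norm \<xi> ^ p * P ^ (m + p)"
    by (simp add: power_mult_distrib)
  finally have "g \<le> C * G ^ m * (H ^ (m + p) * (1 / c) ^ p) / norm \<xi> ^ p * P ^ (m + p)" .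
  moreover have "0 \<le> (1 / (1 - c)) ^ p * X / norm \<xi> ^ p" using c X by auto
  ultimately show ?thesis unfolding G_def by linarith
qed

text \<open>Everything except the index \<open>N\<close> is fixed before the decay order
  \<open>p\<close>, so the dependence on \<open>p\<close> is confined to \<open>X\<close>,
  \<open>Y\<close> and \<open>S\<close>, and only their growth remains to be compared with the
  weights.\<close>

lemma not_in_WF_imp_decay:
  fixes U :: "(real^'n::finite) set"
  assumes U: "open U" and u: "distribution U u" and \<tau>: "\<tau> > 0" and \<sigma>: "\<sigma> > 1" and \<xi>0: "\<xi>\<^sub>0 \<noteq> 0"
    and \<Omega>: "open \<Omega>" "x\<^sub>0 \<in> \<Omega>" "\<Omega> \<subseteq> U" and \<Gamma>: "conic_nhd \<xi>\<^sub>0 \<Gamma>"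
    and v: "bounded_compact_seq U v" "\<And>N. equal_on \<Omega> (v N) u"
    and A: "A > 0" "h > 0" "\<And>N \<eta>. \<eta> \<in> \<Gamma> \<Longrightarrow> norm (fourier U (v N) \<eta>) \<le>
      A * (h ^ N * fact N powr (\<tau> / \<sigma>)) / norm \<eta> ^ nat \<lfloor>real N powr (1 / \<sigma>)\<rfloor>"
  shows "\<exists>\<Gamma>\<^sub>0 K \<phi>. conic_nhd \<xi>\<^sub>0 \<Gamma>\<^sub>0 \<and> regular_compact K \<and> K \<subseteq> U \<and>
       \<phi> \<in> D_roumieu \<tau> \<sigma> K \<and> (\<forall>\<^sub>F x in nhds x\<^sub>0. \<phi> x = 1) \<and>
       (\<exists>A>0. \<exists>h>0. \<forall>N. \<forall>\<xi>\<in>\<Gamma>\<^sub>0. norm (fourier U (mult_dist \<phi> u) \<xi>) \<le>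
            A * (h powr (real N powr \<sigma>) * M_seq \<tau> \<sigma> N) / norm \<xi> ^ N)"
proof -
  obtain r where r: "r > 0" "cube x\<^sub>0 r \<subseteq> \<Omega>" using cube_subset_open[OF \<Omega>(1,2)] .
  obtain F a where gev: "\<And>i. gevrey (F i) a" and zero: "\<And>i k t. r \<le> \<bar>t - x\<^sub>0 $ i\<bar> \<Longrightarrow> F i k t = 0"
    and one: "\<And>x. x \<in> ball x\<^sub>0 (r / 2) \<Longrightarrow> tensor F x = 1"
    and smooth: "smooth_on UNIV (tensor F)" and supp: "supp (tensor F) \<subseteq> cube x\<^sub>0 r"
    using tensor_bump[OF r(1), of x\<^sub>0] by metis
  have a: "a \<ge> 1" using gevreyD(1)[OF gev] .
  obtain \<Gamma>\<^sub>0 c where \<Gamma>0: "conic_nhd \<xi>\<^sub>0 \<Gamma>\<^sub>0" and c: "0 < c" "c < 1"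
    and shrink: "\<And>\<xi> \<zeta>. \<xi> \<in> \<Gamma>\<^sub>0 \<Longrightarrow> norm \<zeta> \<le> c * norm \<xi> \<Longrightarrow> \<xi> - \<zeta> \<in> \<Gamma>"
    using conic_nhd_shrink[OF \<Gamma> \<xi>0] by metis
  obtain K C m where K: "compact K" "K \<subseteq> U" "C \<ge> 0"
    and C: "\<And>N f B. smooth_on U f \<Longrightarrow> B \<ge> 0 \<Longrightarrow> deriv_le m K f B \<Longrightarrow> norm (pairing U (v N) f) \<le> C * B"
    using bounded_compact_seq_equicontinuous[OF U v(1)] by metis
  have cd: "compact_distribution U (v N)" for N
    using v(1) by (auto simp: bounded_compact_seq_def)
  have cube\<Omega>: "compact (supp (tensor F))"
    using supp by (metis closed_supp compact_cube compact_Int_closed inf.absorb_iff2)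
  then have test\<Omega>: "tensor F \<in> test_functions \<Omega>" and test: "tensor F \<in> test_functions U"
    using smooth supp r \<Omega> by (auto simp: test_functions_def)
  obtain b where b: "\<And>x. x \<in> K \<Longrightarrow> norm x \<le> b"
    using compact_imp_bounded[OF K(1)] by (auto simp: bounded_iff)
  define R where "R = norm x\<^sub>0 + r"
  \<comment> \<open>The half period pi / w exceeds both \<open>b\<close>, the bound on
    \<open>K\<close>, and \<open>R\<close>, beyond which every factor of the cutoff
    vanishes.\<close>
  define w where "w = pi / (max b R + 1)"
  have R0: "R > 0" using r by (simp add: R_def add_nonneg_pos)
  have w: "w > 0" and piw: "pi / w = max b R + 1"
    using R0 by (auto simp: w_def)
  interpret T: tensor_fourier F a w R
  proof (intro tensor_fourier.intro gevrey_fourier.intro gev w)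
    show "R < pi / w" unfolding piw by simp
    fix i k and t :: real assume "R \<le> \<bar>t\<bar>"
    then have "r \<le> \<bar>t - x\<^sub>0 $ i\<bar>"
      using component_le_norm_cart[of x\<^sub>0 i] unfolding R_def by linarith
    then show "F i k t = 0" by (rule zero)
  qed
  have Kw: "\<bar>x $ i\<bar> < pi / w" if "x \<in> K" for x i
    using b[OF that] component_le_norm_cart[of x i] unfolding piw by linarith
  define H where "H = max 1 (w / (2 * pi))"
  define G where "G = 1 + 2 * pi * (1 / c + 1)"
  define D where "D = max 1 (2 / w) * a"
  have D: "D \<ge> 1" using a mult_mono[of 1 "max 1 (2 / w)" 1 a] by (simp add: D_def)
  have G: "G \<ge> 1" using c by (simp add: G_def)
  have H1: "H \<ge> 1" by (simp add: H_def)
  define E where "E p = h ^ nat \<lceil>real p powr \<sigma>\<rceil> * fact (nat \<lceil>real p powr \<sigma>\<rceil>) powr (\<tau> / \<sigma>)" for p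
  define X where "X p = (1 / (1 - c)) ^ p * (A * E p)" for p
  define Y where "Y p = C * G ^ m * (H ^ (m + p) * (1 / c) ^ p)" for p
  define Q where "Q = (3 * (D ^ 3 * fact 4)) ^ CARD('n)"
  define S where "S p = (3 * (D ^ (m + p + 3) * fact (2 * (m + p) + 4))) ^ CARD('n)" for p
  have E0: "E p \<ge> 0" for p using A(2) by (simp add: E_def)
  have X0: "X p \<ge> 0" for p using A c E0 by (simp add: X_def)
  have Y0: "Y p \<ge> 0" for p using K(3) G H1 c by (simp add: Y_def)
  have decay: "norm (fourier U (mult_dist (tensor F) u) \<xi>) \<le> (X p * Q + Y p * S p) / norm \<xi> ^ p"
    if \<xi>: "\<xi> \<in> \<Gamma>\<^sub>0" for \<xi> p
  proof -
    have \<xi>n: "\<xi> \<noteq> 0" using \<xi> \<Gamma>0 by (auto simp: conic_nhd_def)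
    define N where "N = nat \<lceil>real p powr \<sigma>\<rceil>"
    note sw = iter_partial_plane_wave(2)
    have "fourier U (mult_dist (tensor F) u) \<xi> = u (\<lambda>x. tensor F x * plane_wave \<xi> x)"
      unfolding fourier_eq_pairing by (rule mult_dist_compact(2)[OF U u test sw])
    \<comment> \<open>The test function is supported in \<Omega>, where \<open>u\<close> and
      \<open>v N\<close> agree; \<open>u\<close> may therefore be exchanged for the term that suits
      this \<open>p\<close>.\<close>
    also have "\<dots> = v N (\<lambda>x. tensor F x * plane_wave \<xi> x)"
      using v(2)[of N] test_functions_mult(1)[OF \<Omega>(1) test\<Omega> sw] by (simp add: equal_on_def)
    also have "\<dots> = pairing U (v N) (\<lambda>x. tensor F x * plane_wave \<xi> x)"
      by (rule pairing_cutoff(2)[OF U cd test_functions_mult(1)[OF U test sw], symmetric])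
    also have "norm \<dots> \<le> (X p / norm \<xi> ^ p) * (3 * ((max 1 (2 / w) * a) ^ 3 * fact 4)) ^ CARD('n) +
        (Y p / norm \<xi> ^ p) * (3 * ((max 1 (2 / w) * a) ^ (m + p + 3) * fact (2 * (m + p) + 4))) ^ CARD('n)"
    proof (rule T.pairing_tensor_le[OF U cd K(2) Kw K(3) C])
      fix k :: "'n \<Rightarrow> int"
      have "norm (pairing U (v N) (plane_wave (\<xi> - freq w k))) \<le>
        (1 / (1 - c)) ^ p * (A * E p) / norm \<xi> ^ p +
        C * (1 + 2 * pi * (1 / c + 1)) ^ m * (H ^ (m + p) * (1 / c) ^ p) / norm \<xi> ^ p *
          (\<Prod>i\<in>UNIV. 1 + \<bar>of_int (k i)\<bar>) ^ (m + p)"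
      proof (rule translate_le[OF c \<xi>n K(3)])
        assume "norm (freq w k) \<le> c * norm \<xi>"
        from A(3)[OF shrink[OF \<xi> this], of N]
        show "norm (pairing U (v N) (plane_wave (\<xi> - freq w k))) \<le> A * E p / norm (\<xi> - freq w k) ^ p"
          unfolding fourier_eq_pairing N_def floor_root_ceiling[OF \<sigma>] E_def .
      next
        show "norm (pairing U (v N) (plane_wave (\<xi> - freq w k))) \<le>
            C * (1 + 2 * pi * norm (\<xi> - freq w k)) ^ m"
          by (rule norm_pairing_plane_wave_le[OF C])
        show "1 + norm (freq w k) \<le> H * (\<Prod>i\<in>UNIV. 1 + \<bar>of_int (k i)\<bar>)"
          unfolding H_def by (rule one_plus_norm_freq_le[OF w])
      qed (use A E0 H1 in auto)
      then show "norm (pairing U (v N) (plane_wave (\<xi> - freq w k))) \<le> X p / norm \<xi> ^ p +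
          Y p / norm \<xi> ^ p * (\<Prod>i\<in>UNIV. 1 + \<bar>of_int (k i)\<bar>) ^ (m + p)"
        unfolding X_def Y_def G_def .
    qed (use X0 Y0 in auto)
    also have "\<dots> = (X p * Q + Y p * S p) / norm \<xi> ^ p"
      by (simp add: Q_def S_def D_def add_divide_distrib)
    finally show ?thesis .
  qed
  have "dominated \<tau> \<sigma> (\<lambda>p. X p * Q + Y p * S p)"
  proof -
    have "dominated \<tau> \<sigma> (\<lambda>p. (A * Q) * (1 / (1 - c)) ^ p * E p)"
      unfolding E_def
      by (intro dominated_geometric[OF \<tau> \<sigma>] dominated_fact_ceiling[OF \<tau> \<sigma> A(2)])
        (use A c D in \<open>auto simp: Q_def\<close>)
    \<comment> \<open>\<open>Y p * S p\<close> regrouped as constant, geometric factor and Gevrey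
      factor; the latter has a = 2m + 4, and its exponent is the dimension.\<close>
    moreover have "dominated \<tau> \<sigma> (\<lambda>p. (C * G ^ m * H ^ m * (3 * D ^ (m + 3)) ^ CARD('n)) * (H * (1 / c)) ^ p *
        ((D ^ CARD('n)) ^ p * fact (2 * p + (2 * m + 4)) ^ CARD('n)))"
    proof (intro dominated_geometric[OF \<tau> \<sigma>] dominated_gevrey[OF \<tau> \<sigma>])
      show "1 \<le> H * (1 / c)" using H1 c mult_mono[of 1 H 1 "1 / c"] by simp
    qed (use K(3) G H1 D in auto)
    ultimately have "dominated \<tau> \<sigma> (\<lambda>p. (A * Q) * (1 / (1 - c)) ^ p * E p +
      (C * G ^ m * H ^ m * (3 * D ^ (m + 3)) ^ CARD('n)) * (H * (1 / c)) ^ p *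
        ((D ^ CARD('n)) ^ p * fact (2 * p + (2 * m + 4)) ^ CARD('n)))"
      by (rule dominated_add[OF \<tau>])
    then show ?thesis
    proof (rule dominated_mono)
      fix p
      have "S p = (3 * D ^ (m + 3)) ^ CARD('n) * ((D ^ CARD('n)) ^ p * fact (2 * p + (2 * m + 4)) ^ CARD('n))"
      proof -
        have "2 * (m + p) + 4 = 2 * p + (2 * m + 4)" "m + p + 3 = (m + 3) + p" by simp_all
        then have "S p = (3 * (D ^ (m + 3) * D ^ p * fact (2 * p + (2 * m + 4)))) ^ CARD('n)"
          unfolding S_def by (simp only: power_add)
        then show ?thesis
          by (simp only: power_mult_distrib power_mult[symmetric] mult_ac)
      qed
      moreover have "Y p = C * G ^ m * H ^ m * (H * (1 / c)) ^ p"
        unfolding Y_def by (simp only: power_add power_mult_distrib mult_ac)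
      ultimately show "X p * Q + Y p * S p \<le> (A * Q) * (1 / (1 - c)) ^ p * E p +
        (C * G ^ m * H ^ m * (3 * D ^ (m + 3)) ^ CARD('n)) * (H * (1 / c)) ^ p *
          ((D ^ CARD('n)) ^ p * fact (2 * p + (2 * m + 4)) ^ CARD('n))"
        unfolding X_def by (simp only: mult_ac order_refl)
    qed
  qed
  then obtain A' h' where A': "A' > 0" "h' > 0"
    "\<And>p. X p * Q + Y p * S p \<le> A' * (h' powr (real p powr \<sigma>) * M_seq \<tau> \<sigma> p)"
    unfolding dominated_def by blast
  show ?thesis
  proof (rule exI[of _ \<Gamma>\<^sub>0], rule exI[of _ "cube x\<^sub>0 r"], rule exI[of _ "tensor F"], intro conjI)
    show "\<exists>A>0. \<exists>h>0. \<forall>N. \<forall>\<xi>\<in>\<Gamma>\<^sub>0. norm (fourier U (mult_dist (tensor F) u) \<xi>) \<le>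
        A * (h powr (real N powr \<sigma>) * M_seq \<tau> \<sigma> N) / norm \<xi> ^ N"
    proof (rule exI[of _ A'], rule conjI[OF A'(1)], rule exI[of _ h'], intro conjI allI ballI A'(2))
      fix p \<xi> assume "\<xi> \<in> \<Gamma>\<^sub>0"
      from decay[OF this, of p]
      show "norm (fourier U (mult_dist (tensor F) u) \<xi>) \<le>
          A' * (h' powr (real p powr \<sigma>) * M_seq \<tau> \<sigma> p) / norm \<xi> ^ p"
        by (rule order_trans) (intro divide_right_mono A' zero_le_power norm_ge_zero)
    qed
    have "\<forall>\<^sub>F x in nhds x\<^sub>0. x \<in> ball x\<^sub>0 (r / 2)"
      using r by (intro eventually_nhds_in_open) auto
    then show "\<forall>\<^sub>F x in nhds x\<^sub>0. tensor F x = 1"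
      by (rule eventually_mono) (rule one)
  qed (use \<Gamma>0 regular_compact_cube[OF r(1)] r \<Omega> tensor_in_D_roumieu[OF \<tau> \<sigma> gev smooth supp] in auto)
qed

lemma decay_imp_not_in_WF:
  fixes U :: "(real^'n::finite) set"
  assumes U: "open U" and u: "distribution U u" and \<tau>: "\<tau> > 0" and \<sigma>: "\<sigma> > 1"
    and x0: "x\<^sub>0 \<in> U" and \<Gamma>: "conic_nhd \<xi>\<^sub>0 \<Gamma>" and K: "regular_compact K" "K \<subseteq> U"
    and \<phi>: "\<phi> \<in> D_roumieu \<tau> \<sigma> K" "\<forall>\<^sub>F x in nhds x\<^sub>0. \<phi> x = 1"
    and A: "A > 0" "h > 0" "\<And>N \<xi>. \<xi> \<in> \<Gamma> \<Longrightarrow> norm (fourier U (mult_dist \<phi> u) \<xi>) \<le>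
      A * (h powr (real N powr \<sigma>) * M_seq \<tau> \<sigma> N) / norm \<xi> ^ N"
  shows "(x\<^sub>0, \<xi>\<^sub>0) \<notin> WF \<tau> \<sigma> U u"
proof -
  have s: "smooth_on UNIV \<phi>" "supp \<phi> \<subseteq> K"
    using \<phi>(1) by (auto simp: D_roumieu_def D_h_def)
  have "compact (supp \<phi>)"
    using s(2) K(1) by (metis regular_compact_def closed_supp compact_Int_closed inf.absorb_iff2)
  then have test: "\<phi> \<in> test_functions U" using s K by (auto simp: test_functions_def)
  obtain S where S: "open S" "x\<^sub>0 \<in> S" "\<And>x. x \<in> S \<Longrightarrow> \<phi> x = 1"
    using \<phi>(2) by (auto simp: eventually_nhds)
  \<comment> \<open>The neighbourhood on which \<phi> equals 1 may leave \<open>U\<close>, whereas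
    the definition of the wave front set asks for a subset of \<open>U\<close>.\<close>
  define \<Omega> where "\<Omega> = S \<inter> U"
  have eq: "equal_on \<Omega> (mult_dist \<phi> u) u"
    unfolding equal_on_def mult_dist_def
  proof
    fix \<psi> assume "\<psi> \<in> test_functions \<Omega>"
    then have "\<phi> x * \<psi> x = \<psi> x" for x
      using test_functionsD(3)[of \<psi> \<Omega>] notin_supp[of x \<psi>] S(3)[of x] by (auto simp: \<Omega>_def)
    then show "u (\<lambda>x. \<phi> x * \<psi> x) = u \<psi>" by presburger
  qed
  \<comment> \<open>The decay hypothesis is used at order floor(N^(1/\<sigma>)); \<open>A\<close> is
    kept, and \<open>h\<close> is enlarged as \<open>M_seq_floor_root_le\<close> demands.\<close>
  have "norm (fourier U (mult_dist \<phi> u) \<eta>) \<le>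
      A * ((max 1 h * exp (\<tau> / \<sigma>)) ^ N * fact N powr (\<tau> / \<sigma>)) / norm \<eta> ^ nat \<lfloor>real N powr (1 / \<sigma>)\<rfloor>"
    if "\<eta> \<in> \<Gamma>" for N \<eta>
    by (rule order_trans[OF A(3)[OF that, of "nat \<lfloor>real N powr (1 / \<sigma>)\<rfloor>"]])
      (use A in \<open>intro divide_right_mono mult_left_mono M_seq_floor_root_le[OF \<tau> \<sigma>]; simp\<close>)
  moreover have "open \<Omega>" "x\<^sub>0 \<in> \<Omega>" "\<Omega> \<subseteq> U" using S U x0 by (auto simp: \<Omega>_def)
  moreover have "max 1 h * exp (\<tau> / \<sigma>) > 0" by simp
  ultimately show ?thesis
    using A(1) \<Gamma> eq mult_dist_bounded[OF U u test] unfolding WF_def by blast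
qed

theorem theorem3p1:
  fixes U :: "(real^'n::finite) set"
    and u :: "'n functional"
    and \<tau> \<sigma> :: real
    and x\<^sub>0 \<xi>\<^sub>0 :: "real^'n"
  assumes "open U" and "distribution U u"
    and "\<tau> > 0" and "\<sigma> > 1"
    and "x\<^sub>0 \<in> U" and "\<xi>\<^sub>0 \<noteq> 0"
  shows "(x\<^sub>0, \<xi>\<^sub>0) \<notin> WF \<tau> \<sigma> U u \<longleftrightarrow>
    (\<exists>\<Gamma>\<^sub>0 K \<phi>. conic_nhd \<xi>\<^sub>0 \<Gamma>\<^sub>0 \<and> regular_compact K \<and> K \<subseteq> U \<and>
       \<phi> \<in> D_roumieu \<tau> \<sigma> K \<and> (\<forall>\<^sub>F x in nhds x\<^sub>0. \<phi> x = 1) \<and>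
       (\<exists>A>0. \<exists>h>0. \<forall>N. \<forall>\<xi>\<in>\<Gamma>\<^sub>0.
          norm (fourier U (mult_dist \<phi> u) \<xi>) \<le>
            A * (h powr (real N powr \<sigma>) * M_seq \<tau> \<sigma> N) / norm \<xi> ^ N))"
proof
  assume "(x\<^sub>0, \<xi>\<^sub>0) \<notin> WF \<tau> \<sigma> U u"
  then obtain \<Omega> \<Gamma> v A h where "open \<Omega>" "x\<^sub>0 \<in> \<Omega>" "\<Omega> \<subseteq> U" "conic_nhd \<xi>\<^sub>0 \<Gamma>"
      "bounded_compact_seq U v" "\<forall>N. equal_on \<Omega> (v N) u" "A > 0" "h > 0"
      "\<forall>N. \<forall>\<eta>\<in>\<Gamma>. norm (fourier U (v N) \<eta>) \<le>
        A * (h ^ N * fact N powr (\<tau> / \<sigma>)) / norm \<eta> ^ nat \<lfloor>real N powr (1 / \<sigma>)\<rfloor>"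
    using assms(5,6) unfolding WF_def by blast
  then show "\<exists>\<Gamma>\<^sub>0 K \<phi>. conic_nhd \<xi>\<^sub>0 \<Gamma>\<^sub>0 \<and> regular_compact K \<and> K \<subseteq> U \<and>
       \<phi> \<in> D_roumieu \<tau> \<sigma> K \<and> (\<forall>\<^sub>F x in nhds x\<^sub>0. \<phi> x = 1) \<and>
       (\<exists>A>0. \<exists>h>0. \<forall>N. \<forall>\<xi>\<in>\<Gamma>\<^sub>0.
          norm (fourier U (mult_dist \<phi> u) \<xi>) \<le>
            A * (h powr (real N powr \<sigma>) * M_seq \<tau> \<sigma> N) / norm \<xi> ^ N)"
    by (intro not_in_WF_imp_decay[OF assms(1-4,6), where \<Omega> = \<Omega> and \<Gamma> = \<Gamma> and v = v and A = A and h = h]) auto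
next
  assume "\<exists>\<Gamma>\<^sub>0 K \<phi>. conic_nhd \<xi>\<^sub>0 \<Gamma>\<^sub>0 \<and> regular_compact K \<and> K \<subseteq> U \<and>
       \<phi> \<in> D_roumieu \<tau> \<sigma> K \<and> (\<forall>\<^sub>F x in nhds x\<^sub>0. \<phi> x = 1) \<and>
       (\<exists>A>0. \<exists>h>0. \<forall>N. \<forall>\<xi>\<in>\<Gamma>\<^sub>0.
          norm (fourier U (mult_dist \<phi> u) \<xi>) \<le>
            A * (h powr (real N powr \<sigma>) * M_seq \<tau> \<sigma> N) / norm \<xi> ^ N)"
  then show "(x\<^sub>0, \<xi>\<^sub>0) \<notin> WF \<tau> \<sigma> U u"
    using decay_imp_not_in_WF[OF assms(1-5)] by (elim exE conjE) meson
qed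

end
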